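(* Let $m,n$ be positive integers, let $\theta=\frac{\max\{n+1,m+2\}}{m}$, and let $\Phi:\mathbb{N}\to(0,\infty)$ satisfy $\Phi(t)\le t^{-n/m}$ for $t\ge1$, with $\tau=\liminf_{t\to\infty}\frac{-\log\Phi(t)}{\log t}$. (a) If $\tau>\theta$ and $\Phi$ is decreasing, then $\dim_H(Exact(\Phi))\ge m(n-1)+\frac{m+1}{1+\tau}$ (with the last fraction $0$ if $\tau=\infty$). (b) If $\tau>\max\{\theta,\frac{5+\sqrt{17}}{2}\}$ ($\Phi$ not necessarily decreasing), then $\dim_H(Exact(\Phi))\ge m(n-1)$ and $\dim_P(Exact(\Phi))=mn$.
   Context: All norms are maximum norms. For $\Psi:\mathbb{N}\to(0,\infty)$, $W(\Psi)$ is the set of real $m\times n$ matrices $A$ such that $\Vert A\mathbf{q}-\mathbf{p}\Vert\le\Psi(\Vert\mathbf{q}\Vert)$ for infinitely many $\mathbf{p}\in\mathbb{Z}^m$, $\mathbf{q}\in\mathbb{Z}^n\setminus\{0\}$. $Exact(\Phi)=W(\Phi)\setminus\bigcup_{c>1}W(\Phi/c)$, where $\Phi/c$ is $t\mapsto\Phi(t)/c$. Matrices are identified with $\mathbb{R}^{mn}$; $\dim_H,\dim_P$ are Hausdorff and packing dimension. *)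

theory Defs
  imports "HOL-Analysis.Analysis" "HOL-Library.Liminf_Limsup"
begin

definition maxnorm :: "real ^ 'k \<Rightarrow> real" where
  "maxnorm v = Max (range (\<lambda>i. \<bar>v $ i\<bar>))"

definition imaxnorm :: "int ^ 'k \<Rightarrow> int" where
  "imaxnorm v = Max (range (\<lambda>i. \<bar>v $ i\<bar>))"

definition rvec :: "int ^ 'k \<Rightarrow> real ^ 'k" where
  "rvec v = (\<chi> i. real_of_int (v $ i))"

text \<open>m x n real matrices are elements of real^'n^'m (CARD('m) = m rows, CARD('n) = n columns).\<close>

definition W :: "(nat \<Rightarrow> real) \<Rightarrow> (real ^ 'n ^ 'm) set" where
  "W Psi = {A. infinite {(p :: int ^ 'm, q :: int ^ 'n).
                 q \<noteq> 0 \<and> maxnorm (A *v rvec q - rvec p) \<le> Psi (nat (imaxnorm q))}}"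

definition Exact :: "(nat \<Rightarrow> real) \<Rightarrow> (real ^ 'n ^ 'm) set" where
  "Exact Phi = W Phi - (\<Union>c\<in>{c::real. c > 1}. W (\<lambda>t. Phi t / c))"

definition hausdorff_content :: "real \<Rightarrow> real \<Rightarrow> 'a::metric_space set \<Rightarrow> ennreal" where
  "hausdorff_content s \<delta> E =
     (INF U \<in> {U :: nat \<Rightarrow> 'a set. E \<subseteq> (\<Union>i. U i) \<and> (\<forall>i. bounded (U i) \<and> diameter (U i) \<le> \<delta>)}.
        (\<Sum>i. ennreal (diameter (U i) powr s)))"

definition hausdorff_measure :: "real \<Rightarrow> 'a::metric_space set \<Rightarrow> ennreal" where
  "hausdorff_measure s E = (SUP \<delta> \<in> {0<..}. hausdorff_content s \<delta> E)"

definition hausdorff_dim :: "'a::metric_space set \<Rightarrow> ereal" where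
  "hausdorff_dim E = Inf {ereal s | s. 0 \<le> s \<and> hausdorff_measure s E = 0}"

definition covering_number :: "real \<Rightarrow> 'a::metric_space set \<Rightarrow> nat" where
  "covering_number \<delta> E = (LEAST k. \<exists>F. finite F \<and> card F = k \<and> E \<subseteq> (\<Union>x\<in>F. cball x \<delta>))"

definition upper_box_dim :: "'a::metric_space set \<Rightarrow> ereal" where
  "upper_box_dim E = (if bounded E
     then Limsup (at_right 0) (\<lambda>\<delta>. ereal (ln (real (covering_number \<delta> E)) / - ln \<delta>))
     else \<infinity>)"

definition packing_dim :: "'a::metric_space set \<Rightarrow> ereal" where
  "packing_dim E = (INF Es \<in> {Es :: nat \<Rightarrow> 'a set. E \<subseteq> (\<Union>i. Es i)}. SUP i. upper_box_dim (Es i))"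

end

theory Submission
  imports Defs "HOL-Real_Asymp.Real_Asymp"
begin

text \<open>
  Fix one column. By Borel--Cantelli, whatever the distinguished column \<open>y\<close> is, for almost every
  choice of the other \<open>n - 1\<close> columns only finitely many integer vectors \<open>q\<close> that are not supported
  on the distinguished coordinate satisfy \<open>\<parallel>A q - p\<parallel> \<le> \<Phi>(\<parallel>q\<parallel>)\<close>; this only needs \<open>m t > n + 1\<close> for an exponent \<open>t\<close> below \<open>\<tau>\<close>.
  So it suffices to find a large set of exactly approximable points \<open>y\<close> in \<open>m\<close>-space.

  Such points are limits of nested cubes. A cube belongs to a rational point \<open>p/q\<close> in lowest terms
  and consists of points whose distance to \<open>p/q\<close> in every coordinate is between \<open>(1 - \<epsilon>) d(q)\<close> and \<open>d(q)\<close>, where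
  \<open>d(q) = max\<^sub>j \<Phi>(j q) / (j q)\<close>: some multiple of \<open>(p, q)\<close> is then a solution for \<open>\<Phi>\<close>, and none is a
  solution for \<open>\<Phi>/c\<close> once \<open>(1 - \<epsilon>) c > 1\<close>, without any monotonicity of \<open>\<Phi>\<close>. Denominators in a middle range are harmless
  because distinct rationals repel each other; the remaining dangerous rationals have small
  measure inside the cube since \<open>m t > m + 2\<close>. Dirichlet's theorem applied outside the dangerous set provides about
  \<open>N\<^bsup>m(m+1)\<^esup>\<close> times the volume of the cube many \<open>N\<^bsup>-m-1\<^esup>\<close>-separated children with denominators comparable to \<open>N\<^bsup>m\<^esup>\<close>. Taking \<open>N\<close> very large
  at each step makes the natural measure on the Cantor set look like Lebesgue measure at the scales \<open>N\<^bsup>-m-1\<^esup>\<close>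
  (packing dimension) and, if \<open>\<Phi>\<close> is decreasing and \<open>\<Phi>(N\<^bsup>m\<^esup>)\<close> is about \<open>N\<^bsup>-m\<tau>\<^esup>\<close>, Hoelder continuous of every order below
  \<open>(m + 1)/(1 + \<tau>)\<close> (Hausdorff dimension).
\<close>

section \<open>Dimension bounds from measures\<close>

text \<open>The two entries of \<theta> have different sources. \<open>n + 1\<close> makes the sum
  of \<open>T powr (n - m t)\<close> converge in the Borel-Cantelli argument. \<open>m + 2\<close>
  is used against the dangerous rationals just beyond the safe range of a cube: around
  \<open>p/q\<close> with \<open>d = rad Phi q\<close> this range ends at
  \<open>Y = 1 / (2 q d)\<close>, while the cube has side comparable to \<open>d\<close>, far below
  the spacing \<open>1/Y\<close>. There boundary terms outweigh volume, and their share of the cube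
  is about \<open>q powr (m + 2 t - m t^2)\<close>, which tends to 0 if \<open>t > 1\<close> and
  \<open>m t > m + 2\<close>. The exponent \<open>(m + 1) / (1 + \<tau>)\<close> balances the number
  of children, about \<open>N powr (m (m + 1))\<close>, against the side of a child cube, about
  \<open>N powr (-m (1 + \<tau>))\<close>. As \<tau> is a lower limit, the lower bound on
  \<open>Phi\<close> behind this side holds only for infinitely many \<open>N\<close>; every other
  requirement is therefore proved for all large \<open>N\<close>. Monotonicity turns a lower bound
  at one argument into one for all denominators up to \<open>N ^ m\<close>. For general
  \<open>Phi\<close> the sides are uncontrolled, and the construction is run with Hoelder exponent
  \<open>S = 0\<close>.\<close>

text \<open>Mass distribution principle for the image of \<open>M\<close> under \<open>A\<close>.
  Preimages of balls are enclosed in measurable sets \<open>R\<close>, so measurability of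
  \<open>A\<close> never has to be discussed.\<close>

lemma hausdorff_dim_ge:
  fixes A :: "'b \<Rightarrow> 'a::metric_space"
  assumes G: "G \<in> sets M" "emeasure M G > 0" and AG: "A ` G \<subseteq> E" and C: "C > 0"
    and cover: "\<And>x r. 0 < r \<Longrightarrow> \<exists>R\<in>sets M. {b\<in>G. A b \<in> cball x r} \<subseteq> R \<and> emeasure M R \<le> ennreal (C * r powr s)"
  shows "hausdorff_dim E \<ge> ereal s"
  unfolding hausdorff_dim_def
proof (rule Inf_greatest, clarify)
  fix t :: real assume t: "0 \<le> t" "hausdorff_measure t E = 0"
  show "ereal s \<le> ereal t"
  proof (rule ccontr)
    assume "\<not> ereal s \<le> ereal t"
    then have ts: "t < s" by simp
    obtain g where g: "0 < g" "ennreal g < emeasure M G"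
    proof (cases "emeasure M G")
      case (real g')
      then show ?thesis using G(2) that[of "g'/2"] by (auto simp: ennreal_less_iff)
    next
      case top
      then show ?thesis using that[of 1] by simp
    qed
    \<comment> \<open>\<open>e\<close> bounds both the weighted sum over the cover and the total
      allowance for degenerate sets, so that \<open>C * e + e = g\<close> contradicts
      \<open>g < emeasure M G\<close>.\<close>
    define e where "e = g / (C + 1)"
    have e: "e > 0" using g C by (simp add: e_def)
    have "hausdorff_content t 1 E \<le> hausdorff_measure t E"
      unfolding hausdorff_measure_def by (rule SUP_upper) simp
    then have "hausdorff_content t 1 E < ennreal e" using t e by simp
    then obtain U :: "nat \<Rightarrow> 'a set" where U: "E \<subseteq> (\<Union>i. U i)" "\<And>i. bounded (U i)" "\<And>i. diameter (U i) \<le> 1"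
      and sum: "(\<Sum>i. ennreal (diameter (U i) powr t)) < ennreal e"
      unfolding hausdorff_content_def INF_less_iff by auto
    have "\<exists>R\<in>sets M. {b\<in>G. A b \<in> U i} \<subseteq> R \<and>
       emeasure M R \<le> ennreal C * ennreal (diameter (U i) powr t) + ennreal (e * (1/2)^Suc i)" for i
    proof (cases "U i = {}")
      case True then show ?thesis by (intro bexI[of _ "{}"]) auto
    next
      case False
      then obtain x where x: "x \<in> U i" by auto
      have sub: "U i \<subseteq> cball x (diameter (U i))"
        using diameter_bounded_bound[OF U(2) x] by auto
      show ?thesis
      proof (cases "diameter (U i) > 0")
        case True
        obtain R where R: "R \<in> sets M" "{b\<in>G. A b \<in> cball x (diameter (U i))} \<subseteq> R"
          "emeasure M R \<le> ennreal (C * diameter (U i) powr s)" using cover[OF True] by blast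
        have "diameter (U i) powr s \<le> diameter (U i) powr t"
          using True U(3)[of i] ts by (intro powr_mono') auto
        then have "ennreal (C * diameter (U i) powr s) \<le> ennreal C * ennreal (diameter (U i) powr t)"
          using C by (subst ennreal_mult[symmetric]) (auto intro!: ennreal_leI)
        then have "emeasure M R \<le> ennreal C * ennreal (diameter (U i) powr t) + ennreal (e * (1/2)^Suc i)"
          by (intro add_increasing2[OF zero_le] order_trans[OF R(3)])
        moreover have "{b\<in>G. A b \<in> U i} \<subseteq> R" using R(2) sub by blast
        ultimately show ?thesis using R(1) by blast
      next
        case False
        \<comment> \<open>\<open>0 powr t = 0\<close> even for \<open>t = 0\<close>, so single points cost nothing in the cover.\<close>
        define r where "r = (e * (1/2)^Suc i / C) powr (1/s)"
        have r: "r > 0" using e C by (simp add: r_def)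
        have rs: "C * r powr s = e * (1/2)^Suc i" using ts t e C by (simp add: r_def powr_powr)
        obtain R where R: "R \<in> sets M" "{b\<in>G. A b \<in> cball x r} \<subseteq> R"
          "emeasure M R \<le> ennreal (C * r powr s)" using cover[OF r] by blast
        have "U i \<subseteq> cball x r" using sub subset_cball[of "diameter (U i)" r x] False r by auto
        then have "{b\<in>G. A b \<in> U i} \<subseteq> R" using R(2) by blast
        moreover have "emeasure M R \<le> ennreal C * ennreal (diameter (U i) powr t) + ennreal (e * (1/2)^Suc i)"
          using R(3) unfolding rs by (rule add_increasing[OF zero_le])
        ultimately show ?thesis using R(1) by blast
      qed
    qed
    then have "\<forall>i. \<exists>R. R \<in> sets M \<and> {b\<in>G. A b \<in> U i} \<subseteq> R \<and>
       emeasure M R \<le> ennreal C * ennreal (diameter (U i) powr t) + ennreal (e * (1/2)^Suc i)" by (simp only: Bex_def) simp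
    from choice[OF this] obtain R where R': "\<forall>i. R i \<in> sets M \<and> {b\<in>G. A b \<in> U i} \<subseteq> R i \<and>
       emeasure M (R i) \<le> ennreal C * ennreal (diameter (U i) powr t) + ennreal (e * (1/2)^Suc i)" ..
    then have R: "R i \<in> sets M" "{b\<in>G. A b \<in> U i} \<subseteq> R i"
       "emeasure M (R i) \<le> ennreal C * ennreal (diameter (U i) powr t) + ennreal (e * (1/2)^Suc i)" for i
      by (simp_all only:)
    have "G \<subseteq> (\<Union>i. R i)"
    proof
      fix b assume "b \<in> G"
      then obtain i where "A b \<in> U i" using AG U(1) by blast
      then show "b \<in> (\<Union>i. R i)" using R(2)[of i] \<open>b \<in> G\<close> by blast
    qed
    then have "emeasure M G \<le> emeasure M (\<Union>i. R i)" using R(1) by (intro emeasure_mono) auto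
    also have "\<dots> \<le> (\<Sum>i. emeasure M (R i))" using R(1) by (intro emeasure_subadditive_countably) auto
    also have "\<dots> \<le> (\<Sum>i. ennreal C * ennreal (diameter (U i) powr t) + ennreal (e * (1/2)^Suc i))"
      by (intro suminf_le R) auto
    also have "\<dots> = ennreal C * (\<Sum>i. ennreal (diameter (U i) powr t)) + (\<Sum>i. ennreal (e * (1/2)^Suc i))"
      by (subst suminf_add[symmetric]) auto
    also have "(\<Sum>i. ennreal (e * (1/2)^Suc i)) = ennreal e"
      using sums_mult[OF power_half_series, of e] e by (intro suminf_ennreal_eq) auto
    also have "ennreal C * (\<Sum>i. ennreal (diameter (U i) powr t)) \<le> ennreal C * ennreal e"
      using sum by (intro mult_left_mono) auto
    also have "ennreal C * ennreal e + ennreal e = ennreal g"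
    proof -
      have "C * e + e = (C + 1) * e" by (simp add: algebra_simps)
      also have "\<dots> = g" using C by (simp add: e_def)
      finally have "C * e + e = g" .
      then show ?thesis using C e by (simp flip: ennreal_mult ennreal_plus)
    qed
    finally show False using g by simp
  qed
qed

text \<open>Upper box dimension is a limsup, so an upper bound on it controls covering numbers at
  all small radii; a mass bound at some arbitrarily small radii therefore suffices. Each piece of
  box dimension below \<open>d\<close> has a null preimage, and countably many such pieces cannot
  cover \<open>G\<close>.\<close>

lemma packing_dim_ge:
  fixes A :: "'b \<Rightarrow> 'a::heine_borel"
  assumes G: "G \<in> sets M" "emeasure M G > 0" and AG: "A ` G \<subseteq> E"
    and cover: "\<And>e r0. 0 < e \<Longrightarrow> 0 < r0 \<Longrightarrow> \<exists>r>0. r < r0 \<and> (\<forall>x. \<exists>R\<in>sets M. {b\<in>G. A b \<in> cball x r} \<subseteq> R \<and>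
                  emeasure M R \<le> ennreal (r powr (d - e)))"
  shows "packing_dim E \<ge> ereal d"
  unfolding packing_dim_def
proof (rule INF_greatest, clarify)
  fix Es :: "nat \<Rightarrow> 'a set" assume Es: "E \<subseteq> (\<Union>i. Es i)"
  show "ereal d \<le> (SUP i. upper_box_dim (Es i))"
  proof (rule ccontr)
    assume "\<not> ?thesis"
    then have "(SUP i. upper_box_dim (Es i)) < ereal d" by simp
    then obtain t where t: "(SUP i. upper_box_dim (Es i)) < ereal t" "t < d"
      by (meson ereal_dense2 less_ereal.simps(1))
    \<comment> \<open>Half the gap: \<open>r powr (-t)\<close> balls of mass
      \<open>r powr (d - e)\<close> have total mass \<open>r powr e\<close>, which tends to
      0.\<close>
    define e where "e = (d - t) / 2"
    have e: "e > 0" using t by (simp add: e_def)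
    have null: "\<exists>R\<in>null_sets M. {b\<in>G. A b \<in> Es i} \<subseteq> R" for i
    proof -
      have ub: "upper_box_dim (Es i) < ereal t" using t(1) by (meson SUP_upper UNIV_I order.strict_trans1)
      then have bd: "bounded (Es i)" unfolding upper_box_dim_def by (auto split: if_splits)
      have "Limsup (at_right 0) (\<lambda>\<delta>. ereal (ln (real (covering_number \<delta> (Es i))) / - ln \<delta>)) < ereal t"
        using ub bd unfolding upper_box_dim_def by simp
      then have "eventually (\<lambda>\<delta>. ereal (ln (real (covering_number \<delta> (Es i))) / - ln \<delta>) < ereal t) (at_right 0)"
        by (rule Limsup_lessD)
      then obtain d0 where d0: "d0 > 0" "\<And>\<delta>. 0 < \<delta> \<Longrightarrow> \<delta> < d0 \<Longrightarrow> ln (real (covering_number \<delta> (Es i))) / - ln \<delta> < t"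
        unfolding eventually_at_right_field by auto
      have small: "\<exists>R\<in>sets M. {b\<in>G. A b \<in> Es i} \<subseteq> R \<and> emeasure M R \<le> ennreal h" if h: "h > 0" for h
      proof -
        define r0 where "r0 = min (min d0 (1/2)) (h powr (1/e))"
        have "r0 > 0" using d0 h by (simp add: r0_def)
        from cover[OF e this] obtain r where r: "r > 0" "r < r0" and
          cov: "\<forall>x. \<exists>R\<in>sets M. {b\<in>G. A b \<in> cball x r} \<subseteq> R \<and> emeasure M R \<le> ennreal (r powr (d - e))"
          by (elim exE conjE) (rule that)
        from cov[unfolded Bex_def, THEN choice] obtain R where
          R': "\<forall>x. R x \<in> sets M \<and> {b\<in>G. A b \<in> cball x r} \<subseteq> R x \<and> emeasure M (R x) \<le> ennreal (r powr (d - e))" ..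
        then have R: "R x \<in> sets M" "{b\<in>G. A b \<in> cball x r} \<subseteq> R x" "emeasure M (R x) \<le> ennreal (r powr (d - e))" for x
          by (simp_all only:)
        have "\<exists>k F. finite F \<and> card F = k \<and> Es i \<subseteq> (\<Union>x\<in>F. cball x r)"
        proof -
          have "compact (closure (Es i))" using bd by (simp add: compact_closure)
          then obtain F where F: "finite F" "closure (Es i) \<subseteq> (\<Union>x\<in>F. ball x r)"
            using r unfolding compact_eq_totally_bounded by blast
          have "(\<Union>x\<in>F. ball x r) \<subseteq> (\<Union>x\<in>F. cball x r)" by auto
          then have "Es i \<subseteq> (\<Union>x\<in>F. cball x r)" using F(2) closure_subset[of "Es i"] by (meson subset_trans)
          then show ?thesis using F(1) by blast
        qed
        then have "\<exists>F. finite F \<and> card F = covering_number r (Es i) \<and> Es i \<subseteq> (\<Union>x\<in>F. cball x r)"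
          unfolding covering_number_def by (rule LeastI_ex)
        then obtain F where F: "finite F" "card F = covering_number r (Es i)" "Es i \<subseteq> (\<Union>x\<in>F. cball x r)" by blast
        have cF: "real (card F) \<le> r powr (-t)"
        proof (cases "card F = 0")
          case True then show ?thesis by simp
        next
          case False
          have "ln r < 0" using r by (simp add: r0_def)
          moreover have "ln (real (card F)) / - ln r < t" using d0(2)[of r] r F(2) by (simp add: r0_def)
          ultimately have "ln (real (card F)) < t * (- ln r)" by (simp add: field_simps)
          then have "ln (real (card F)) < ln (r powr (-t))" using r by (simp add: ln_powr)
          moreover have "r powr (-t) > 0" "real (card F) > 0" using r False by auto
          ultimately show ?thesis by (metis ln_less_cancel_iff less_imp_le)
        qed
        have "{b\<in>G. A b \<in> Es i} \<subseteq> (\<Union>x\<in>F. R x)"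
        proof
          fix b assume b: "b \<in> {b\<in>G. A b \<in> Es i}"
          then obtain x where "x \<in> F" "A b \<in> cball x r" using F(3) by blast
          then show "b \<in> (\<Union>x\<in>F. R x)" using R(2)[of x] b by blast
        qed
        moreover have "emeasure M (\<Union>x\<in>F. R x) \<le> ennreal h"
        proof -
          have "emeasure M (\<Union>x\<in>F. R x) \<le> (\<Sum>x\<in>F. emeasure M (R x))"
            using F R by (intro emeasure_subadditive_finite) auto
          also have "\<dots> \<le> (\<Sum>x\<in>F. ennreal (r powr (d - e)))" by (intro sum_mono R)
          also have "\<dots> = ennreal (real (card F) * r powr (d - e))" by (simp add: ennreal_mult ennreal_of_nat_eq_real_of_nat)
          also have "\<dots> \<le> ennreal (r powr (-t) * r powr (d - e))" using cF by (intro ennreal_leI mult_right_mono) auto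
          also have "r powr (-t) * r powr (d - e) = r powr e" by (simp add: powr_add[symmetric] e_def field_simps)
          also have "ennreal (r powr e) \<le> ennreal ((h powr (1/e)) powr e)"
            using r e by (intro ennreal_leI powr_mono2) (auto simp: r0_def)
          also have "(h powr (1/e)) powr e = h" using e h by (simp add: powr_powr)
          finally show ?thesis .
        qed
        ultimately show ?thesis using F R(1) by (intro bexI[of _ "\<Union>x\<in>F. R x"]) auto
      qed
      have "\<forall>n. \<exists>R\<in>sets M. {b\<in>G. A b \<in> Es i} \<subseteq> R \<and> emeasure M R \<le> ennreal (inverse (real (Suc n)))"
        by (intro allI small) simp
      from this[unfolded Bex_def, THEN choice] obtain R where
        R': "\<forall>n. R n \<in> sets M \<and> {b\<in>G. A b \<in> Es i} \<subseteq> R n \<and> emeasure M (R n) \<le> ennreal (inverse (real (Suc n)))" ..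
      then have R: "R n \<in> sets M" "{b\<in>G. A b \<in> Es i} \<subseteq> R n" "emeasure M (R n) \<le> ennreal (inverse (real (Suc n)))" for n
        by (simp_all only:)
      have "emeasure M (\<Inter>n. R n) \<le> ennreal (inverse (real (Suc n)))" for n
      proof -
        have "emeasure M (\<Inter>n. R n) \<le> emeasure M (R n)" using R(1) by (intro emeasure_mono) auto
        then show ?thesis using R(3)[of n] by simp
      qed
      then have "emeasure M (\<Inter>n. R n) \<le> 0"
      proof -
        have "(\<lambda>n. ennreal (inverse (real (Suc n)))) \<longlonglongrightarrow> ennreal 0"
          using LIMSEQ_inverse_real_of_nat by (rule tendsto_ennrealI)
        then show ?thesis using \<open>\<And>n. emeasure M (\<Inter>n. R n) \<le> ennreal (inverse (real (Suc n)))\<close>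
          by (intro LIMSEQ_le_const[of _ 0]) auto
      qed
      then have "(\<Inter>n. R n) \<in> null_sets M" using R(1) by (intro null_setsI) auto
      moreover have "{b\<in>G. A b \<in> Es i} \<subseteq> (\<Inter>n. R n)" by (rule INT_greatest) (rule R(2))
      ultimately show ?thesis by (rule bexI[rotated])
    qed
    then have "\<forall>i. \<exists>R. R \<in> null_sets M \<and> {b\<in>G. A b \<in> Es i} \<subseteq> R" by (simp only: Bex_def) simp
    from choice[OF this] obtain R where R': "\<forall>i. R i \<in> null_sets M \<and> {b\<in>G. A b \<in> Es i} \<subseteq> R i" ..
    then have R: "R i \<in> null_sets M" "{b\<in>G. A b \<in> Es i} \<subseteq> R i" for i by (simp_all only:)
    have "(\<Union>i. R i) \<in> null_sets M" using R(1) by blast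
    moreover have "G \<subseteq> (\<Union>i. R i)"
    proof
      fix b assume "b \<in> G"
      then obtain i where "A b \<in> Es i" using AG Es by blast
      then show "b \<in> (\<Union>i. R i)" using R(2)[of i] \<open>b \<in> G\<close> by blast
    qed
    ultimately have "emeasure M G = 0" using G(1) by (metis null_setsD1 null_sets_subset)
    then show False using G by simp
  qed
qed

section \<open>Counting separated points; the upper bound for packing dimension\<close>

text \<open>Volume comparison: the balls of radius \<open>e/2\<close> around the points are disjoint
  and lie in a ball of radius \<open>R + e/2\<close>.\<close>

lemma card_separated_le:
  fixes Z :: "'a::euclidean_space set"
  assumes "finite Z" and sep: "\<And>x y. x \<in> Z \<Longrightarrow> y \<in> Z \<Longrightarrow> x \<noteq> y \<Longrightarrow> e \<le> dist x y"
    and sub: "Z \<subseteq> cball c R" and e: "0 < e" and R: "0 \<le> R"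
  shows "real (card Z) \<le> ((R + e/2) / (e/2)) ^ DIM('a)"
proof -
  let ?v = "unit_ball_vol (real DIM('a))"
  have v: "?v > 0" by simp
  have fin: "emeasure lborel (ball z r) < top" for z :: 'a and r
    using emeasure_lborel_ball_finite[of z r] by simp
  have "disjoint_family_on (\<lambda>z. ball z (e/2)) Z"
    unfolding disjoint_family_on_def
  proof (intro ballI impI)
    fix x y assume *: "x \<in> Z" "y \<in> Z" "x \<noteq> y"
    show "ball x (e/2) \<inter> ball y (e/2) = {}"
    proof (rule ccontr)
      assume "ball x (e/2) \<inter> ball y (e/2) \<noteq> {}"
      then obtain z where "dist x z < e/2" "dist y z < e/2" by auto
      then have "dist x y < e" using dist_triangle2[of x y z] by simp
      then show False using sep[OF *] by simp
    qed
  qed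
  then have "measure lborel (\<Union>z\<in>Z. ball z (e/2)) = (\<Sum>z\<in>Z. measure lborel (ball z (e/2)))"
    using assms(1) by (intro measure_finite_Union) (auto dest: less_imp_neq[OF fin, THEN notE])
  also have "\<dots> = real (card Z) * (?v * (e/2) ^ DIM('a))"
    using e by (simp add: content_ball)
  finally have 1: "measure lborel (\<Union>z\<in>Z. ball z (e/2)) = real (card Z) * (?v * (e/2) ^ DIM('a))" .
  have "(\<Union>z\<in>Z. ball z (e/2)) \<subseteq> ball c (R + e/2)"
  proof clarify
    fix z x assume "z \<in> Z" "x \<in> ball z (e/2)"
    then have "dist c z \<le> R" "dist z x < e/2" using sub by auto
    then show "x \<in> ball c (R + e/2)" using dist_triangle[of c x z] by simp
  qed
  then have "measure lborel (\<Union>z\<in>Z. ball z (e/2)) \<le> measure lborel (ball c (R + e/2))"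
    by (intro measure_mono_fmeasurable) (auto intro!: fmeasurableI borel_open open_UN fin)
  also have "\<dots> = ?v * (R + e/2) ^ DIM('a)" using e R by (simp add: content_ball)
  finally have "real (card Z) * (?v * (e/2) ^ DIM('a)) \<le> ?v * (R + e/2) ^ DIM('a)" using 1 by simp
  then have "?v * (real (card Z) * (e/2) ^ DIM('a)) \<le> ?v * (R + e/2) ^ DIM('a)" by (simp add: algebra_simps)
  then have "real (card Z) * (e/2) ^ DIM('a) \<le> (R + e/2) ^ DIM('a)" using v by (simp only: mult_le_cancel_left_pos)
  then have "real (card Z) \<le> (R + e/2) ^ DIM('a) / (e/2) ^ DIM('a)" using e by (simp add: pos_le_divide_eq)
  then show ?thesis by (simp only: power_divide)
qed

text \<open>The volume bound caps the cardinality of separated subsets, so one of maximal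
  cardinality exists; a point far from all its members could be added to it.\<close>

lemma maximal_separated_exists:
  fixes S :: "'a::euclidean_space set"
  assumes "bounded S" "0 < e"
  obtains Z where "finite Z" "Z \<subseteq> S" "\<And>x y. x \<in> Z \<Longrightarrow> y \<in> Z \<Longrightarrow> x \<noteq> y \<Longrightarrow> e \<le> dist x y"
    "\<And>x. x \<in> S \<Longrightarrow> \<exists>z\<in>Z. dist x z < e"
proof -
  obtain R where R: "R \<ge> 0" "S \<subseteq> cball 0 R"
    using assms(1)
  proof -
    obtain a where "\<forall>x\<in>S. norm x \<le> a" using assms(1) unfolding bounded_iff by blast
    then have "S \<subseteq> cball 0 \<bar>a\<bar>" by force
    then show ?thesis using that[of "\<bar>a\<bar>"] by simp
  qed
  let ?P = "\<lambda>Z. finite Z \<and> Z \<subseteq> S \<and> (\<forall>x\<in>Z. \<forall>y\<in>Z. x \<noteq> y \<longrightarrow> e \<le> dist x y)"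
  let ?B = "((R + e/2) / (e/2)) ^ DIM('a)"
  have bound: "card Z \<le> nat \<lfloor>?B\<rfloor>" if "?P Z" for Z
  proof -
    have "real (card Z) \<le> ?B" using that R assms(2) by (intro card_separated_le[where c = 0]) auto
    then show ?thesis by linarith
  qed
  obtain Z where Z: "?P Z" "\<And>Y. ?P Y \<Longrightarrow> card Y \<le> card Z"
    using ex_has_greatest_nat[of ?P "{}" card "Suc (nat \<lfloor>?B\<rfloor>)"] bound[THEN le_imp_less_Suc] by auto
  have "\<exists>z\<in>Z. dist x z < e" if x: "x \<in> S" for x
  proof (rule ccontr)
    assume "\<not> ?thesis"
    then have far: "\<forall>z\<in>Z. e \<le> dist x z" by auto
    then have "x \<notin> Z" using assms(2) by auto
    have "?P (insert x Z)" using Z(1) far x by (auto simp: dist_commute)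
    then have "card (insert x Z) \<le> card Z" by (rule Z(2))
    then show False using Z(1) \<open>x \<notin> Z\<close> by simp
  qed
  then show ?thesis using Z(1) by (intro that[of Z]) auto
qed

lemma upper_box_dim_cball_le:
  fixes c :: "'a::euclidean_space"
  assumes R: "0 \<le> R"
  shows "upper_box_dim (cball c R) \<le> ereal (real DIM('a))"
proof -
  \<comment> \<open>The volume bound is \<open>(2 * R + d) / d \<le> C / d\<close> for
    \<open>d < 1\<close>. Moreover \<open>ln C \<ge> 0\<close>, which settles the formal case of
    covering number 0, where \<open>ln 0 = 0\<close>.\<close>
  define C where "C = 2 * R + 2"
  have C: "C > 0" using R by (simp add: C_def)
  let ?D = "real DIM('a)"
  have le: "ln (real (covering_number d (cball c R))) / - ln d \<le> ?D * (ln C - ln d) / (- ln d)"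
    if d: "0 < d" "d < 1" for d :: real
  proof -
    obtain Z where Z: "finite Z" "Z \<subseteq> cball c R" "\<And>x y. x \<in> Z \<Longrightarrow> y \<in> Z \<Longrightarrow> x \<noteq> y \<Longrightarrow> d \<le> dist x y"
      "\<And>x. x \<in> cball c R \<Longrightarrow> \<exists>z\<in>Z. dist x z < d"
      using maximal_separated_exists[OF bounded_cball d(1)] by metis
    have "cball c R \<subseteq> (\<Union>z\<in>Z. cball z d)"
    proof
      fix x assume "x \<in> cball c R"
      then obtain z where "z \<in> Z" "dist x z < d" using Z(4) by blast
      then show "x \<in> (\<Union>z\<in>Z. cball z d)" by (auto simp: dist_commute intro!: bexI[of _ z])
    qed
    then have "covering_number d (cball c R) \<le> card Z"
      unfolding covering_number_def using Z(1) by (intro Least_le) blast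
    then have "real (covering_number d (cball c R)) \<le> real (card Z)" by simp
    also have "\<dots> \<le> ((R + d/2) / (d/2)) ^ DIM('a)"
      using Z d R by (intro card_separated_le[where c = c]) auto
    also have "\<dots> \<le> (C / d) ^ DIM('a)"
      using d R by (intro power_mono) (auto simp: C_def field_simps)
    finally have cov: "real (covering_number d (cball c R)) \<le> (C / d) ^ DIM('a)" .
    have "ln (real (covering_number d (cball c R))) \<le> ?D * (ln C - ln d)"
    proof (cases "covering_number d (cball c R) = 0")
      case True
      have "ln C \<ge> 0" "ln d \<le> 0" using R d by (auto simp: C_def)
      then show ?thesis using True by simp
    next
      case False
      then have "ln (real (covering_number d (cball c R))) \<le> ln ((C / d) ^ DIM('a))"
        using cov d C by (subst ln_le_cancel_iff) auto
      also have "\<dots> = ?D * (ln C - ln d)" using C d by (simp add: ln_realpow ln_div)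
      finally show ?thesis .
    qed
    then show ?thesis using d by (intro divide_right_mono) (auto simp: ln_less_zero less_imp_le)
  qed
  have ev: "eventually (\<lambda>d. ereal (ln (real (covering_number d (cball c R))) / - ln d)
         \<le> ereal (?D * (ln C - ln d) / (- ln d))) (at_right 0)"
    unfolding eventually_at_right_field using le by (intro exI[of _ 1]) auto
  have "((\<lambda>d. ?D * (ln C - ln d) / (- ln d)) \<longlongrightarrow> ?D) (at_right 0)"
    by real_asymp
  then have "Limsup (at_right 0) (\<lambda>d. ereal (?D * (ln C - ln d) / (- ln d))) = ereal ?D"
    by (intro lim_imp_Limsup) auto
  then show ?thesis using Limsup_mono[OF ev] unfolding upper_box_dim_def by simp
qed

text \<open>\<open>upper_box_dim\<close> is infinite on unbounded sets, hence the exhaustion by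
  balls.\<close>

lemma packing_dim_le:
  fixes E :: "'a::euclidean_space set"
  shows "packing_dim E \<le> ereal (real DIM('a))"
proof -
  have "E \<subseteq> (\<Union>i::nat. cball 0 (real i))"
    using real_arch_simple by fastforce
  then have "packing_dim E \<le> (SUP i::nat. upper_box_dim (cball (0::'a) (real i)))"
    unfolding packing_dim_def by (intro INF_lower) auto
  also have "\<dots> \<le> ereal (real DIM('a))" by (intro SUP_least upper_box_dim_cball_le) simp
  finally show ?thesis .
qed

section \<open>Rational points\<close>

lemma card_vec_int: "card {v :: int ^ 'k. \<forall>i. v $ i \<in> S i} = (\<Prod>i\<in>UNIV. card (S i))"
proof -
  have "bij_betw vec_lambda (PiE (UNIV :: 'k set) S) {v :: int ^ 'k. \<forall>i. v $ i \<in> S i}"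
    by (rule bij_betwI[where g = vec_nth]) (auto simp: PiE_def Pi_def)
  then have "card {v :: int ^ 'k. \<forall>i. v $ i \<in> S i} = card (PiE (UNIV :: 'k set) S)"
    by (simp add: bij_betw_same_card)
  then show ?thesis by (simp add: card_PiE)
qed

lemma finite_vec_int:
  assumes "\<And>i. finite (S i)" shows "finite {v :: int ^ 'k. \<forall>i. v $ i \<in> S i}"
proof -
  have "bij_betw vec_lambda (PiE (UNIV :: 'k set) S) {v :: int ^ 'k. \<forall>i. v $ i \<in> S i}"
    by (rule bij_betwI[where g = vec_nth]) (auto simp: PiE_def Pi_def)
  moreover have "finite (PiE (UNIV :: 'k set) S)" using assms by (intro finite_PiE) auto
  ultimately show ?thesis using bij_betw_finite by blast
qed

lemma emeasure_cbox_vec: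
  fixes a b :: "real ^ 'm"
  assumes "\<And>i. a $ i \<le> b $ i"
  shows "emeasure lborel (cbox a b) = ennreal (\<Prod>i\<in>UNIV. b $ i - a $ i)"
proof -
  have "cbox a b \<noteq> {}" using assms by (auto simp: interval_ne_empty_cart)
  then have "measure lborel (cbox a b) = (\<Prod>i\<in>UNIV. b $ i - a $ i)" by (rule content_cbox_cart)
  then show ?thesis
    using emeasure_lborel_cbox_finite[of a b] by (subst emeasure_eq_ennreal_measure) (auto simp: less_top)
qed

definition rat_pt :: "int ^ 'm \<Rightarrow> nat \<Rightarrow> real ^ 'm" where
  "rat_pt p q = (\<chi> i. real_of_int (p $ i) / real q)"

text \<open>Lowest terms without gcds: \<open>q\<close> divides every denominator of the same
  rational point. In this form it recognises equal fractions as multiples.\<close>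

definition lowest_terms :: "int ^ 'm \<Rightarrow> nat \<Rightarrow> bool" where
  "lowest_terms p q \<longleftrightarrow> q \<ge> 1 \<and> (\<forall>p' q'. q' \<ge> 1 \<longrightarrow> (\<forall>i. int q' * p $ i = int q * p' $ i) \<longrightarrow> q dvd q')"

definition box_at :: "real ^ 'm \<Rightarrow> real \<Rightarrow> (real ^ 'm) set" where
  "box_at a s = cbox a (\<chi> i. a $ i + s)"

lemma mem_box_at: "z \<in> box_at a s \<longleftrightarrow> (\<forall>i. a $ i \<le> z $ i \<and> z $ i \<le> a $ i + s)"
  by (simp add: box_at_def mem_box_cart)

lemma sets_box_at [measurable, simp]: "box_at a s \<in> sets borel"
  by (simp add: box_at_def)

lemma emeasure_box_at:
  fixes a :: "real ^ 'm"
  assumes "0 \<le> s"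
  shows "emeasure lborel (box_at a s) = ennreal (s ^ CARD('m))"
  unfolding box_at_def using assms by (subst emeasure_cbox_vec) auto

text \<open>Per coordinate the admissible numerators lie in an interval of length
  \<open>q s + 2 w q \<le> q s + 1\<close>, so there are at most \<open>q s + 2\<close>. The summand
  2 is the boundary term; it dominates when the cube is smaller than the spacing
  \<open>1/q\<close>.\<close>

lemma emeasure_near_rationals:
  fixes a :: "real ^ 'm"
  assumes q: "q \<ge> 1" and w: "0 \<le> w" "w * real q \<le> 1/2" and s: "0 \<le> s"
  obtains R where "R \<in> sets lborel"
    "{z \<in> box_at a s. \<exists>p :: int ^ 'm. \<forall>i. \<bar>z $ i - real_of_int (p $ i) / real q\<bar> \<le> w} \<subseteq> R"
    "emeasure lborel R \<le> ennreal (((real q * s + 2) * (2 * w)) ^ CARD('m))"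
proof -
  define I where "I i = {\<lceil>real q * (a $ i - w)\<rceil>..\<lfloor>real q * (a $ i + s + w)\<rfloor>}" for i
  define P where "P = {p :: int ^ 'm. \<forall>i. p $ i \<in> I i}"
  define B where "B p = box_at ((\<chi> i. real_of_int (p $ i) / real q - w) :: real ^ 'm) (2 * w)" for p :: "int ^ 'm"
  have finP: "finite P" unfolding P_def I_def by (intro finite_vec_int) simp
  have cI: "real (card (I i)) \<le> real q * s + 2" for i
  proof -
    have "real q * (a $ i + s + w) - real q * (a $ i - w) = real q * s + 2 * (w * real q)" by (simp add: algebra_simps)
    then have *: "real q * (a $ i + s + w) - real q * (a $ i - w) \<le> real q * s + 1" using w by simp
    have "0 \<le> real q * s" using s by simp
    have "real (card (I i)) = max 0 (real_of_int (\<lfloor>real q * (a $ i + s + w)\<rfloor> + 1 - \<lceil>real q * (a $ i - w)\<rceil>))"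
      unfolding I_def by simp
    also have "\<dots> \<le> real q * s + 2" using * \<open>0 \<le> real q * s\<close> by linarith
    finally show ?thesis .
  qed
  have "real (card P) = (\<Prod>i\<in>UNIV. real (card (I i)))" unfolding P_def by (simp add: card_vec_int)
  also have "\<dots> \<le> (\<Prod>i\<in>(UNIV :: 'm set). real q * s + 2)" by (intro prod_mono) (auto simp: cI)
  finally have cP: "real (card P) \<le> (real q * s + 2) ^ CARD('m)" by simp
  show ?thesis
  proof (rule that[of "\<Union>p\<in>P. B p"])
    show "(\<Union>p\<in>P. B p) \<in> sets lborel" using finP by (auto simp: B_def)
    show "{z \<in> box_at a s. \<exists>p :: int ^ 'm. \<forall>i. \<bar>z $ i - real_of_int (p $ i) / real q\<bar> \<le> w} \<subseteq> (\<Union>p\<in>P. B p)"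
    proof clarify
      fix z p assume z: "z \<in> box_at a s" and p: "\<forall>i. \<bar>z $ i - real_of_int (p $ i) / real q\<bar> \<le> w"
      have "p $ i \<in> I i" for i
      proof -
        have "a $ i \<le> z $ i" "z $ i \<le> a $ i + s" using z by (auto simp: mem_box_at)
        moreover have "\<bar>z $ i - real_of_int (p $ i) / real q\<bar> \<le> w" using p by simp
        ultimately have "a $ i - w \<le> real_of_int (p $ i) / real q" "real_of_int (p $ i) / real q \<le> a $ i + s + w" by linarith+
        then have "real q * (a $ i - w) \<le> real_of_int (p $ i)" "real_of_int (p $ i) \<le> real q * (a $ i + s + w)"
          using q by (auto simp: field_simps)
        then show ?thesis by (simp add: I_def ceiling_le_iff le_floor_iff)
      qed
      then have "p \<in> P" by (simp add: P_def)
      moreover have "z \<in> B p" unfolding B_def mem_box_at using p by (simp add: abs_le_iff) (metis add.commute diff_le_eq le_diff_eq minus_diff_eq)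
      ultimately show "z \<in> (\<Union>p\<in>P. B p)" by blast
    qed
    have "emeasure lborel (\<Union>p\<in>P. B p) \<le> (\<Sum>p\<in>P. emeasure lborel (B p))"
      using finP by (intro emeasure_subadditive_finite) (auto simp: B_def)
    also have "\<dots> = (\<Sum>p\<in>P. ennreal ((2 * w) ^ CARD('m)))"
      using w by (simp add: B_def emeasure_box_at)
    also have "\<dots> = ennreal (real (card P) * (2 * w) ^ CARD('m))"
      using w by (simp add: ennreal_mult ennreal_of_nat_eq_real_of_nat)
    also have "\<dots> \<le> ennreal ((real q * s + 2) ^ CARD('m) * (2 * w) ^ CARD('m))"
      using cP w by (intro ennreal_leI mult_right_mono) auto
    finally show "emeasure lborel (\<Union>p\<in>P. B p) \<le> ennreal (((real q * s + 2) * (2 * w)) ^ CARD('m))"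
      by (simp add: power_mult_distrib)
  qed
qed

lemma emeasure_near_rationals_UN:
  fixes a :: "real ^ 'm"
  assumes J: "finite J" "\<And>q. q \<in> J \<Longrightarrow> q \<ge> 1 \<and> 0 \<le> w q \<and> w q * real q \<le> 1/2" and s: "0 \<le> s"
  obtains R where "R \<in> sets lborel"
    "\<And>z q p. z \<in> box_at a s \<Longrightarrow> q \<in> J \<Longrightarrow> \<forall>i. \<bar>z $ i - rat_pt p q $ i\<bar> \<le> w q \<Longrightarrow> z \<in> R"
    "emeasure lborel R \<le> ennreal (\<Sum>q\<in>J. ((real q * s + 2) * (2 * w q)) ^ CARD('m))"
proof -
  let ?T = "\<lambda>q. {z \<in> box_at a s. \<exists>p :: int ^ 'm. \<forall>i. \<bar>z $ i - real_of_int (p $ i) / real q\<bar> \<le> w q}"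
  have "\<forall>q. \<exists>R. q \<in> J \<longrightarrow> R \<in> sets lborel \<and> ?T q \<subseteq> R \<and> emeasure lborel R \<le> ennreal (((real q * s + 2) * (2 * w q)) ^ CARD('m))"
  proof
    fix q
    show "\<exists>R. q \<in> J \<longrightarrow> R \<in> sets lborel \<and> ?T q \<subseteq> R \<and> emeasure lborel R \<le> ennreal (((real q * s + 2) * (2 * w q)) ^ CARD('m))"
    proof (cases "q \<in> J")
      case True
      then have q: "q \<ge> 1" "0 \<le> w q" "w q * real q \<le> 1/2" using J(2) by blast+
      show ?thesis by (rule emeasure_near_rationals[OF q s, where a = a]) auto
    qed simp
  qed
  from choice[OF this] obtain R where R: "\<And>q. q \<in> J \<Longrightarrow> R q \<in> sets lborel" "\<And>q. q \<in> J \<Longrightarrow> ?T q \<subseteq> R q"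
    "\<And>q. q \<in> J \<Longrightarrow> emeasure lborel (R q) \<le> ennreal (((real q * s + 2) * (2 * w q)) ^ CARD('m))" by blast
  show ?thesis
  proof (rule that[of "\<Union>q\<in>J. R q"])
    show "(\<Union>q\<in>J. R q) \<in> sets lborel" using J(1) R(1) by (intro sets.finite_UN) auto
    show "z \<in> (\<Union>q\<in>J. R q)" if "z \<in> box_at a s" "q \<in> J" "\<forall>i. \<bar>z $ i - rat_pt p q $ i\<bar> \<le> w q" for z q and p :: "int ^ 'm"
      using that R(2)[of q] by (auto simp: rat_pt_def)
    have "emeasure lborel (\<Union>q\<in>J. R q) \<le> (\<Sum>q\<in>J. emeasure lborel (R q))"
      using J(1) R(1) by (intro emeasure_subadditive_finite) auto
    also have "\<dots> \<le> (\<Sum>q\<in>J. ennreal (((real q * s + 2) * (2 * w q)) ^ CARD('m)))" by (intro sum_mono R)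
    also have "\<dots> = ennreal (\<Sum>q\<in>J. ((real q * s + 2) * (2 * w q)) ^ CARD('m))"
      using J(2) s by (intro sum_ennreal) auto
    finally show "emeasure lborel (\<Union>q\<in>J. R q) \<le> ennreal (\<Sum>q\<in>J. ((real q * s + 2) * (2 * w q)) ^ CARD('m))" .
  qed
qed

text \<open>The least denominator works: the remainder of any other denominator modulo it would be a
  smaller denominator, unless it is 0.\<close>

lemma lowest_terms_exists:
  fixes p :: "int ^ 'm"
  assumes q: "q \<ge> 1"
  obtains p' q' where "lowest_terms p' q'" "q' \<le> q" "rat_pt p' q' = rat_pt p q"
proof -
  let ?P = "\<lambda>q'. q' \<ge> 1 \<and> (\<exists>p' :: int ^ 'm. \<forall>i. int q' * p $ i = int q * p' $ i)"
  have Pq: "?P q" using q by auto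
  define q' where "q' = (LEAST q'. ?P q')"
  have q': "?P q'" unfolding q'_def using Pq by (rule LeastI)
  have min: "q' \<le> k" if "?P k" for k unfolding q'_def using that by (rule Least_le)
  obtain p' :: "int ^ 'm" where p': "\<And>i. int q' * p $ i = int q * p' $ i" using q' by blast
  have "lowest_terms p' q'"
    unfolding lowest_terms_def
  proof (intro conjI allI impI)
    show "1 \<le> q'" using q' by simp
    fix p2 :: "int ^ 'm" and q2 :: nat assume q2: "1 \<le> q2" and eq: "\<forall>i. int q2 * p' $ i = int q' * p2 $ i"
    have eq2: "int q2 * p $ i = int q * p2 $ i" for i
    proof -
      have "int q' * (int q2 * p $ i) = int q2 * (int q * p' $ i)" using p'[of i] by (simp add: algebra_simps)
      also have "\<dots> = int q * (int q' * p2 $ i)" using eq by (simp add: algebra_simps)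
      finally have "int q' * (int q2 * p $ i) = int q' * (int q * p2 $ i)" by (simp add: algebra_simps)
      then show ?thesis using q' by simp
    qed
    define r where "r = q2 mod q'"
    have r: "r < q'" using q' by (simp add: r_def)
    have ri: "int r = int q2 - int (q2 div q') * int q'"
      unfolding r_def by (metis minus_mult_div_eq_mod mult.commute of_nat_mult zdiv_int zmod_int)
    have "\<forall>i. int r * p $ i = int q * (\<chi> i. p2 $ i - int (q2 div q') * p' $ i) $ i"
    proof
      fix i
      have "int r * p $ i = int q2 * p $ i - int (q2 div q') * (int q' * p $ i)"
        unfolding ri by (simp add: algebra_simps)
      also have "\<dots> = int q * p2 $ i - int (q2 div q') * (int q * p' $ i)" using eq2 p' by simp
      finally show "int r * p $ i = int q * (\<chi> i. p2 $ i - int (q2 div q') * p' $ i) $ i"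
        by (simp add: algebra_simps)
    qed
    then have "r \<ge> 1 \<Longrightarrow> ?P r" by blast
    then have "\<not> r \<ge> 1" using min[of r] r by fastforce
    then have "r = 0" by simp
    then show "q' dvd q2" by (auto simp: r_def)
  qed
  moreover have "rat_pt p' q' = rat_pt p q"
  proof -
    have "real_of_int (p' $ i) / real q' = real_of_int (p $ i) / real q" for i
    proof -
      have "real_of_int (int q' * p $ i) = real_of_int (int q * p' $ i)" using p' by simp
      then show ?thesis using q q' by (simp add: field_simps)
    qed
    then show ?thesis by (simp add: rat_pt_def vec_eq_iff)
  qed
  moreover have "q' \<le> q" using min Pq by blast
  ultimately show ?thesis using that by blast
qed

text \<open>Passing to lowest terms can only decrease \<open>q\<close> and thus only weakens the
  bound \<open>1 / (q N)\<close>.\<close>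

lemma Dirichlet_vec:
  fixes z :: "real ^ 'm"
  assumes N: "N \<ge> 1"
  obtains p :: "int ^ 'm" and q :: nat where "lowest_terms p q" "q \<le> N ^ CARD('m)"
    "\<And>i. \<bar>z $ i - rat_pt p q $ i\<bar> \<le> 1 / (real q * real N)"
proof -
  obtain h :: "'m \<Rightarrow> nat" where h: "bij_betw h UNIV {..<CARD('m)}"
    using ex_bij_betw_finite_nat[of "UNIV :: 'm set"] by (auto simp: atLeast0LessThan)
  obtain q p where qp: "0 < q" "q \<le> int (N ^ CARD('m))"
     "\<And>i. i < CARD('m) \<Longrightarrow> \<bar>of_int q * (z $ (inv h i)) - of_int (p i)\<bar> < 1 / N"
    using Dirichlet_approx_simult[of N "CARD('m)" "\<lambda>i. z $ (inv h i)"] N by auto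
  define p0 where "p0 = ((\<chi> i. p (h i)) :: int ^ 'm)"
  define q0 where "q0 = nat q"
  have q0: "q0 \<ge> 1" "q0 \<le> N ^ CARD('m)" "real_of_int q = real q0" using qp by (auto simp: q0_def le_nat_iff nat_le_iff)
  have app: "\<bar>z $ i - rat_pt p0 q0 $ i\<bar> \<le> 1 / (real q0 * real N)" for i
  proof -
    have "h i < CARD('m)" using h by (auto simp: bij_betw_def)
    moreover have "inv h (h i) = i" using h by (intro inv_f_f) (simp add: bij_betw_def)
    ultimately have "\<bar>real q0 * z $ i - of_int (p (h i))\<bar> < 1 / N" using qp(3)[of "h i"] q0 by simp
    moreover have "z $ i - rat_pt p0 q0 $ i = (real q0 * z $ i - of_int (p (h i))) / real q0"
      using q0 by (simp add: rat_pt_def p0_def field_simps)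
    ultimately have "\<bar>z $ i - rat_pt p0 q0 $ i\<bar> \<le> (1 / N) / real q0"
      using q0 by (simp add: abs_divide divide_right_mono less_imp_le del: divide_divide_eq_left divide_divide_eq_left')
    then show ?thesis by (simp add: mult.commute)
  qed
  obtain p' q' where p': "lowest_terms p' q'" "q' \<le> q0" "rat_pt p' q' = rat_pt p0 q0"
    using lowest_terms_exists[OF q0(1)] by metis
  have "1 / (real q0 * real N) \<le> 1 / (real q' * real N)"
    using p' N by (intro divide_left_mono mult_right_mono) (auto simp: lowest_terms_def)
  then have "\<And>i. \<bar>z $ i - rat_pt p' q' $ i\<bar> \<le> 1 / (real q' * real N)" unfolding p'(3) by (rule order_trans[OF app])
  then show ?thesis using that[OF p'(1) order_trans[OF p'(2) q0(2)]] by blast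
qed

lemma power_add_le: "0 \<le> u \<Longrightarrow> 0 \<le> v \<Longrightarrow> (u + v :: real) ^ k \<le> 2 ^ k * (u ^ k + v ^ k)"
proof -
  assume *: "0 \<le> u" "0 \<le> v"
  have "(u + v) ^ k \<le> (2 * max u v) ^ k" using * by (intro power_mono) auto
  also have "\<dots> = 2 ^ k * (max u v) ^ k" by (simp add: power_mult_distrib)
  also have "(max u v) ^ k \<le> u ^ k + v ^ k" using * by (simp add: max_def)
  finally show ?thesis by simp
qed

lemma sum_inverse_squares_le: "(\<Sum>q=1..n. 1 / (real q)\<^sup>2) \<le> 2"
proof -
  \<comment> \<open>Telescoping against \<open>1/n - 1/(n+1)\<close> needs this sharper bound as
    induction hypothesis.\<close>
  have "(\<Sum>q=1..n. 1 / (real q)\<^sup>2) \<le> 2 - 1 / real (max n 1)"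
  proof (induction n)
    case (Suc n)
    show ?case
    proof (cases "n = 0")
      case False
      have "1 / (real (Suc n))\<^sup>2 \<le> 1 / (real n * real (Suc n))"
        using False by (intro divide_left_mono) (auto simp: power2_eq_square)
      also have "\<dots> = 1 / real n - 1 / real (Suc n)" using False by (simp add: field_simps)
      finally have "1 / (real (Suc n))\<^sup>2 \<le> 1 / real n - 1 / real (Suc n)" .
      moreover have "max n 1 = n" "max (Suc n) 1 = Suc n" using False by auto
      ultimately show ?thesis using Suc by (simp only: sum.cl_ivl_Suc) simp
    qed simp
  qed simp
  also have "\<dots> \<le> 2" by simp
  finally show ?thesis .
qed

lemma sum_inverse_le_ln: "n \<ge> 1 \<Longrightarrow> (\<Sum>q=1..n. 1 / real q) \<le> 1 + ln (real n)"
proof (induction n rule: dec_induct)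
  case (step n)
  have "ln (real n / real (Suc n)) \<le> real n / real (Suc n) - 1" using step by (intro ln_le_minus_one) auto
  then have "1 / real (Suc n) \<le> ln (real (Suc n)) - ln (real n)" using step by (simp add: ln_div field_simps)
  then show ?case using step by simp
qed simp

section \<open>Measure of the dangerous set\<close>

text \<open>The exclusion radius is twice the distance \<open>q powr (-1-t)\<close> that the limit
  point has to keep; the other half pays for the move from a rational centre to the limit
  point.\<close>

definition avoids :: "real \<Rightarrow> real \<Rightarrow> real \<Rightarrow> real ^ 'm \<Rightarrow> bool" where
  "avoids t Y X x \<longleftrightarrow> (\<forall>q :: nat. Y < real q \<longrightarrow> real q \<le> X \<longrightarrow>
     (\<forall>p :: int ^ 'm. \<exists>i. \<bar>x $ i - rat_pt p q $ i\<bar> > 2 * real q powr (-1-t)))"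

text \<open>\<open>s\<close> is the side of a cube and \<open>Y\<close> a denominator up to which it is safe; the inequality
  says that the dangerous rationals with denominators beyond \<open>Y\<close> fill at most an eighth of the cube
  (compare the constant \<open>D\<close> in the proof of \<open>danger_measure\<close>).\<close>

definition roomy :: "nat \<Rightarrow> real \<Rightarrow> real \<Rightarrow> real \<Rightarrow> bool" where
  "roomy m t s Y \<longleftrightarrow> 8 \<le> Y \<and> 2 * 4 ^ m * ((4 * s) ^ m * Y powr (2 - real m * t) + 8 ^ m * Y powr (2 - real m - real m * t)) \<le> s ^ m / 8"

text \<open>Here \<open>d\<close> plays the role of \<open>rad Phi q\<close> and
  \<open>e * d\<close> that of half the side of the cube. Since \<open>Y \<ge> q powr t / 2\<close>,
  the volume term of \<open>roomy\<close> is negligible because \<open>m t > 2\<close>. In the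
  boundary term \<open>Y\<close> is rewritten through \<open>q d\<close>; after splitting off
  \<open>d ^ m\<close>, the remaining power of \<open>q\<close> has exponent
  \<open>m + 2 t - m t^2\<close>.\<close>

lemma eventually_roomy:
  assumes t: "t > 1" and mt: "real m * t > real m + 2" and e: "e > 0" and m: "m \<ge> 1"
  shows "eventually (\<lambda>q :: nat. \<forall>d. 0 < d \<longrightarrow> d \<le> real q powr (-1-t) \<longrightarrow> roomy m t (e * d) (1 / (2 * real q * d))) sequentially"
proof -
  define C1 where "C1 = 2 * 4 ^ m * 4 ^ m * (1/2 :: real) powr (2 - real m * t)"
  define C2 where "C2 = 2 * 4 ^ m * 8 ^ m * (1/2 :: real) powr (2 - real m - real m * t) / e ^ m"
  have lim1: "(\<lambda>q :: nat. C1 * (real q powr (t * (2 - real m * t)))) \<longlonglongrightarrow> C1 * 0"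
    using t mt by (intro tendsto_mult tendsto_const tendsto_neg_powr filterlim_real_sequentially) (auto simp: mult_less_0_iff)
  \<comment> \<open>From \<open>m t > m + 2\<close>: multiply by \<open>t\<close> and use
    \<open>m \<le> m t\<close>.\<close>
  have "real m + 2 * t < m * t * t"
  proof -
    have "(real m + 2) * t < m * t * t" using mt t by simp
    moreover have "real m * 1 \<le> real m * t" using t by (intro mult_left_mono) auto
    ultimately show ?thesis by (simp add: algebra_simps)
  qed
  then have lim2: "(\<lambda>q :: nat. C2 * (real q powr (m + 2 * t - m * t * t))) \<longlonglongrightarrow> C2 * 0"
    by (intro tendsto_mult tendsto_const tendsto_neg_powr filterlim_real_sequentially) auto
  have lim3: "filterlim (\<lambda>q :: nat. real q powr t) at_top sequentially"
    using t by real_asymp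
  have "eventually (\<lambda>q :: nat. C1 * (real q powr (t * (2 - real m * t))) < 1/16) sequentially"
    using lim1 by (rule order_tendstoD) simp
  moreover have "eventually (\<lambda>q :: nat. C2 * (real q powr (m + 2 * t - m * t * t)) < 1/16) sequentially"
    using lim2 by (rule order_tendstoD) simp
  moreover have "eventually (\<lambda>q :: nat. real q powr t \<ge> 16) sequentially"
    using lim3 by (simp add: filterlim_at_top)
  moreover have "eventually (\<lambda>q :: nat. q \<ge> 1) sequentially" by (rule eventually_ge_at_top)
  ultimately show ?thesis
  proof eventually_elim
    case (elim q)
    have q: "real q \<ge> 1" using elim by simp
    show ?case
    proof (intro allI impI)
      fix d :: real assume d: "0 < d" "d \<le> real q powr (-1-t)"
      define Y where "Y = 1 / (2 * real q * d)"
      have Y: "Y > 0" using d q by (simp add: Y_def)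
      have "real q * d \<le> real q * real q powr (-1-t)" using d q by (intro mult_left_mono) auto
      also have "\<dots> = real q powr (-t)" using q by (simp add: powr_mult_base)
      finally have "real q * d \<le> real q powr (-t)" .
      then have "real q powr t * (real q * d) \<le> real q powr t * real q powr (-t)" by (intro mult_left_mono) auto
      also have "\<dots> = 1" using q by (simp add: powr_minus)
      finally have Yge: "Y \<ge> real q powr t * (1/2)" using d q by (simp add: Y_def field_simps)
      have "2 * 4 ^ m * ((4 * (e * d)) ^ m * Y powr (2 - real m * t)) = (e * d) ^ m * (2 * 4 ^ m * 4 ^ m * Y powr (2 - real m * t))"
        by (simp add: power_mult_distrib)
      also have "\<dots> \<le> (e * d) ^ m * (2 * 4 ^ m * 4 ^ m * (real q powr t * (1/2)) powr (2 - real m * t))"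
        using Yge mt q d e by (intro mult_left_mono powr_mono2') auto
      also have "(real q powr t * (1/2)) powr (2 - real m * t) = real q powr (t * (2 - real m * t)) * (1/2) powr (2 - real m * t)"
        using q by (subst powr_mult) (auto simp: powr_powr)
      also have "(e * d) ^ m * (2 * 4 ^ m * 4 ^ m * (real q powr (t * (2 - real m * t)) * (1/2) powr (2 - real m * t)))
          = (e * d) ^ m * (C1 * real q powr (t * (2 - real m * t)))"
        by (simp add: C1_def)
      also have "\<dots> \<le> (e * d) ^ m * (1/16)" using elim e d by (intro mult_left_mono) auto
      finally have 1: "2 * 4 ^ m * ((4 * (e * d)) ^ m * Y powr (2 - real m * t)) \<le> (e * d) ^ m / 16" by simp
      have Yp: "Y powr (2 - real m - real m * t) = (1/2) powr (2 - real m - real m * t) * (real q powr (m + m * t - 2) * d powr (m + m * t - 2))"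
      proof -
        have "Y = (1/2) * (real q * d) powr (-1)" using d q by (simp add: Y_def powr_minus field_simps)
        then have "Y powr (2 - real m - real m * t) = ((1/2) * (real q * d) powr (-1)) powr (2 - real m - real m * t)"
          by (simp only:)
        also have "\<dots> = (1/2) powr (2 - real m - real m * t) * ((real q * d) powr (-1)) powr (2 - real m - real m * t)"
          by (rule powr_mult)
        also have "((real q * d) powr (-1)) powr (2 - real m - real m * t) = (real q * d) powr (m + m * t - 2)"
          by (subst powr_powr) (simp add: algebra_simps)
        finally have "Y powr (2 - real m - real m * t) = (1/2) powr (2 - real m - real m * t) * (real q * d) powr (m + m * t - 2)" .
        then show ?thesis using d q by (simp add: powr_mult)
      qed
      have dp: "d powr (m + m * t - 2) = d ^ m * d powr (m * t - 2)"
      proof -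
        have "d powr (m + m * t - 2) = d powr (real m + (m * t - 2))" by (simp add: algebra_simps)
        then show ?thesis using d by (simp only: powr_add powr_realpow)
      qed
      have "2 * 4 ^ m * (8 ^ m * Y powr (2 - real m - real m * t)) =
         d ^ m * e ^ m * (C2 * (real q powr (m + m * t - 2) * d powr (m * t - 2)))"
        unfolding Yp dp C2_def using e by simp
      also have "\<dots> \<le> d ^ m * e ^ m * (C2 * (real q powr (m + m * t - 2) * (real q powr (-1-t)) powr (m * t - 2)))"
        using d e mt t q by (intro mult_left_mono powr_mono2) (auto simp: C2_def)
      also have "real q powr (m + m * t - 2) * (real q powr (-1-t)) powr (m * t - 2) = real q powr (m + 2 * t - m * t * t)"
        using q by (simp add: powr_powr powr_add[symmetric] algebra_simps)
      also have "d ^ m * e ^ m * (C2 * real q powr (m + 2 * t - m * t * t)) \<le> d ^ m * e ^ m * (1/16)"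
        using elim e d by (intro mult_left_mono) auto
      finally have 2: "2 * 4 ^ m * (8 ^ m * Y powr (2 - real m - real m * t)) \<le> (e * d) ^ m / 16"
        by (simp add: power_mult_distrib mult.commute)
      have "8 \<le> Y" using Yge elim by simp
      then show "roomy m t (e * d) (1 / (2 * real q * d))"
        unfolding roomy_def Y_def[symmetric] distrib_left using 1 2 by simp
    qed
  qed
qed

text \<open>An upper bound for the Dirichlet error \<open>1 / (q N)\<close> when
  \<open>q \<ge> N ^ m / (8 * 4 ^ m)\<close>, the lower bound imposed on child denominators. The
  same length serves as the separation of children.\<close>

definition sep :: "nat \<Rightarrow> nat \<Rightarrow> real" where
  "sep m N = 8 * 4 ^ m / real N ^ (m + 1)"

lemma sep_eq_powr:
  assumes "N \<ge> 1"
  shows "sep m N = 8 * 4 ^ m * real N powr (-(real m + 1))"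
proof -
  have "real N powr (real m + 1) = real N powr (real (m + 1))" by (simp add: add.commute)
  also have "\<dots> = real N ^ (m + 1)" using assms by (subst powr_realpow) auto
  finally have "real N powr (-(real m + 1)) = 1 / real N ^ (m + 1)" by (subst powr_minus_divide) (simp only:)
  then show ?thesis by (simp add: sep_def)
qed

text \<open>Points with a Dirichlet denominator below \<open>N ^ m / (8 * 4 ^ m)\<close> give no
  useful child. Their volume terms add up to at most \<open>s ^ m / 8\<close>, which is where the
  constant comes from, and their boundary terms to a logarithm over \<open>N\<close>.\<close>

lemma small_denominators_measure:
  fixes a :: "real ^ 'm"
  assumes s: "0 < s" and N: "N \<ge> 2"
  defines "m \<equiv> CARD('m)"
  assumes E: "8 ^ m * (1 + ln (real (N ^ m))) / real N \<le> s ^ m / 8"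
  obtains R where "R \<in> sets lborel"
    "\<And>z q p. z \<in> box_at a s \<Longrightarrow> 1 \<le> q \<Longrightarrow> 8 * 4 ^ m * q < N ^ m \<Longrightarrow> \<forall>i. \<bar>z $ i - rat_pt p q $ i\<bar> \<le> 1 / (real q * real N) \<Longrightarrow> z \<in> R"
    "emeasure lborel R \<le> ennreal (s ^ m / 4)"
proof -
  define J where "J = {q. 1 \<le> q \<and> 8 * 4 ^ m * q < N ^ m}"
  have Jsub: "J \<subseteq> {1..N ^ m}"
  proof
    fix q assume q: "q \<in> J"
    have "1 \<le> q" "8 * 4 ^ m * q < N ^ m" using q by (auto simp: J_def)
    moreover have "1 * q \<le> 8 * 4 ^ m * q" by (intro mult_right_mono) auto
    ultimately show "q \<in> {1..N ^ m}" unfolding atLeastAtMost_iff by linarith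
  qed
  then have finJ: "finite J" by (rule finite_subset) simp
  have m: "m \<ge> 1" by (simp add: m_def Suc_leI)
  have J: "q \<ge> 1 \<and> 0 \<le> 1 / (real q * real N) \<and> 1 / (real q * real N) * real q \<le> 1/2" if "q \<in> J" for q
    using that N by (auto simp: J_def field_simps)
  obtain R where R: "R \<in> sets lborel"
    "\<And>z q p. z \<in> box_at a s \<Longrightarrow> q \<in> J \<Longrightarrow> \<forall>i. \<bar>z $ i - rat_pt p q $ i\<bar> \<le> 1 / (real q * real N) \<Longrightarrow> z \<in> R"
    "emeasure lborel R \<le> ennreal (\<Sum>q\<in>J. ((real q * s + 2) * (2 * (1 / (real q * real N)))) ^ m)"
    using emeasure_near_rationals_UN[OF finJ J less_imp_le[OF s(1)], of a] unfolding m_def by blast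
  show ?thesis
  proof (rule that[OF R(1)])
    show "z \<in> R" if "z \<in> box_at a s" "1 \<le> q" "8 * 4 ^ m * q < N ^ m" "\<forall>i. \<bar>z $ i - rat_pt p q $ i\<bar> \<le> 1 / (real q * real N)" for z q p
      using that by (intro R(2)[of z q p]) (auto simp: J_def)
    have est: "((real q * s + 2) * (2 * (1 / (real q * real N)))) ^ m \<le> 4 ^ m * s ^ m * (1 / real N ^ m) + 8 ^ m / real N * (1 / real q)"
      if q: "q \<in> J" for q
    proof -
      have q1: "real q \<ge> 1" using q by (auto simp: J_def)
      have "((real q * s + 2) * (2 * (1 / (real q * real N)))) = 2 * s / real N + 4 / (real q * real N)"
        using q1 N by (simp add: field_simps)
      also have "\<dots> ^ m \<le> 2 ^ m * ((2 * s / real N) ^ m + (4 / (real q * real N)) ^ m)"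
        using s by (intro power_add_le) auto
      also have "\<dots> = 4 ^ m * s ^ m * (1 / real N ^ m) + 8 ^ m * (1 / (real q * real N)) ^ m"
      proof -
        have "(2 :: real) ^ m * 2 ^ m = 4 ^ m" "(2 :: real) ^ m * 4 ^ m = 8 ^ m"
          by (simp_all flip: power_mult_distrib)
        moreover have "(2 * s / real N) ^ m = 2 ^ m * s ^ m * (1 / real N ^ m)"
          by (simp add: power_divide power_mult_distrib)
        moreover have "(4 / (real q * real N)) ^ m = 4 ^ m * (1 / (real q * real N)) ^ m"
          by (simp add: power_divide)
        ultimately show ?thesis by (simp only: distrib_left mult.assoc[symmetric])
      qed
      \<comment> \<open>Reduction to the exponent 1, at the price of a harmonic sum, whose logarithm
        is beaten by the factor \<open>1 / N\<close>.\<close>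
      also have "(1 / (real q * real N)) ^ m \<le> (1 / (real q * real N)) ^ 1"
      proof (rule power_decreasing)
        have "1 * 1 \<le> real q * real N" using q1 N by (intro mult_mono) auto
        then show "1 / (real q * real N) \<le> 1" by (simp add: divide_le_eq_1)
      qed (use m in auto)
      finally show ?thesis by (simp add: mult.commute)
    qed
    have cJ: "real (card J) * (8 * 4 ^ m) \<le> real N ^ m"
    proof -
      have "J \<subseteq> {1..N ^ m div (8 * 4 ^ m)}" by (auto simp: J_def less_eq_div_iff_mult_less_eq mult.commute)
      then have "card J \<le> N ^ m div (8 * 4 ^ m)" using card_mono[of "{1..N ^ m div (8 * 4 ^ m)}" J] by simp
      then have "card J * (8 * 4 ^ m) \<le> N ^ m" by (meson div_times_less_eq_dividend le_trans mult_le_mono1)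
      then have "real (card J * (8 * 4 ^ m)) \<le> real (N ^ m)" by (simp only: of_nat_le_iff)
      then show ?thesis by simp
    qed
    note R(3)
    also have "ennreal (\<Sum>q\<in>J. ((real q * s + 2) * (2 * (1 / (real q * real N)))) ^ m) \<le>
      ennreal (\<Sum>q\<in>J. 4 ^ m * s ^ m * (1 / real N ^ m) + 8 ^ m / real N * (1 / real q))"
      by (intro ennreal_leI sum_mono est)
    also have "(\<Sum>q\<in>J. 4 ^ m * s ^ m * (1 / real N ^ m) + 8 ^ m / real N * (1 / real q)) =
       real (card J) * (4 ^ m * s ^ m * (1 / real N ^ m)) + 8 ^ m / real N * (\<Sum>q\<in>J. 1 / real q)"
      by (simp add: sum.distrib sum_distrib_left)
    also have "ennreal \<dots> \<le> ennreal (s ^ m / 4)"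
    proof (rule ennreal_leI)
      have "real (card J) * (4 ^ m * s ^ m * (1 / real N ^ m)) = real (card J) * (8 * 4 ^ m) * (s ^ m / (8 * real N ^ m))"
        by simp
      also have "\<dots> \<le> real N ^ m * (s ^ m / (8 * real N ^ m))" using cJ s by (intro mult_right_mono) auto
      also have "\<dots> = s ^ m / 8" using N by simp
      finally have 1: "real (card J) * (4 ^ m * s ^ m * (1 / real N ^ m)) \<le> s ^ m / 8" .
      have "(\<Sum>q\<in>J. 1 / real q) \<le> (\<Sum>q=1..N^m. 1 / real q)" using Jsub by (intro sum_mono2) auto
      also have "\<dots> \<le> 1 + ln (real (N ^ m))" using N by (intro sum_inverse_le_ln) auto
      finally have "8 ^ m / real N * (\<Sum>q\<in>J. 1 / real q) \<le> 8 ^ m / real N * (1 + ln (real (N ^ m)))"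
        by (intro mult_left_mono) auto
      also have "\<dots> \<le> s ^ m / 8" using E by simp
      finally have 2: "8 ^ m / real N * (\<Sum>q\<in>J. 1 / real q) \<le> s ^ m / 8" .
      have "s ^ m / 8 + s ^ m / 8 = s ^ m / 4" by simp
      then show "real (card J) * (4 ^ m * s ^ m * (1 / real N ^ m)) + 8 ^ m / real N * (\<Sum>q\<in>J. 1 / real q) \<le> s ^ m / 4"
        using add_mono[OF 1 2] by (simp only:)
    qed
    finally show "emeasure lborel R \<le> ennreal (s ^ m / 4)" .
  qed
qed

text \<open>The widening by \<rho> transfers avoidance from a point \<open>z\<close> to a rational
  point within \<rho> of it. The contribution of \<rho> is estimated crudely through
  \<open>X\<close>, the rest through \<open>D\<close>; each takes an eighth of the cube.\<close>

lemma danger_measure: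
  fixes a :: "real ^ 'm"
  assumes t: "1 < t" and s: "0 < s" "s \<le> 1" and X: "1 \<le> X" and \<rho>: "0 < \<rho>" "\<rho> * X \<le> 1/4"
  defines "m \<equiv> CARD('m)"
  assumes mt: "real m * t > real m + 2" and roomy: "roomy m t s Y" and E: "2 ^ m * X * (6 * X * \<rho>) ^ m \<le> s ^ m / 8"
  obtains R where "R \<in> sets lborel"
    "\<And>z q p. z \<in> box_at a s \<Longrightarrow> Y < real q \<Longrightarrow> real q \<le> X \<Longrightarrow>
       \<forall>i. \<bar>z $ i - rat_pt p q $ i\<bar> \<le> 2 * real q powr (-1-t) + \<rho> \<Longrightarrow> z \<in> R"
    "emeasure lborel R \<le> ennreal (s ^ m / 4)"
proof -
  define J where "J = {q. Y < real q \<and> real q \<le> X}"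
  have Y: "Y \<ge> 8" using roomy by (simp add: roomy_def)
  have J1: "real q \<ge> 8" if "q \<in> J" for q using that Y by (auto simp: J_def)
  have Jsub: "J \<subseteq> {1..nat \<lfloor>X\<rfloor>}"
  proof
    fix q assume q: "q \<in> J"
    then have "q \<ge> 1" using J1[OF q] by simp
    then show "q \<in> {1..nat \<lfloor>X\<rfloor>}" using q by (auto simp: J_def le_nat_floor)
  qed
  then have finJ: "finite J" by (rule finite_subset) simp
  have "card J \<le> nat \<lfloor>X\<rfloor>" using card_mono[OF _ Jsub] by simp
  then have cJ: "real (card J) \<le> X" using X by linarith
  define w where "w q = 2 * real q powr (-1-t) + \<rho>" for q :: nat
  have wJ: "q \<ge> 1 \<and> 0 \<le> w q \<and> w q * real q \<le> 1/2" if q: "q \<in> J" for q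
  proof -
    have q8: "real q \<ge> 8" using J1[OF q] .
    have "real q powr (-1-t) * real q = real q powr (-t)" using q8 by (simp add: powr_mult_base mult.commute)
    also have "\<dots> \<le> real q powr (-1)" using q8 t by (intro powr_mono) auto
    also have "\<dots> \<le> 1/8" using q8 by (simp add: powr_minus_divide field_simps)
    finally have 1: "2 * real q powr (-1-t) * real q \<le> 1/4" by simp
    have "\<rho> * real q \<le> \<rho> * X" using q \<rho> by (intro mult_left_mono) (auto simp: J_def)
    then have "w q * real q \<le> 1/2" using 1 \<rho> unfolding w_def distrib_right by linarith
    then show ?thesis using q8 \<rho> by (simp add: w_def)
  qed
  obtain R where R: "R \<in> sets lborel"
    "\<And>z q p. z \<in> box_at a s \<Longrightarrow> q \<in> J \<Longrightarrow> \<forall>i. \<bar>z $ i - rat_pt p q $ i\<bar> \<le> w q \<Longrightarrow> z \<in> R"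
    "emeasure lborel R \<le> ennreal (\<Sum>q\<in>J. ((real q * s + 2) * (2 * w q)) ^ m)"
    using emeasure_near_rationals_UN[OF finJ wJ less_imp_le[OF s(1)], of a] unfolding m_def by blast
  define D where "D = 4 ^ m * ((4 * s) ^ m * Y powr (2 - real m * t) + 8 ^ m * Y powr (2 - real m - real m * t))"
  have D0: "D \<ge> 0" using s by (simp add: D_def)
  show ?thesis
  proof (rule that[OF R(1)])
    show "z \<in> R" if "z \<in> box_at a s" "Y < real q" "real q \<le> X" "\<forall>i. \<bar>z $ i - rat_pt p q $ i\<bar> \<le> 2 * real q powr (-1-t) + \<rho>" for z q p
      using that by (intro R(2)[of z q p]) (auto simp: J_def w_def)
    have est: "((real q * s + 2) * (2 * w q)) ^ m \<le> D * (1 / (real q)\<^sup>2) + 2 ^ m * (6 * X * \<rho>) ^ m"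
      if q: "q \<in> J" for q
    proof -
      have q8: "real q \<ge> 8" using J1[OF q] .
      have Yq: "Y < real q" "real q \<le> X" using q by (auto simp: J_def)
      let ?u = "4 * s * real q powr (-t) + 8 * real q powr (-1-t)"
      let ?v = "(real q * s + 2) * (2 * \<rho>)"
      have base: "real q * real q powr (-1-t) = real q powr (-t)" using q8 by (simp add: powr_mult_base)
      have "(real q * s + 2) * (2 * w q) = 4 * s * (real q * real q powr (-1-t)) + 8 * real q powr (-1-t) + ?v"
        by (simp add: w_def algebra_simps)
      then have "(real q * s + 2) * (2 * w q) = ?u + ?v" unfolding base .
      also have "(?u + ?v) ^ m \<le> 2 ^ m * (?u ^ m + ?v ^ m)" using s \<rho> by (intro power_add_le) auto
      finally have 1: "((real q * s + 2) * (2 * w q)) ^ m \<le> 2 ^ m * (?u ^ m + ?v ^ m)" .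
      have "real q * s + 2 \<le> X * 1 + 2 * X" using Yq s X by (intro add_mono mult_mono) auto
      then have "?v \<le> (3 * X) * (2 * \<rho>)" using \<rho> by (intro mult_right_mono) auto
      then have 2: "?v ^ m \<le> (6 * X * \<rho>) ^ m" using s \<rho> by (intro power_mono) (auto simp: mult_ac)
      have "?u ^ m \<le> 2 ^ m * ((4 * s * real q powr (-t)) ^ m + (8 * real q powr (-1-t)) ^ m)"
        using s by (intro power_add_le) auto
      \<comment> \<open>Splitting off \<open>q powr (-2)\<close> leaves a convergent sum; the
        remaining powers have negative exponents and are bounded by their values at
        \<open>Y\<close>.\<close>
      also have "(4 * s * real q powr (-t)) ^ m = (4 * s) ^ m * (real q powr (-2) * real q powr (2 - real m * t))"
        using q8 by (simp only: power_mult_distrib powr_power powr_add[symmetric]) (simp add: algebra_simps)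
      also have "(8 * real q powr (-1-t)) ^ m = 8 ^ m * (real q powr (-2) * real q powr (2 - real m - real m * t))"
        using q8 by (simp only: power_mult_distrib powr_power powr_add[symmetric]) (simp add: algebra_simps)
      finally have "?u ^ m \<le> 2 ^ m * ((4 * s) ^ m * (real q powr (-2) * real q powr (2 - real m * t)) +
          8 ^ m * (real q powr (-2) * real q powr (2 - real m - real m * t)))" .
      also have "\<dots> \<le> 2 ^ m * ((4 * s) ^ m * (real q powr (-2) * Y powr (2 - real m * t)) +
          8 ^ m * (real q powr (-2) * Y powr (2 - real m - real m * t)))"
        using Yq Y mt s by (intro mult_left_mono add_mono powr_mono2') auto
      finally have 3: "2 ^ m * ?u ^ m \<le> 2 ^ m * (2 ^ m * ((4 * s) ^ m * (real q powr (-2) * Y powr (2 - real m * t)) +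
          8 ^ m * (real q powr (-2) * Y powr (2 - real m - real m * t))))" by (rule mult_left_mono) simp
      have "(2 :: real) ^ m * 2 ^ m = 4 ^ m" by (simp flip: power_mult_distrib)
      then have eqD: "2 ^ m * (2 ^ m * ((4 * s) ^ m * (real q powr (-2) * Y powr (2 - real m * t)) +
          8 ^ m * (real q powr (-2) * Y powr (2 - real m - real m * t)))) = D * real q powr (-2)"
        unfolding D_def by (simp add: algebra_simps flip: \<open>2 ^ m * 2 ^ m = 4 ^ m\<close>)
      have "real q powr (-2) = 1 / (real q)\<^sup>2" using q8 by (simp add: powr_minus_divide)
      then have "2 ^ m * ?u ^ m \<le> D * (1 / (real q)\<^sup>2)" using 3 unfolding eqD by (simp only:)
      moreover have "2 ^ m * ?v ^ m \<le> 2 ^ m * (6 * X * \<rho>) ^ m" using 2 by (rule mult_left_mono) simp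
      ultimately show ?thesis using 1 unfolding distrib_left by linarith
    qed
    note R(3)
    also have "ennreal (\<Sum>q\<in>J. ((real q * s + 2) * (2 * w q)) ^ m) \<le>
      ennreal (\<Sum>q\<in>J. D * (1 / (real q)\<^sup>2) + 2 ^ m * (6 * X * \<rho>) ^ m)"
      by (intro ennreal_leI sum_mono est)
    also have "(\<Sum>q\<in>J. D * (1 / (real q)\<^sup>2) + 2 ^ m * (6 * X * \<rho>) ^ m) =
       D * (\<Sum>q\<in>J. 1 / (real q)\<^sup>2) + real (card J) * (2 ^ m * (6 * X * \<rho>) ^ m)"
      by (simp add: sum.distrib sum_distrib_left)
    also have "ennreal \<dots> \<le> ennreal (s ^ m / 4)"
    proof (rule ennreal_leI)
      have "(\<Sum>q\<in>J. 1 / (real q)\<^sup>2) \<le> (\<Sum>q=1..nat \<lfloor>X\<rfloor>. 1 / (real q)\<^sup>2)" using Jsub by (intro sum_mono2) auto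
      also have "\<dots> \<le> 2" by (rule sum_inverse_squares_le)
      finally have "D * (\<Sum>q\<in>J. 1 / (real q)\<^sup>2) \<le> D * 2" using D0 by (rule mult_left_mono)
      also have "\<dots> \<le> s ^ m / 8" using roomy by (simp add: roomy_def D_def mult_ac)
      finally have 1: "D * (\<Sum>q\<in>J. 1 / (real q)\<^sup>2) \<le> s ^ m / 8" .
      have "real (card J) * (2 ^ m * (6 * X * \<rho>) ^ m) \<le> X * (2 ^ m * (6 * X * \<rho>) ^ m)"
        using cJ X \<rho> by (intro mult_right_mono) auto
      also have "\<dots> \<le> s ^ m / 8" using E by (simp add: mult_ac)
      finally have 2: "real (card J) * (2 ^ m * (6 * X * \<rho>) ^ m) \<le> s ^ m / 8" .
      have "s ^ m / 8 + s ^ m / 8 = s ^ m / 4" by simp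
      then show "D * (\<Sum>q\<in>J. 1 / (real q)\<^sup>2) + real (card J) * (2 ^ m * (6 * X * \<rho>) ^ m) \<le> s ^ m / 4"
        using add_mono[OF 1 2] by (simp only:)
    qed
    finally show "emeasure lborel R \<le> ennreal (s ^ m / 4)" .
  qed
qed

abbreviation pt :: "(int ^ 'm) \<times> nat \<Rightarrow> real ^ 'm" where
  "pt x \<equiv> rat_pt (fst x) (snd x)"

text \<open>\<open>s\<close> is half the side of the parent cube, whose lower corner is
  \<open>a\<close>. The margin \<open>s / 4\<close> leaves room for the whole cube of the child next
  to its centre.\<close>

definition good_child :: "real \<Rightarrow> nat \<Rightarrow> real ^ 'm \<Rightarrow> real \<Rightarrow> real \<Rightarrow> (int ^ 'm) \<times> nat \<Rightarrow> bool" where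
  "good_child t N a s Y x \<longleftrightarrow> lowest_terms (fst x) (snd x) \<and> N ^ CARD('m) \<le> 8 * 4 ^ CARD('m) * snd x \<and> snd x \<le> N ^ CARD('m)
     \<and> (\<forall>i. a $ i + s / 4 \<le> pt x $ i \<and> pt x $ i \<le> a $ i + 7 * s / 4) \<and> avoids t Y ((2 * real (snd x)) powr (1/t)) (pt x)"

text \<open>Half of the volume \<open>s ^ m\<close> remains outside the two exceptional sets, and
  each child accounts for a box of side \<open>2 * (m + 1) * sep m N\<close>.\<close>

definition children_ratio :: "nat \<Rightarrow> real" where
  "children_ratio m = 1 / (2 * (2 * (real m + 1)) ^ m)"

text \<open>These conditions make both exceptional sets small and let Dirichlet's theorem move
  points by at most \<open>s / 4\<close>. Apart from the logarithmic one they amount to negative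
  powers of \<open>N\<close> being small; where \<open>X\<close> is involved the exponent is
  negative because \<open>m / t < m\<close>.\<close>

lemma eventually_child_conditions:
  assumes t: "1 < t" and s: "0 < s" and m: "m \<ge> 1"
  shows "eventually (\<lambda>N. N \<ge> 2 \<and> 8 ^ m * (1 + ln (real (N ^ m))) / real N \<le> s ^ m / 8 \<and> sep m N \<le> s / 4 \<and>
     sep m N * (2 * real N ^ m) powr (1/t) \<le> 1/4 \<and>
     2 ^ m * (2 * real N ^ m) powr (1/t) * (6 * (2 * real N ^ m) powr (1/t) * sep m N) ^ m \<le> s ^ m / 8) sequentially"
proof -
  define c where "c = 8 * (4 :: real) ^ m"
  define b where "b = (2 :: real) powr (1/t)"
  have mt: "real m / t < real m" using t m by (simp add: divide_less_eq)
  have X: "(2 * real N ^ m) powr (1/t) = b * real N powr (m/t)" if "N \<ge> 2" for N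
    using that by (simp add: b_def powr_mult powr_powr flip: powr_realpow)
  have S: "sep m N = c * real N powr (-(real m + 1))" if "N \<ge> 2" for N
    using that by (simp only: sep_eq_powr c_def)
  have neg0: "(\<lambda>N. C * real N powr e) \<longlonglongrightarrow> 0" if "e < 0" for C e
    using tendsto_mult[OF tendsto_const[of C] tendsto_neg_powr[OF that filterlim_real_sequentially]] by simp
  have l1: "(\<lambda>N. 8 ^ m * (1 + real m * ln (real N)) / real N) \<longlonglongrightarrow> 0" by real_asymp
  have "eventually (\<lambda>N. 8 ^ m * (1 + real m * ln (real N)) / real N < s ^ m / 8) sequentially"
    using s by (intro order_tendstoD(2)[OF l1]) simp
  moreover have "eventually (\<lambda>N. c * real N powr (-(real m + 1)) < s / 4) sequentially"
    using s by (intro order_tendstoD(2)[OF neg0]) auto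
  moreover have "eventually (\<lambda>N. b * c * real N powr (m/t - (real m + 1)) < 1/4) sequentially"
    using mt by (intro order_tendstoD(2)[OF neg0]) auto
  moreover have "eventually (\<lambda>N. 2 ^ m * b * (6 * b * c) ^ m * real N powr ((m + 1) * (m/t - m)) < s ^ m / 8) sequentially"
    using mt s by (intro order_tendstoD(2)[OF neg0]) (auto simp: mult_less_0_iff)
  moreover have "eventually (\<lambda>N. N \<ge> (2::nat)) sequentially" by (rule eventually_ge_at_top)
  ultimately show ?thesis
  proof eventually_elim
    case (elim N)
    have N: "real N > 0" using elim by simp
    have XS: "b * real N powr (m/t) * (c * real N powr (-(real m + 1))) = b * c * real N powr (m/t - (real m + 1))"
    proof -
      have "real N powr (m/t) * real N powr (-(real m + 1)) = real N powr (m/t - (real m + 1))"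
        by (simp only: powr_add[symmetric]) (simp add: algebra_simps)
      then show ?thesis by (metis mult.assoc mult.left_commute)
    qed
    have "real N powr (m/t) * (real N powr (m/t - (real m + 1))) ^ m = real N powr (m/t + (m/t - (real m + 1)) * m)"
      using N by (simp add: powr_power mult.commute flip: powr_add)
    also have "m/t + (m/t - (real m + 1)) * m = (m + 1) * (m/t - m)" by (simp add: algebra_simps add_divide_distrib)
    finally have P: "real N powr (m/t) * (real N powr (m/t - (real m + 1))) ^ m = real N powr ((m + 1) * (m/t - m))" .
    have "2 ^ m * (b * real N powr (m/t)) * (6 * (b * real N powr (m/t)) * (c * real N powr (-(real m + 1)))) ^ m
        = 2 ^ m * (b * real N powr (m/t)) * (6 * (b * c * real N powr (m/t - (real m + 1)))) ^ m"
      using XS by (simp only: mult.assoc)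
    also have "\<dots> = 2 ^ m * b * (6 * b * c) ^ m * (real N powr (m/t) * (real N powr (m/t - (real m + 1))) ^ m)"
      by (simp add: power_mult_distrib mult_ac)
    finally have XE: "2 ^ m * (b * real N powr (m/t)) * (6 * (b * real N powr (m/t)) * (c * real N powr (-(real m + 1)))) ^ m
        = 2 ^ m * b * (6 * b * c) ^ m * real N powr ((m + 1) * (m/t - m))" unfolding P .
    have L: "ln (real (N ^ m)) = real m * ln (real N)" using N by (simp add: ln_realpow)
    have SX: "c * real N powr (-(real m + 1)) * (b * real N powr (m/t)) = b * c * real N powr (m/t - (real m + 1))"
      using XS by (simp only: mult.commute)
    show ?case unfolding X[OF elim(5)] S[OF elim(5)] XE SX L using elim by (auto intro: less_imp_le)
  qed
qed

section \<open>Children of a cube\<close>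

lemma norm_le_card_mult:
  fixes v :: "real ^ 'm"
  assumes "\<And>i. \<bar>v $ i\<bar> \<le> r"
  shows "norm v \<le> real CARD('m) * r"
proof -
  have "norm v \<le> (\<Sum>i\<in>UNIV. \<bar>v $ i\<bar>)" by (rule norm_le_l1_cart)
  also have "\<dots> \<le> (\<Sum>i\<in>(UNIV :: 'm set). r)" by (intro sum_mono assms)
  finally show ?thesis by simp
qed

text \<open>Dirichlet's theorem at the points of a middle cube outside both exceptional sets yields
  good children. Boxes around a maximal separated set of their centres cover what remains of the
  middle cube, which bounds the cardinality from below.\<close>

lemma eventually_children:
  fixes a :: "real ^ 'm"
  assumes t: "1 < t" and s: "0 < s" "s \<le> 1"
  defines "m \<equiv> CARD('m)"
  assumes mt: "real m * t > real m + 2" and roomy: "roomy m t s Y"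
  shows "eventually (\<lambda>N. \<exists>Z. finite Z \<and> children_ratio m * (s / sep m N) ^ m \<le> real (card Z) \<and>
     (\<forall>x\<in>Z. good_child t N a s Y x) \<and> (\<forall>x\<in>Z. \<forall>y\<in>Z. x \<noteq> y \<longrightarrow> sep m N \<le> dist (pt x) (pt y))) sequentially"
proof -
  have m: "m \<ge> 1" by (simp add: m_def Suc_leI)
  show ?thesis using eventually_child_conditions[OF t s(1) m]
  proof eventually_elim
    case (elim N)
    define X where "X = (2 * real N ^ m) powr (1/t)"
    define \<rho> where "\<rho> = sep m N"
    \<comment> \<open>The middle cube runs from \<open>a + s/2\<close> to
      \<open>a + 3 * s/2\<close>: a move by \<open>\<rho> \<le> s / 4\<close> stays in the range
      demanded by \<open>good_child\<close>.\<close>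
    define a' where "a' = (\<chi> i. a $ i + s / 2)"
    have N: "N \<ge> 2" and \<rho>0: "\<rho> > 0" using elim by (auto simp: \<rho>_def sep_def)
    have X1: "1 \<le> X" unfolding X_def
    proof (rule ge_one_powr_ge_zero)
      have "real N ^ m \<ge> 1" using N by simp
      then show "1 \<le> 2 * real N ^ m" by simp
    qed (use t in auto)
    have Xq: "(2 * real q) powr (1/t) \<le> X" if "q \<le> N ^ m" for q
    proof -
      have "real q \<le> real (N ^ m)" using that by (simp only: of_nat_le_iff)
      then show ?thesis unfolding X_def using t by (intro powr_mono2) auto
    qed
    obtain R1 where R1: "R1 \<in> sets lborel"
      "\<And>z q p. z \<in> box_at a' s \<Longrightarrow> 1 \<le> q \<Longrightarrow> 8 * 4 ^ m * q < N ^ m \<Longrightarrow> \<forall>i. \<bar>z $ i - rat_pt p q $ i\<bar> \<le> 1 / (real q * real N) \<Longrightarrow> z \<in> R1"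
      "emeasure lborel R1 \<le> ennreal (s ^ m / 4)"
      using small_denominators_measure[of s N a'] s N elim unfolding m_def by blast
    obtain R2 where R2: "R2 \<in> sets lborel"
      "\<And>z q p. z \<in> box_at a' s \<Longrightarrow> Y < real q \<Longrightarrow> real q \<le> X \<Longrightarrow>
         \<forall>i. \<bar>z $ i - rat_pt p q $ i\<bar> \<le> 2 * real q powr (-1-t) + \<rho> \<Longrightarrow> z \<in> R2"
      "emeasure lborel R2 \<le> ennreal (s ^ m / 4)"
      using danger_measure[OF t s X1 \<rho>0, of Y a'] mt roomy elim unfolding m_def[symmetric] X_def \<rho>_def by blast
    define S where "S = {pt x | x. good_child t N a s Y x}"
    have cand: "\<exists>x\<in>S. \<forall>i. \<bar>z $ i - x $ i\<bar> \<le> \<rho>" if z: "z \<in> box_at a' s" "z \<notin> R1" "z \<notin> R2" for z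
    proof -
      have N1: "N \<ge> 1" using N by simp
      obtain p :: "int ^ 'm" and q where pq: "lowest_terms p q" "q \<le> N ^ m" "\<And>i. \<bar>z $ i - rat_pt p q $ i\<bar> \<le> 1 / (real q * real N)"
        using Dirichlet_vec[OF N1] unfolding m_def by blast
      have q1: "q \<ge> 1" using pq by (simp add: lowest_terms_def)
      have big: "N ^ m \<le> 8 * 4 ^ m * q" using R1(2)[OF z(1) q1] pq(3) z(2) by (meson not_le)
      then have "real (N ^ m) \<le> real (8 * 4 ^ m * q)" by (simp only: of_nat_le_iff)
      then have "real N ^ m \<le> 8 * 4 ^ m * real q" by simp
      then have "1 / (real q * real N) \<le> \<rho>"
        using q1 N unfolding \<rho>_def sep_def by (simp add: field_simps)
      then have near: "\<bar>z $ i - rat_pt p q $ i\<bar> \<le> \<rho>" for i using pq(3) order_trans by blast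
      have "avoids t Y ((2 * real q) powr (1/t)) (rat_pt p q)"
        unfolding avoids_def
      proof (intro allI impI)
        fix q' :: nat and p' :: "int ^ 'm" assume q': "Y < real q'" "real q' \<le> (2 * real q) powr (1/t)"
        then have "real q' \<le> X" using Xq[OF pq(2)] by linarith
        then obtain i where "\<bar>z $ i - rat_pt p' q' $ i\<bar> > 2 * real q' powr (-1-t) + \<rho>"
          using R2(2)[OF z(1) q'(1), of p'] z(3) by (meson not_le)
        then show "\<exists>i. \<bar>rat_pt p q $ i - rat_pt p' q' $ i\<bar> > 2 * real q' powr (-1-t)"
          using near[of i] by (intro exI[of _ i]) linarith
      qed
      moreover have "a $ i + s / 4 \<le> rat_pt p q $ i \<and> rat_pt p q $ i \<le> a $ i + 7 * s / 4" for i
      proof -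
        have "a $ i + s / 2 \<le> z $ i" "z $ i \<le> a $ i + s / 2 + s" using z(1) by (auto simp: mem_box_at a'_def)
        then show ?thesis using near[of i] elim unfolding \<rho>_def by linarith
      qed
      ultimately have "good_child t N a s Y (p, q)"
        unfolding good_child_def using pq big by (simp add: m_def)
      then show ?thesis using near unfolding S_def by fastforce
    qed
    have "S \<subseteq> box_at a (2 * s)"
    proof
      fix x assume "x \<in> S"
      then have "a $ i + s / 4 \<le> x $ i \<and> x $ i \<le> a $ i + 7 * s / 4" for i by (auto simp: S_def good_child_def)
      moreover have "s / 4 \<ge> 0" "7 * s / 4 \<le> 2 * s" using s by auto
      ultimately show "x \<in> box_at a (2 * s)" unfolding mem_box_at by (meson add_increasing2 add_left_mono order_trans order_refl)
    qed
    then have "bounded S" unfolding box_at_def by (rule bounded_subset[OF bounded_cbox])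
    then obtain Z0 where Z0: "finite Z0" "Z0 \<subseteq> S" "\<And>x y. x \<in> Z0 \<Longrightarrow> y \<in> Z0 \<Longrightarrow> x \<noteq> y \<Longrightarrow> \<rho> \<le> dist x y"
      "\<And>x. x \<in> S \<Longrightarrow> \<exists>z\<in>Z0. dist x z < \<rho>"
      using maximal_separated_exists[OF _ \<rho>0] by metis
    \<comment> \<open>\<open>w \<ge> 2 * \<rho>\<close> as \<open>m \<ge> 1\<close>: one \<rho>
      leads from the point to its Dirichlet fraction, another from there to the separated
      set.\<close>
    define w where "w = (real m + 1) * \<rho>"
    have w0: "w \<ge> 0" using \<rho>0 by (simp add: w_def)
    define B where "B x = box_at (\<chi> i. x $ i - w) (2 * w)" for x :: "real ^ 'm"
    have cover: "box_at a' s \<subseteq> R1 \<union> R2 \<union> (\<Union>x\<in>Z0. B x)"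
    proof
      fix z assume z: "z \<in> box_at a' s"
      show "z \<in> R1 \<union> R2 \<union> (\<Union>x\<in>Z0. B x)"
      proof (cases "z \<in> R1 \<or> z \<in> R2")
        case False
        then obtain x where x: "x \<in> S" "\<And>i. \<bar>z $ i - x $ i\<bar> \<le> \<rho>" using cand[OF z] by blast
        obtain y where y: "y \<in> Z0" "dist x y < \<rho>" using Z0(4)[OF x(1)] by blast
        have "y $ i - w \<le> z $ i \<and> z $ i \<le> y $ i - w + 2 * w" for i
        proof -
          have "\<bar>x $ i - y $ i\<bar> \<le> norm (x - y)" using component_le_norm_cart[of "x - y" i] by simp
          then have "\<bar>x $ i - y $ i\<bar> \<le> \<rho>" using y(2) by (simp add: dist_norm)
          then have "\<bar>z $ i - y $ i\<bar> \<le> 2 * \<rho>" using x(2)[of i] by linarith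
          also have "\<dots> \<le> w" unfolding w_def using m \<rho>0 by (intro mult_right_mono) auto
          finally show ?thesis by linarith
        qed
        then have "z \<in> B y" unfolding B_def mem_box_at by simp
        then show ?thesis using y(1) by blast
      qed auto
    qed
    have measB: "B x \<in> sets lborel" for x by (simp add: B_def)
    have "ennreal (s ^ m) = emeasure lborel (box_at a' s)" using s by (simp add: emeasure_box_at m_def)
    also have "\<dots> \<le> emeasure lborel (R1 \<union> R2 \<union> (\<Union>x\<in>Z0. B x))"
      using cover R1(1) R2(1) Z0(1) measB by (intro emeasure_mono) auto
    also have "\<dots> \<le> emeasure lborel (R1 \<union> R2) + emeasure lborel (\<Union>x\<in>Z0. B x)"
      using R1(1) R2(1) Z0(1) measB by (intro emeasure_subadditive) auto
    also have "\<dots> \<le> (emeasure lborel R1 + emeasure lborel R2) + (\<Sum>x\<in>Z0. emeasure lborel (B x))"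
      using R1(1) R2(1) Z0(1) measB by (intro add_mono emeasure_subadditive emeasure_subadditive_finite) auto
    also have "\<dots> \<le> (ennreal (s ^ m / 4) + ennreal (s ^ m / 4)) + (\<Sum>x\<in>Z0. ennreal ((2 * w) ^ m))"
      using R1(3) R2(3) w0 by (intro add_mono sum_mono) (auto simp: B_def emeasure_box_at m_def)
    also have "\<dots> = ennreal (s ^ m / 4 + s ^ m / 4 + real (card Z0) * (2 * w) ^ m)"
    proof -
      have "(\<Sum>x\<in>Z0. ennreal ((2 * w) ^ m)) = ennreal (real (card Z0) * (2 * w) ^ m)"
        using w0 by (subst sum_ennreal) auto
      then show ?thesis using s w0 by (simp only:) (subst ennreal_plus, simp, simp)+
    qed
    finally have "s ^ m \<le> s ^ m / 4 + s ^ m / 4 + real (card Z0) * (2 * w) ^ m"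
      using s w0 by (subst (asm) ennreal_le_iff) auto
    then have "s ^ m / 2 \<le> real (card Z0) * (2 * w) ^ m" by linarith
    moreover have w1: "(2 * w) ^ m = (2 * (real m + 1)) ^ m * \<rho> ^ m" by (simp add: w_def power_mult_distrib mult_ac)
    moreover have "(2 * (real m + 1)) ^ m > 0" "\<rho> ^ m > 0" using \<rho>0 by auto
    ultimately have "s ^ m / 2 / ((2 * (real m + 1)) ^ m * \<rho> ^ m) \<le> real (card Z0)"
      by (subst pos_divide_le_eq) auto
    then have cZ: "children_ratio m * (s / \<rho>) ^ m \<le> real (card Z0)"
      by (simp add: children_ratio_def power_divide mult_ac)
    have "\<forall>x. \<exists>y. x \<in> Z0 \<longrightarrow> x = pt y \<and> good_child t N a s Y y" using Z0(2) by (auto simp: S_def)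
    from choice[OF this] obtain g where g: "\<And>x. x \<in> Z0 \<Longrightarrow> x = pt (g x)" "\<And>x. x \<in> Z0 \<Longrightarrow> good_child t N a s Y (g x)" by blast
    have inj: "inj_on g Z0" by (metis g(1) inj_onI)
    show ?case
    proof (intro exI[of _ "g ` Z0"] conjI ballI impI)
      show "finite (g ` Z0)" using Z0(1) by simp
      show "children_ratio m * (s / sep m N) ^ m \<le> real (card (g ` Z0))"
        using cZ card_image[OF inj] by (simp add: \<rho>_def)
      show "good_child t N a s Y x" if "x \<in> g ` Z0" for x using that g(2) by auto
      show "sep m N \<le> dist (pt x) (pt y)" if "x \<in> g ` Z0" "y \<in> g ` Z0" "x \<noteq> y" for x y
      proof -
        note xy = that
        obtain u v where "u \<in> Z0" "v \<in> Z0" "x = g u" "y = g v" using xy by auto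
        then show ?thesis using Z0(3)[of u v] g(1)[of u] g(1)[of v] xy(3) by (auto simp: \<rho>_def)
      qed
    qed
  qed
qed

section \<open>Random matrices with a prescribed column\<close>

lemma Basis_mat: "(Basis :: (real ^ 'n ^ 'm) set) = (\<lambda>(i, j). axis i (axis j 1)) ` UNIV"
  unfolding Basis_vec_def by auto

lemma inner_axis_mat: "(A :: real ^ 'n ^ 'm) \<bullet> axis i (axis j 1) = A $ i $ j"
  by (simp add: inner_axis)

lemma mem_cbox_mat: "(x :: real ^ 'n ^ 'm) \<in> cbox a b \<longleftrightarrow> (\<forall>i j. a $ i $ j \<le> x $ i $ j \<and> x $ i $ j \<le> b $ i $ j)"
  unfolding mem_box Basis_mat by (auto simp: inner_axis_mat)

lemma emeasure_cbox_mat: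
  fixes a b :: "real ^ 'n ^ 'm"
  assumes "\<And>i j. a $ i $ j \<le> b $ i $ j"
  shows "emeasure lborel (cbox a b) = ennreal (\<Prod>i\<in>UNIV. \<Prod>j\<in>UNIV. b $ i $ j - a $ i $ j)"
proof -
  have inj: "inj (\<lambda>(i :: 'm, j :: 'n). axis i (axis j (1 :: real)))"
    by (auto simp: inj_on_def axis_eq_axis)
  have "emeasure lborel (cbox a b) = ennreal (\<Prod>d\<in>Basis. (b - a) \<bullet> d)"
    using assms by (subst emeasure_lborel_cbox_eq) (auto simp: Basis_mat inner_axis_mat)
  also have "(\<Prod>d\<in>Basis. (b - a) \<bullet> d) = (\<Prod>(i, j)\<in>UNIV. b $ i $ j - a $ i $ j)"
    unfolding Basis_mat using inj by (subst prod.reindex) (auto simp: inner_axis_mat o_def split_beta)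
  also have "\<dots> = (\<Prod>i\<in>UNIV. \<Prod>j\<in>UNIV. b $ i $ j - a $ i $ j)"
    by (simp add: prod.cartesian_product flip: UNIV_Times_UNIV)
  finally show ?thesis .
qed

lemma maxnorm_le_iff: "maxnorm v \<le> r \<longleftrightarrow> (\<forall>i. \<bar>v $ i\<bar> \<le> r)"
  unfolding maxnorm_def by (subst Max_le_iff) auto

lemma imaxnorm_le_iff: "imaxnorm v \<le> r \<longleftrightarrow> (\<forall>i. \<bar>v $ i\<bar> \<le> r)"
  unfolding imaxnorm_def by (subst Max_le_iff) auto

lemma imaxnorm_nonneg: "imaxnorm v \<ge> 0"
  using imaxnorm_le_iff[of v "imaxnorm v"] by (meson abs_ge_zero order_refl order_trans)

lemma imaxnorm_pos: "v \<noteq> 0 \<Longrightarrow> imaxnorm v \<ge> 1"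
  using imaxnorm_le_iff[of v 0] by (force simp: vec_eq_iff not_le)

lemma imaxnorm_axis: "imaxnorm (axis j q :: int ^ 'n) = \<bar>q\<bar>"
proof (rule antisym)
  show "imaxnorm (axis j q :: int ^ 'n) \<le> \<bar>q\<bar>" by (auto simp: imaxnorm_le_iff axis_def)
  have "\<bar>(axis j q :: int ^ 'n) $ j\<bar> \<le> imaxnorm (axis j q :: int ^ 'n)" using imaxnorm_le_iff by blast
  then show "\<bar>q\<bar> \<le> imaxnorm (axis j q :: int ^ 'n)" by simp
qed

text \<open>Half-open, because one entry will serve as a parameter \<open>u\<close> in
  \<open>[0, 1)\<close>, for which \<open>\<lfloor>u * M\<rfloor>\<close> is an index below
  \<open>M\<close>.\<close>

definition unit_mats :: "(real ^ 'n ^ 'm) set" where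
  "unit_mats = {B. \<forall>i j. 0 \<le> B $ i $ j \<and> B $ i $ j < 1}"

text \<open>The entry \<open>(i0, j0)\<close>, which is overwritten anyway, serves as the random parameter of the column.\<close>

definition put_col :: "'m \<Rightarrow> 'n \<Rightarrow> (real \<Rightarrow> real ^ 'm) \<Rightarrow> real ^ 'n ^ 'm \<Rightarrow> real ^ 'n ^ 'm" where
  "put_col i0 j0 f B = (\<chi> i j. if j = j0 then f (B $ i0 $ j0) $ i else B $ i $ j)"

lemma measurable_entry [measurable]: "(\<lambda>B :: real ^ 'n ^ 'm. B $ i $ j) \<in> borel_measurable borel"
  by (intro borel_measurable_continuous_onI continuous_intros)

lemma unit_mats_sets [measurable, simp]: "unit_mats \<in> sets borel"
proof -
  have "{B :: real ^ 'n ^ 'm \<in> space borel. \<forall>i j. 0 \<le> B $ i $ j \<and> B $ i $ j < 1} \<in> sets borel" by measurable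
  then show ?thesis by (simp add: unit_mats_def)
qed

lemma emeasure_unit_mats_pos: "emeasure lborel (unit_mats :: (real ^ 'n ^ 'm) set) > 0"
proof -
  let ?b = "(\<chi> i j. 1/2) :: real ^ 'n ^ 'm"
  have "0 < emeasure lborel (cbox 0 ?b)" by (subst emeasure_cbox_mat) (auto simp: prod_pos)
  also have "\<dots> \<le> emeasure lborel (unit_mats :: (real ^ 'n ^ 'm) set)"
  proof (rule emeasure_mono)
    show "cbox 0 ?b \<subseteq> unit_mats"
    proof
      fix x assume "x \<in> cbox 0 ?b"
      then have x: "0 \<le> x $ i $ j" "x $ i $ j \<le> 1/2" for i j by (auto simp: mem_cbox_mat)
      have "x $ i $ j < 1" for i j using x(2)[of i j] by simp
      then show "x \<in> unit_mats" using x by (simp add: unit_mats_def)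
    qed
  qed simp
  finally show ?thesis .
qed

lemma norm_column_le: "norm (\<chi> i. A $ i $ j) \<le> norm (A :: real ^ 'n ^ 'm)"
  unfolding norm_vec_def[of A] norm_vec_def[of "\<chi> i. A $ i $ j"]
  by (intro L2_set_mono) (auto simp: component_le_norm_cart)

lemma abs_entry_le_norm: "\<bar>A $ i $ j\<bar> \<le> norm (A :: real ^ 'n ^ 'm)"
  using component_le_norm_cart[of "A $ i" j] Finite_Cartesian_Product.norm_nth_le[of A i] by linarith

text \<open>The image of Lebesgue measure on \<open>[0, 1)\<close> under \<open>f\<close> gives the
  ball around \<open>x\<close> mass at most \<open>v\<close>, expressed by explicit intervals of
  length \<open>1 / M\<close>, which can be multiplied with boxes in the other matrix
  entries.\<close>

definition interval_cover :: "(real \<Rightarrow> 'a::metric_space) \<Rightarrow> 'a \<Rightarrow> real \<Rightarrow> real \<Rightarrow> bool" where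
  "interval_cover f x \<rho> v \<longleftrightarrow> (\<exists>M I. M \<ge> (1::nat) \<and> finite I \<and>
     {u \<in> {0..<1}. f u \<in> cball x \<rho>} \<subseteq> (\<Union>i\<in>I. {real i / real M..(real i + 1) / real M}) \<and> real (card I) / real M \<le> v)"

lemma interval_cover_mono: "interval_cover f x \<rho> v \<Longrightarrow> v \<le> w \<Longrightarrow> interval_cover f x \<rho> w"
  unfolding interval_cover_def by (meson order_trans)

lemma interval_cover_subset:
  assumes "interval_cover f x \<rho> v" "\<rho>' \<le> \<rho>" shows "interval_cover f x \<rho>' v"
proof -
  have "{u \<in> {0..<1}. f u \<in> cball x \<rho>'} \<subseteq> {u \<in> {0..<1}. f u \<in> cball x \<rho>}" using assms(2) by auto
  then show ?thesis using assms(1) unfolding interval_cover_def by (meson subset_trans)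
qed

lemma interval_cover_1: "interval_cover f x \<rho> 1"
  unfolding interval_cover_def by (intro exI[of _ 1] exI[of _ "{0}"]) auto

text \<open>Product of the interval cover with boxes: entries outside column \<open>j0\<close> are
  confined to length \<open>2 * \<rho>\<close>, the parameter to length \<open>1 / M\<close>, and
  the other entries of column \<open>j0\<close> range freely over \<open>[0, 1]\<close>.\<close>

lemma put_col_preimage_cover:
  fixes X :: "real ^ 'n ^ 'm"
  assumes ic: "interval_cover f (\<chi> i. X $ i $ j0) \<rho> v" and \<rho>: "0 < \<rho>"
  obtains R where "R \<in> sets lborel" "{B \<in> unit_mats. put_col i0 j0 f B \<in> cball X \<rho>} \<subseteq> R"
    "emeasure lborel R \<le> ennreal (v * (2 * \<rho>) ^ (CARD('m) * (CARD('n) - 1)))"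
proof -
  obtain M I where M: "M \<ge> (1::nat)" "finite I"
    "{u \<in> {0..<1}. f u \<in> cball (\<chi> i. X $ i $ j0) \<rho>} \<subseteq> (\<Union>i\<in>I. {real i / real M..(real i + 1) / real M})"
    "real (card I) / real M \<le> v" using ic unfolding interval_cover_def by blast
  define a where "a l = ((\<chi> i j. if j = j0 then (if i = i0 then real l / real M else 0) else X $ i $ j - \<rho>) :: real ^ 'n ^ 'm)" for l :: nat
  define b where "b l = ((\<chi> i j. if j = j0 then (if i = i0 then (real l + 1) / real M else 1) else X $ i $ j + \<rho>) :: real ^ 'n ^ 'm)" for l :: nat
  let ?e = "CARD('m) * (CARD('n) - 1)"
  have vol: "emeasure lborel (cbox (a l) (b l)) = ennreal (1 / real M * (2 * \<rho>) ^ ?e)" for l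
  proof -
    have le: "a l $ i $ j \<le> b l $ i $ j" for i j
      using \<rho> M(1) by (auto simp: a_def b_def divide_right_mono)
    have row: "(\<Prod>j\<in>UNIV. b l $ i $ j - a l $ i $ j) = (if i = i0 then 1 / real M else 1) * (2 * \<rho>) ^ (CARD('n) - 1)" for i
    proof -
      have "(\<Prod>j\<in>UNIV. b l $ i $ j - a l $ i $ j) =
         (b l $ i $ j0 - a l $ i $ j0) * (\<Prod>j\<in>UNIV - {j0}. b l $ i $ j - a l $ i $ j)"
        by (rule prod.remove) auto
      also have "(\<Prod>j\<in>UNIV - {j0}. b l $ i $ j - a l $ i $ j) = (\<Prod>j\<in>UNIV - {j0}. 2 * \<rho>)"
        by (intro prod.cong) (auto simp: a_def b_def)
      also have "b l $ i $ j0 - a l $ i $ j0 = (if i = i0 then 1 / real M else 1)"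
        by (simp add: a_def b_def add_divide_distrib)
      finally show ?thesis by (simp add: card_Diff_singleton)
    qed
    have "(\<Prod>i\<in>UNIV. \<Prod>j\<in>UNIV. b l $ i $ j - a l $ i $ j) = 1 / real M * (2 * \<rho>) ^ ?e"
    proof -
      have "(\<Prod>i\<in>(UNIV :: 'm set). (2 * \<rho>) ^ (CARD('n) - 1)) = (2 * \<rho>) ^ ?e"
        by (simp only: prod_constant power_mult[symmetric] mult.commute)
      then show ?thesis unfolding row by (simp only: prod.distrib) (simp add: prod.delta)
    qed
    then show ?thesis using le by (simp add: emeasure_cbox_mat)
  qed
  show ?thesis
  proof (rule that[of "\<Union>l\<in>I. cbox (a l) (b l)"])
    show "(\<Union>l\<in>I. cbox (a l) (b l)) \<in> sets lborel" using M(2) by auto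
    show "{B \<in> unit_mats. put_col i0 j0 f B \<in> cball X \<rho>} \<subseteq> (\<Union>l\<in>I. cbox (a l) (b l))"
    proof clarify
      fix B assume B: "B \<in> unit_mats" "put_col i0 j0 f B \<in> cball X \<rho>"
      let ?A = "put_col i0 j0 f B"
      let ?u = "B $ i0 $ j0"
      have nA: "norm (X - ?A) \<le> \<rho>" using B(2) by (simp add: dist_norm)
      have "(\<chi> i. (X - ?A) $ i $ j0) = (\<chi> i. X $ i $ j0) - f ?u" by (simp add: vec_eq_iff put_col_def)
      then have "norm ((\<chi> i. X $ i $ j0) - f ?u) \<le> \<rho>" using norm_column_le[of "X - ?A" j0] nA by simp
      then have "f ?u \<in> cball (\<chi> i. X $ i $ j0) \<rho>" by (simp add: dist_norm)
      moreover have "?u \<in> {0..<1}" using B(1) by (auto simp: unit_mats_def)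
      ultimately obtain l where l: "l \<in> I" "?u \<in> {real l / real M..(real l + 1) / real M}" using M(3) by blast
      have "a l $ i $ j \<le> B $ i $ j \<and> B $ i $ j \<le> b l $ i $ j" for i j
      proof (cases "j = j0")
        case True
        then show ?thesis using l(2) B(1) by (auto simp: a_def b_def unit_mats_def less_imp_le)
      next
        case False
        have "\<bar>(X - ?A) $ i $ j\<bar> \<le> \<rho>" using abs_entry_le_norm nA by (rule order_trans)
        then have "\<bar>X $ i $ j - B $ i $ j\<bar> \<le> \<rho>" using False by (simp add: put_col_def)
        then show ?thesis using False by (simp add: a_def b_def abs_le_iff)
      qed
      then show "B \<in> (\<Union>l\<in>I. cbox (a l) (b l))" using l(1) by (auto simp: mem_cbox_mat)
    qed
    have "emeasure lborel (\<Union>l\<in>I. cbox (a l) (b l)) \<le> (\<Sum>l\<in>I. emeasure lborel (cbox (a l) (b l)))"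
      using M(2) by (intro emeasure_subadditive_finite) auto
    also have "\<dots> = ennreal (real (card I) / real M * (2 * \<rho>) ^ ?e)"
      unfolding vol using \<rho> M(1) by (subst sum_ennreal) auto
    also have "\<dots> \<le> ennreal (v * (2 * \<rho>) ^ ?e)" using M(4) \<rho> by (intro ennreal_leI mult_right_mono) auto
    finally show "emeasure lborel (\<Union>l\<in>I. cbox (a l) (b l)) \<le> ennreal (v * (2 * \<rho>) ^ ?e)" .
  qed
qed

definition near_lattice :: "'m \<Rightarrow> 'n \<Rightarrow> (real \<Rightarrow> real ^ 'm) \<Rightarrow> int ^ 'n \<Rightarrow> real \<Rightarrow> (real ^ 'n ^ 'm) set" where
  "near_lattice i0 j0 f q \<phi> = {B \<in> unit_mats. \<forall>i. \<exists>p :: int. \<bar>(put_col i0 j0 f B *v rvec q) $ i - of_int p\<bar> \<le> \<phi>}"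

lemma near_lattice_sets:
  fixes f :: "real \<Rightarrow> real ^ 'm" and q :: "int ^ 'n"
  assumes [measurable]: "f \<in> borel_measurable borel"
  shows "near_lattice i0 j0 f q \<phi> \<in> sets borel"
proof -
  have fm: "(\<lambda>B :: real ^ 'n ^ 'm. f (B $ i0 $ j0) $ i) \<in> borel_measurable borel" for i
  proof -
    have 1: "(\<lambda>B :: real ^ 'n ^ 'm. f (B $ i0 $ j0)) \<in> measurable borel borel" by measurable
    have 2: "(\<lambda>x :: real ^ 'm. x $ i) \<in> borel_measurable borel"
      by (intro borel_measurable_continuous_onI continuous_intros)
    show ?thesis using measurable_compose[OF 1 2] .
  qed
  have [measurable]: "(\<lambda>B :: real ^ 'n ^ 'm. (put_col i0 j0 f B *v rvec q) $ i) \<in> borel_measurable borel" for i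
  proof -
    have "(\<lambda>B :: real ^ 'n ^ 'm. put_col i0 j0 f B $ i $ j) \<in> borel_measurable borel" for j
      using fm[of i] by (cases "j = j0") (auto simp: put_col_def)
    then show ?thesis unfolding matrix_vector_mult_def by simp
  qed
  have "{B \<in> space borel. B \<in> unit_mats \<and> (\<forall>i. \<exists>p :: int. \<bar>(put_col i0 j0 f B *v rvec q) $ i - of_int p\<bar> \<le> \<phi>)} \<in> sets borel"
    by measurable
  then show ?thesis by (simp add: near_lattice_def)
qed

text \<open>Moving the entries of column \<open>j1\<close> by multiples of \<open>3\<phi> / \<bar>q\<^sub>j\<^sub>1\<bar>\<close>, independently in each row, produces about \<open>(3\<phi>)\<^bsup>-m\<^esup>\<close>
  pairwise disjoint translates of the set inside a box of volume \<open>2\<^bsup>m\<^esup>\<close>.\<close>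

lemma emeasure_near_lattice:
  fixes f :: "real \<Rightarrow> real ^ 'm" and q :: "int ^ 'n"
  assumes f: "f \<in> borel_measurable borel" and j1: "j1 \<noteq> j0" "q $ j1 \<noteq> 0" and \<phi>: "0 < \<phi>" "\<phi> \<le> 1/6"
  shows "emeasure lborel (near_lattice i0 j0 f q \<phi>) \<le> ennreal ((12 * \<phi>) ^ CARD('m))"
proof -
  \<comment> \<open>As many shifts by \<open>3 * \<phi>\<close> as fit into length 1: the total
    shifts of two different translates differ by at least \<open>3 * \<phi>\<close> and at most
    \<open>1 - 3 * \<phi>\<close>, hence never by something within \<open>2 * \<phi>\<close> of an
    integer.\<close>
  define K where "K = nat \<lfloor>1 / (3 * \<phi>)\<rfloor>"
  have "1 / (3 * \<phi>) \<ge> 2" using \<phi> by (simp add: field_simps)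
  then have "real K \<ge> 1 / (3 * \<phi>) - 1" "real K \<le> 1 / (3 * \<phi>)" unfolding K_def by linarith+
  then have K: "real K \<ge> 1 / (6 * \<phi>)" "real K * (3 * \<phi>) \<le> 1"
    using \<phi> \<open>1 / (3 * \<phi>) \<ge> 2\<close> by (simp_all add: field_simps)
  have K0: "real K > 0" using K(1) \<phi> by (meson divide_pos_pos less_le_trans mult_pos_pos zero_less_numeral zero_less_one)
  define d where "d = 3 * \<phi> / \<bar>real_of_int (q $ j1)\<bar>"
  have q1: "\<bar>real_of_int (q $ j1)\<bar> \<ge> 1" using j1(2) by linarith
  have d: "d > 0" "d * \<bar>real_of_int (q $ j1)\<bar> = 3 * \<phi>" using \<phi> q1 by (auto simp: d_def)
  \<comment> \<open>Since \<open>j1 \<noteq> j0\<close>, a translation leaves the parameter entry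
    alone and with it the distinguished column.\<close>
  define V where "V k = ((\<chi> i j. if j = j1 then real (k i) * d else 0) :: real ^ 'n ^ 'm)" for k :: "'m \<Rightarrow> nat"
  define S where "S = near_lattice i0 j0 f q \<phi>"
  define P where "P = (PiE UNIV (\<lambda>_. {..<K}) :: ('m \<Rightarrow> nat) set)"
  define big where "big = cbox 0 ((\<chi> i j. if j = j1 then 2 else 1) :: real ^ 'n ^ 'm)"
  have Smeas: "S \<in> sets borel" unfolding S_def by (rule near_lattice_sets[OF f])
  have finP: "finite P" unfolding P_def by (intro finite_PiE) auto
  have cP: "card P = K ^ CARD('m)" unfolding P_def by (simp add: card_PiE)
  have disj: "disjoint_family_on (\<lambda>k. (+) (V k) ` S) P"
    unfolding disjoint_family_on_def
  proof (intro ballI impI)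
    fix k l assume kl: "k \<in> P" "l \<in> P" "k \<noteq> l"
    show "(+) (V k) ` S \<inter> (+) (V l) ` S = {}"
    proof (rule ccontr)
      assume "\<not> ?thesis"
      then obtain B C where BC: "B \<in> S" "C \<in> S" "V k + B = V l + C" by auto
      obtain i where i: "k i \<noteq> l i" using kl(3) by blast
      have ent: "B $ i' $ j = C $ i' $ j" if "j \<noteq> j1" for i' j
        using arg_cong[OF BC(3), of "\<lambda>A. A $ i' $ j"] that by (simp add: V_def)
      have ent1: "B $ i $ j1 - C $ i $ j1 = (real (l i) - real (k i)) * d"
        using arg_cong[OF BC(3), of "\<lambda>A. A $ i $ j1"] by (simp add: V_def algebra_simps)
      have diff: "(put_col i0 j0 f B *v rvec q) $ i - (put_col i0 j0 f C *v rvec q) $ i = (real (l i) - real (k i)) * d * real_of_int (q $ j1)"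
      proof -
        have "(put_col i0 j0 f B *v rvec q) $ i - (put_col i0 j0 f C *v rvec q) $ i =
           (\<Sum>j\<in>UNIV. (put_col i0 j0 f B $ i $ j - put_col i0 j0 f C $ i $ j) * rvec q $ j)"
          by (simp add: matrix_vector_mult_def left_diff_distrib sum_subtractf)
        also have "\<dots> = (\<Sum>j\<in>UNIV. if j = j1 then (real (l i) - real (k i)) * d * real_of_int (q $ j1) else 0)"
          using ent ent1 j1 by (intro sum.cong) (auto simp: put_col_def rvec_def)
        finally show ?thesis by simp
      qed
      obtain p where p: "\<bar>(put_col i0 j0 f B *v rvec q) $ i - of_int p\<bar> \<le> \<phi>" using BC(1) by (auto simp: S_def near_lattice_def)
      obtain p' where p': "\<bar>(put_col i0 j0 f C *v rvec q) $ i - of_int p'\<bar> \<le> \<phi>" using BC(2) by (auto simp: S_def near_lattice_def)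
      let ?D = "(put_col i0 j0 f B *v rvec q) $ i - (put_col i0 j0 f C *v rvec q) $ i"
      have absD: "\<bar>?D\<bar> = \<bar>real (l i) - real (k i)\<bar> * (3 * \<phi>)"
        unfolding diff abs_mult using d by simp
      have "k i < K" "l i < K" using kl by (auto simp: P_def PiE_def)
      then have "\<bar>real (l i) - real (k i)\<bar> \<le> real K - 1" by linarith
      then have "\<bar>real (l i) - real (k i)\<bar> * (3 * \<phi>) \<le> (real K - 1) * (3 * \<phi>)" using \<phi> by (intro mult_right_mono) auto
      then have up: "\<bar>?D\<bar> \<le> 1 - 3 * \<phi>" using K(2) unfolding absD by (simp add: algebra_simps)
      have "\<bar>real (l i) - real (k i)\<bar> \<ge> 1" using i by linarith
      then have "1 * (3 * \<phi>) \<le> \<bar>real (l i) - real (k i)\<bar> * (3 * \<phi>)" using \<phi> by (intro mult_right_mono) auto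
      then have lo: "\<bar>?D\<bar> \<ge> 3 * \<phi>" unfolding absD by simp
      have near: "\<bar>?D - of_int (p - p')\<bar> \<le> 2 * \<phi>" using p p' by simp
      then have "p \<noteq> p'" using lo \<phi> by auto
      then have "\<bar>real_of_int (p - p')\<bar> \<ge> 1" by linarith
      then show False using near up \<phi> by linarith
    qed
  qed
  have transl: "emeasure lborel ((+) v ` S) = emeasure lborel S" "(+) v ` S \<in> sets lborel" for v :: "real ^ 'n ^ 'm"
  proof -
    have im: "(+) v ` S = (\<lambda>x. x + (-v)) -` S \<inter> space lborel"
      by (auto simp: image_iff) (metis add_diff_cancel_left' diff_add_cancel add.commute)
    have meas: "(\<lambda>x. x + (-v)) \<in> measurable lborel borel" by measurable
    show "(+) v ` S \<in> sets lborel" unfolding im using meas Smeas by (rule measurable_sets)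
    have "emeasure lborel ((+) v ` S) = emeasure (distr lborel borel (\<lambda>x. x + (-v))) S"
      unfolding im using meas Smeas by (simp add: emeasure_distr)
    also have "distr lborel borel (\<lambda>x. x + (-v)) = lborel"
    proof -
      have "(\<lambda>x. x + (-v)) = (+) (-v)" by (simp add: fun_eq_iff)
      then show ?thesis by (simp only: lborel_distr_plus)
    qed
    finally show "emeasure lborel ((+) v ` S) = emeasure lborel S" .
  qed
  have inbig: "(+) (V k) ` S \<subseteq> big" if k: "k \<in> P" for k
  proof clarify
    fix B assume "B \<in> S"
    then have B: "0 \<le> B $ i $ j \<and> B $ i $ j < 1" for i j by (auto simp: S_def near_lattice_def unit_mats_def)
    have sh: "0 \<le> real (k i) * d \<and> real (k i) * d \<le> 1" for i
    proof -
      have "k i < K" using k by (auto simp: P_def PiE_def)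
      then have "real (k i) * d \<le> real K * d" using d by (intro mult_right_mono) auto
      also have "real K * d \<le> real K * (d * \<bar>real_of_int (q $ j1)\<bar>)"
      proof (rule mult_left_mono)
        have "d * 1 \<le> d * \<bar>real_of_int (q $ j1)\<bar>" using q1 d(1) by (intro mult_left_mono) auto
        then show "d \<le> d * \<bar>real_of_int (q $ j1)\<bar>" by simp
      qed simp
      also have "\<dots> \<le> 1" using K(2) by (simp add: d)
      finally show ?thesis using d by simp
    qed
    show "V k + B \<in> big" unfolding big_def mem_cbox_mat
    proof (intro allI)
      fix i j
      show "0 $ i $ j \<le> (V k + B) $ i $ j \<and> (V k + B) $ i $ j \<le> (\<chi> i j. if j = j1 then 2 else 1) $ i $ j"
        using B[of i j] sh[of i] by (auto simp: V_def)
    qed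
  qed
  have volbig: "emeasure lborel big = ennreal (2 ^ CARD('m))"
    unfolding big_def by (subst emeasure_cbox_mat) (auto simp: prod.delta)
  have "of_nat (card P) * emeasure lborel S = (\<Sum>k\<in>P. emeasure lborel ((+) (V k) ` S))" using transl by simp
  also have "\<dots> = emeasure lborel (\<Union>k\<in>P. (+) (V k) ` S)"
    using disj finP transl by (intro sum_emeasure) auto
  also have "\<dots> \<le> emeasure lborel big" using inbig by (intro emeasure_mono) (auto simp: big_def)
  finally have le: "of_nat (card P) * emeasure lborel S \<le> ennreal (2 ^ CARD('m))" using volbig by simp
  have "ennreal (real (card P)) * emeasure lborel S \<le> ennreal (2 ^ CARD('m))"
    using le by (simp add: ennreal_of_nat_eq_real_of_nat)
  moreover have "real (card P) > 0" using K0 by (simp add: cP)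
  ultimately have "emeasure lborel S \<le> ennreal (2 ^ CARD('m) / real (card P))"
  proof -
    assume *: "ennreal (real (card P)) * emeasure lborel S \<le> ennreal (2 ^ CARD('m))" and **: "real (card P) > 0"
    have "ennreal (1 / real (card P)) * (ennreal (real (card P)) * emeasure lborel S) \<le> ennreal (1 / real (card P)) * ennreal (2 ^ CARD('m))"
      using * by (rule mult_left_mono) simp
    moreover have "ennreal (1 / real (card P)) * (ennreal (real (card P)) * emeasure lborel S) = emeasure lborel S"
      using ** by (simp add: mult.assoc[symmetric] ennreal_mult[symmetric] del: of_nat_0_less_iff)
    moreover have "ennreal (1 / real (card P)) * ennreal (2 ^ CARD('m)) = ennreal (2 ^ CARD('m) / real (card P))"
      by (simp add: ennreal_mult[symmetric] del: ennreal_numeral)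
    ultimately show ?thesis by simp
  qed
  also have "2 ^ CARD('m) / real (card P) = (2 / real K) ^ CARD('m)" by (simp add: cP power_divide)
  also have "ennreal \<dots> \<le> ennreal ((12 * \<phi>) ^ CARD('m))"
  proof (intro ennreal_leI power_mono)
    show "2 / real K \<le> 12 * \<phi>" using K(1) K0 \<phi> by (simp add: field_simps)
  qed (use K0 in auto)
  finally show ?thesis by (simp add: S_def)
qed

section \<open>A criterion for exact approximation\<close>

text \<open>Since the supremum runs over all multiples of \<open>q\<close>, a point at distance slightly less than
  \<open>rad \<Phi> q\<close> from a fraction with reduced denominator \<open>q\<close> is approximated exactly by the multiples of that fraction,
  even if \<open>\<Phi>\<close> is not monotone.\<close>

definition rad :: "(nat \<Rightarrow> real) \<Rightarrow> nat \<Rightarrow> real" where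
  "rad Phi q = (SUP j\<in>{1..}. Phi (j * q) / real (j * q))"

text \<open>Exactness for a single column with the maximum norm written out; \<open>q\<close> has
  both signs, as in \<open>W\<close> with one column.\<close>

definition exact_pt :: "(nat \<Rightarrow> real) \<Rightarrow> real ^ 'm \<Rightarrow> bool" where
  "exact_pt Phi y \<longleftrightarrow>
     infinite {(p :: int ^ 'm, q :: int). q \<noteq> 0 \<and> (\<forall>i. \<bar>of_int q * y $ i - of_int (p $ i)\<bar> \<le> Phi (nat \<bar>q\<bar>))} \<and>
     (\<forall>c>1. finite {(p :: int ^ 'm, q :: int). q \<noteq> 0 \<and> (\<forall>i. \<bar>of_int q * y $ i - of_int (p $ i)\<bar> \<le> Phi (nat \<bar>q\<bar>) / c)})"

text \<open>\<open>q0_large\<close> amounts to \<open>2 q \<le> q powr t\<close> for all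
  \<open>q \<ge> q0\<close>, so that \<open>(2 q) powr (1/t)\<close> does not exceed
  \<open>q\<close>.\<close>

locale approx_fun =
  fixes Phi :: "nat \<Rightarrow> real" and t :: real and q0 :: nat
  assumes pos: "q \<ge> 1 \<Longrightarrow> Phi q > 0"
    and decay: "q \<ge> q0 \<Longrightarrow> Phi q \<le> real q powr (-t)"
    and t: "t > 1" and q0: "q0 \<ge> 1" and q0_large: "2 \<le> real q0 powr (t - 1)"
begin

lemma decay1: "q \<ge> q0 \<Longrightarrow> Phi q \<le> 1 / real q"
proof -
  assume q: "q \<ge> q0"
  then have "real q powr (-t) \<le> real q powr (-1)" using t q0 by (intro powr_mono) auto
  then show ?thesis using decay[OF q] q q0 by (simp add: powr_minus_divide)
qed

text \<open>The quotients tend to 0, so only finitely many exceed the first one and the supremum is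
  a maximum. The attaining multiple is the one that solves the inequality for
  \<open>Phi\<close>.\<close>

lemma rad_attained:
  assumes q: "q \<ge> 1"
  obtains j where "j \<ge> 1" "rad Phi q = Phi (j * q) / real (j * q)"
    "\<And>i. i \<ge> 1 \<Longrightarrow> Phi (i * q) / real (i * q) \<le> rad Phi q"
proof -
  define f where "f j = Phi (j * q) / real (j * q)" for j
  have f1: "f 1 > 0" using pos[OF q] q by (simp add: f_def)
  obtain J where J: "1 / f 1 < real J" using reals_Archimedean2 by blast
  \<comment> \<open>Beyond \<open>J\<close> the bound \<open>1 / j\<close> is below the first
    quotient, and from \<open>q0\<close> on the decay applies.\<close>
  define K where "K = max J q0"
  have big: "f j \<le> f 1" if j: "j > K" for j
  proof -
    have jq: "j \<le> j * q" using q by simp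
    moreover have "q0 \<le> j" using j by (simp add: K_def)
    ultimately have jq0: "j * q \<ge> q0" by linarith
    have j1: "j \<ge> 1" using j by simp
    have "f j \<le> 1 / real (j * q) / real (j * q)" unfolding f_def by (intro divide_right_mono decay1 jq0) simp
    also have "\<dots> \<le> 1 / real j / 1"
      using j1 q by (intro frac_le) (auto intro: order_trans[OF _ jq] simp del: of_nat_mult simp: Suc_le_eq)
    also have "\<dots> \<le> f 1"
    proof -
      have "1 / f 1 < real j" using J j by (simp add: K_def)
      then have "1 < real j * f 1" using f1 by (simp add: divide_less_eq)
      then show ?thesis using j1 by (simp add: divide_le_eq mult.commute)
    qed
    finally show ?thesis .
  qed
  have "finite (f ` {1..max 1 K})" "f ` {1..max 1 K} \<noteq> {}" by auto
  then have "Max (f ` {1..max 1 K}) \<in> f ` {1..max 1 K}" by (rule Max_in)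
  then obtain j where j: "j \<ge> 1" "f j = Max (f ` {1..max 1 K})" unfolding image_iff by (metis atLeastAtMost_iff)
  have le1: "f i \<le> f j" if "i \<in> {1..max 1 K}" for i unfolding j(2) using that by (intro Max_ge) auto
  have le: "f i \<le> f j" if "i \<ge> 1" for i
  proof (cases "i \<le> max 1 K")
    case False
    then have "f i \<le> f 1" by (intro big) auto
    also have "f 1 \<le> f j" by (rule le1) auto
    finally show ?thesis .
  qed (use that le1 in auto)
  have "rad Phi q = f j" unfolding rad_def f_def[symmetric]
    using j(1) le by (intro cSup_eq_maximum) auto
  then show ?thesis using that[of j] j(1) le by (auto simp: f_def)
qed

lemma rad_ge: "q \<ge> 1 \<Longrightarrow> j \<ge> 1 \<Longrightarrow> Phi (j * q) / real (j * q) \<le> rad Phi q"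
  by (metis rad_attained)

lemma rad_pos: "q \<ge> 1 \<Longrightarrow> rad Phi q > 0"
proof -
  assume q: "q \<ge> 1"
  have "0 < Phi (1 * q) / real (1 * q)" using pos[OF q] q by simp
  also have "\<dots> \<le> rad Phi q" by (rule rad_ge[OF q]) simp
  finally show ?thesis .
qed

lemma rad_le:
  assumes q: "q \<ge> q0" shows "rad Phi q \<le> real q powr (-1-t)"
proof -
  have q1: "q \<ge> 1" using q q0 by simp
  obtain j where j: "j \<ge> 1" "rad Phi q = Phi (j * q) / real (j * q)" using rad_attained[OF q1] by metis
  have le: "q \<le> j * q" using j by simp
  have "Phi (j * q) / real (j * q) \<le> real (j * q) powr (-t) / real (j * q)"
    using order_trans[OF q le] by (intro divide_right_mono decay) auto
  also have "\<dots> = real (j * q) powr (-1-t)" using j q1 by (simp add: powr_diff powr_minus_divide del: of_nat_mult)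
  also have "\<dots> \<le> real q powr (-1-t)" using t q1 le by (intro powr_mono2') (auto simp del: of_nat_mult)
  finally show ?thesis using j by simp
qed

text \<open>The hypotheses separate two kinds of competitors: the lower bound on
  \<open>y $ i - pt (x k) $ i\<close> concerns multiples of the fractions \<open>x k\<close>, while
  \<open>av\<close> concerns all other fractions.\<close>

lemma exact_ptI:
  fixes y :: "real ^ 'm" and x :: "nat \<Rightarrow> (int ^ 'm) \<times> nat" and e :: "nat \<Rightarrow> real"
  assumes lt: "\<And>k. lowest_terms (fst (x k)) (snd (x k))" and qk: "\<And>k. snd (x k) \<ge> k"
    and e: "\<And>k. 0 < e k" "\<And>k. e k < 1" "e \<longlonglongrightarrow> 0"
    and y: "\<And>k i. (1 - e k) * rad Phi (snd (x k)) \<le> y $ i - pt (x k) $ i" "\<And>k i. y $ i - pt (x k) $ i \<le> rad Phi (snd (x k))"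
    and av: "\<And>k q p. 1 / (2 * real (snd (x k)) * rad Phi (snd (x k))) < real q \<Longrightarrow> real q \<le> (2 * real (snd (x (Suc k)))) powr (1/t) \<Longrightarrow>
       \<exists>i. \<bar>y $ i - rat_pt p q $ i\<bar> > real q powr (-1-t)"
  shows "exact_pt Phi y"
  unfolding exact_pt_def
proof (intro conjI allI impI)
  define Q where "Q k = snd (x k)" for k
  have Q1: "Q k \<ge> 1" for k using lt[of k] by (simp add: Q_def lowest_terms_def)
  have radQ: "rad Phi (Q k) > 0" for k by (rule rad_pos[OF Q1])
  have yQ: "0 \<le> y $ i - pt (x k) $ i" "y $ i - pt (x k) $ i \<le> rad Phi (Q k)" for k i
  proof -
    have "0 \<le> (1 - e k) * rad Phi (Q k)" using e(2)[of k] radQ[of k] by simp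
    then show "0 \<le> y $ i - pt (x k) $ i" "y $ i - pt (x k) $ i \<le> rad Phi (Q k)"
      using y[where k = k and i = i] by (auto simp: Q_def)
  qed
  have scaled: "\<bar>of_int q * y $ i - of_int (p $ i)\<bar> = \<bar>of_int q\<bar> * \<bar>y $ i - of_int (p $ i) / of_int q\<bar>"
    if "q \<noteq> 0" for p :: "int ^ 'm" and q :: int and i
    using that by (simp add: field_simps flip: abs_mult)
  let ?S = "{(p :: int ^ 'm, q :: int). q \<noteq> 0 \<and> (\<forall>i. \<bar>of_int q * y $ i - of_int (p $ i)\<bar> \<le> Phi (nat \<bar>q\<bar>))}"
  show "infinite ?S"
  proof
    assume fin: "finite ?S"
    then have "finite (snd ` ?S)" by simp
    then obtain B where B: "\<And>q. q \<in> snd ` ?S \<Longrightarrow> q \<le> B" using Max_ge by blast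
    define k where "k = nat (B + 1)"
    obtain j where j: "j \<ge> 1" "rad Phi (Q k) = Phi (j * Q k) / real (j * Q k)" using rad_attained[OF Q1] by metis
    have jq: "j * Q k \<ge> 1" using j Q1 by (metis mult_le_mono mult_1)
    define p where "p = ((\<chi> i. int j * fst (x k) $ i) :: int ^ 'm)"
    have "(p, int (j * Q k)) \<in> ?S"
    proof (clarsimp simp del: of_nat_mult, intro conjI allI)
      show "0 < j" "0 < Q k" using j(1) Q1[of k] by auto
      fix i
      have "real_of_int (p $ i) / real (j * Q k) = pt (x k) $ i"
        using j by (simp add: p_def rat_pt_def Q_def)
      then have "\<bar>real (j * Q k) * y $ i - of_int (p $ i)\<bar> = real (j * Q k) * \<bar>y $ i - pt (x k) $ i\<bar>"
        using scaled[of "int (j * Q k)" i p] jq by (simp del: of_nat_mult)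
      also have "\<dots> \<le> real (j * Q k) * rad Phi (Q k)" using yQ[where k = k and i = i] by (intro mult_left_mono) auto
      also have "\<dots> = Phi (j * Q k)" using j jq by simp
      finally show "\<bar>real (j * Q k) * y $ i - of_int (p $ i)\<bar> \<le> Phi (j * Q k)" .
    qed
    from B[OF imageI[OF this, of snd]] have "int (j * Q k) \<le> B" by (simp only: snd_conv)
    moreover have "int (j * Q k) \<ge> int (Q k)" using mult_le_mono1[OF j(1), of "Q k"] by (simp only: of_nat_le_iff mult_1)
    moreover have "int (Q k) \<ge> B + 1" using qk[of k] by (simp add: k_def Q_def)
    ultimately show False by linarith
  qed
  fix c :: real assume c: "c > 1"
  let ?F = "{(p :: int ^ 'm, q :: int). q \<noteq> 0 \<and> (\<forall>i. \<bar>of_int q * y $ i - of_int (p $ i)\<bar> \<le> Phi (nat \<bar>q\<bar>) / c)}"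
  have "(\<lambda>k. (1 - e k) * c) \<longlonglongrightarrow> (1 - 0) * c" by (intro tendsto_intros e(3))
  then have "eventually (\<lambda>k. (1 - e k) * c > 1) sequentially" using c by (intro order_tendstoD(1)) auto
  then obtain k0 where k0: "\<And>k. k \<ge> k0 \<Longrightarrow> (1 - e k) * c > 1" by (auto simp: eventually_sequentially)
  \<comment> \<open>For the finitely many \<open>k < k0\<close> the margin \<open>e k\<close> may be
    too large for \<open>c\<close>. There the distance of \<open>y\<close> from the fixed fraction
    is still positive, while \<open>Phi q / c \<le> 1 / q\<close>, so multiples beyond
    \<open>Bk k\<close> fail.\<close>
  define Bk where "Bk k = max q0 (nat \<lceil>1 / ((1 - e k) * rad Phi (Q k))\<rceil>)" for k
  define B where "B = Max (insert 0 (Bk ` {..<k0}))"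
  have B: "Bk k \<le> B" if "k < k0" for k using that unfolding B_def by (intro Max_ge) auto
  define M where "M = max (max B q0) (nat \<lceil>(2 * real (Q 0)) powr (1/t)\<rceil>)"
  \<comment> \<open>A non-multiple \<open>q\<close> lies between \<open>(2 q\<^sub>k)\<^bsup>1/t\<^esup>\<close> and \<open>(2 q\<^sub>k\<^sub>+\<^sub>1)\<^bsup>1/t\<^esup>\<close> for some \<open>k\<close>. Up to \<open>1 / (2 q\<^sub>k rad q\<^sub>k)\<close> it is excluded
      because two distinct fractions with denominators \<open>q\<close>, \<open>q\<^sub>k\<close> differ by at least \<open>1 / (q q\<^sub>k)\<close>, beyond that by \<open>av\<close>.\<close>
  have bound: "q \<le> M" if q1: "q \<ge> 1" and app: "\<And>i. \<bar>real q * y $ i - of_int (p $ i)\<bar> \<le> Phi q / c"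
    for q :: nat and p :: "int ^ 'm"
  proof (rule ccontr)
    assume "\<not> q \<le> M"
    then have qM: "q > B" "q > q0" "real q > (2 * real (Q 0)) powr (1/t)" unfolding M_def by linarith+
    have Pq: "Phi q > 0" using pos q1 by simp
    have Pc: "Phi q / c \<le> Phi q" using c Pq by (simp add: divide_le_eq)
    have app': "real q * \<bar>y $ i - rat_pt p q $ i\<bar> \<le> Phi q / c" for i
      using app[of i] scaled[of "int q" i p] q1 by (simp add: rat_pt_def)
    have qpow: "real q * real q powr (-1-t) = real q powr (-t)" using q1 by (simp add: powr_mult_base)
    show False
    proof (cases "\<exists>k. \<forall>i. int q * fst (x k) $ i = int (Q k) * p $ i")
      case True
      then obtain k where k: "\<And>i. int q * fst (x k) $ i = int (Q k) * p $ i" by blast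
      then have "Q k dvd q" using lt[of k] q1 unfolding lowest_terms_def Q_def by blast
      then obtain j where j: "q = j * Q k" unfolding dvd_def by (metis mult.commute)
      have j1: "j \<ge> 1" using j q1 by (cases j) auto
      have same: "rat_pt p q $ i = pt (x k) $ i" for i
      proof -
        have "real_of_int (int q * fst (x k) $ i) = real_of_int (int (Q k) * p $ i)" using k by simp
        then show ?thesis using q1 Q1[of k] by (simp add: rat_pt_def Q_def field_simps)
      qed
      \<comment> \<open>All coordinates satisfy the lower bound, so an arbitrary one,
        \<open>undefined\<close>, will do.\<close>
      have "(1 - e k) * rad Phi (Q k) \<le> \<bar>y $ undefined - pt (x k) $ undefined\<bar>"
        using y(1)[of k undefined] by (simp add: Q_def)
      then have "real q * ((1 - e k) * rad Phi (Q k)) \<le> real q * \<bar>y $ undefined - pt (x k) $ undefined\<bar>"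
        by (intro mult_left_mono) auto
      then have le: "real q * ((1 - e k) * rad Phi (Q k)) \<le> Phi q / c"
        using app'[of undefined] unfolding same by linarith
      show False
      proof (cases "k < k0")
        case True
        have a: "(1 - e k) * rad Phi (Q k) > 0" using e(2)[of k] radQ[of k] by simp
        have "real (Bk k) \<ge> 1 / ((1 - e k) * rad Phi (Q k))" unfolding Bk_def by linarith
        moreover have "real q > real (Bk k)" using B[OF True] qM by simp
        ultimately have "real q > 1 / ((1 - e k) * rad Phi (Q k))" by linarith
        then have "real q * ((1 - e k) * rad Phi (Q k)) > 1" using a by (simp add: field_simps)
        moreover have "Phi q \<le> 1 / real q" using qM by (intro decay1) simp
        moreover have "1 / real q \<le> 1" using q1 by simp
        ultimately show False using le Pc by linarith
      next
        case False
        have "Phi q / real q \<le> rad Phi (Q k)" unfolding j by (rule rad_ge[OF Q1 j1])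
        then have "Phi q \<le> real q * rad Phi (Q k)" using q1 by (simp add: field_simps)
        then have "(1 - e k) * Phi q \<le> (1 - e k) * (real q * rad Phi (Q k))" using e(2)[of k] by (intro mult_left_mono) auto
        then have "(1 - e k) * Phi q \<le> Phi q / c" using le by (simp add: mult_ac)
        then have "((1 - e k) * c) * Phi q \<le> Phi q" using c by (simp add: field_simps)
        moreover have "((1 - e k) * c) * Phi q > 1 * Phi q" using k0[of k] False Pq by (intro mult_strict_right_mono) auto
        ultimately show False by simp
      qed
    next
      case False
      define X where "X k = (2 * real (Q k)) powr (1/t)" for k
      have ex: "\<exists>k. real q \<le> X k"
      proof -
        define k where "k = nat \<lceil>real q powr t\<rceil>"
        have "real q powr t \<le> real k" unfolding k_def by linarith
        also have "real k \<le> 2 * real (Q k)" using qk[of k] by (simp add: Q_def)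
        finally have "(real q powr t) powr (1/t) \<le> X k" unfolding X_def using t by (intro powr_mono2) auto
        then show ?thesis using t q1 by (auto simp: powr_powr)
      qed
      define K where "K = (LEAST k. real q \<le> X k)"
      have K: "real q \<le> X K" unfolding K_def using ex by (rule LeastI_ex)
      have "K \<noteq> 0" using K qM(3) unfolding X_def by (metis not_le)
      then obtain k where k: "K = Suc k" by (cases K) auto
      have "\<not> real q \<le> X k" using not_less_Least[of k "\<lambda>k. real q \<le> X k"] k by (simp add: K_def)
      then have Xk: "X k < real q" by simp
      show False
      proof (cases "1 / (2 * real (Q k) * rad Phi (Q k)) < real q")
        case True
        then obtain i where i: "\<bar>y $ i - rat_pt p q $ i\<bar> > real q powr (-1-t)"
          using av[of k q p] K unfolding Q_def X_def k by blast
        then have "real q * \<bar>y $ i - rat_pt p q $ i\<bar> > real q * real q powr (-1-t)" using q1 by (intro mult_strict_left_mono) auto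
        then show False using app'[of i] Pc decay[of q] qM unfolding qpow by linarith
      next
        case F2: False
        obtain i where i: "int q * fst (x k) $ i \<noteq> int (Q k) * p $ i" using False by blast
        have qQ: "real q > 0" "real (Q k) > 0" using q1 Q1[of k] by auto
        have "\<bar>int q * fst (x k) $ i - int (Q k) * p $ i\<bar> \<ge> 1" using i by linarith
        then have "real_of_int \<bar>int q * fst (x k) $ i - int (Q k) * p $ i\<bar> \<ge> 1" by linarith
        then have one: "\<bar>real q * of_int (fst (x k) $ i) - real (Q k) * of_int (p $ i)\<bar> \<ge> 1" by simp
        have "pt (x k) $ i - rat_pt p q $ i = (real q * of_int (fst (x k) $ i) - real (Q k) * of_int (p $ i)) / (real q * real (Q k))"
          using qQ by (simp add: rat_pt_def Q_def field_simps)
        then have "\<bar>pt (x k) $ i - rat_pt p q $ i\<bar> = \<bar>real q * of_int (fst (x k) $ i) - real (Q k) * of_int (p $ i)\<bar> / (real q * real (Q k))"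
          using qQ by (simp add: abs_divide)
        then have d1: "\<bar>pt (x k) $ i - rat_pt p q $ i\<bar> \<ge> 1 / (real q * real (Q k))"
          using one qQ by (simp add: divide_right_mono)
        \<comment> \<open>\<open>y\<close> is off its centre by at most half the guaranteed distance
          of the two fractions; the other half, \<open>h\<close>, is left.\<close>
        have "rad Phi (Q k) \<le> 1 / (2 * (real q * real (Q k)))"
          using F2 qQ radQ[of k] by (simp add: field_simps)
        moreover define h where "h = 1 / (2 * (real q * real (Q k)))"
        ultimately have "\<bar>y $ i - pt (x k) $ i\<bar> \<le> h" using yQ[where k = k and i = i] by simp
        moreover have "1 / (real q * real (Q k)) = 2 * h" by (simp add: h_def)
        ultimately have "\<bar>y $ i - rat_pt p q $ i\<bar> \<ge> h" using d1 by linarith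
        then have "\<bar>y $ i - rat_pt p q $ i\<bar> \<ge> 1 / (2 * (real q * real (Q k)))" unfolding h_def .
        then have "real q * \<bar>y $ i - rat_pt p q $ i\<bar> \<ge> real q * (1 / (2 * (real q * real (Q k))))" by (intro mult_left_mono) auto
        also have "real q * (1 / (2 * (real q * real (Q k)))) = 1 / (2 * real (Q k))" using qQ by simp
        finally have lo: "1 / (2 * real (Q k)) \<le> Phi q / c" using app'[of i] by linarith
        \<comment> \<open>\<open>X k\<close> is exactly the threshold beyond which
          \<open>q powr (-t)\<close> is smaller than the bound \<open>1 / (2 * Q k)\<close> just
          obtained.\<close>
        have "(X k) powr t < real q powr t" using Xk t by (intro powr_less_mono2) (auto simp: X_def)
        moreover have "(X k) powr t = 2 * real (Q k)" using t qQ by (simp add: X_def powr_powr)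
        ultimately have "1 / (real q powr t) < 1 / (2 * real (Q k))" using qQ by (intro divide_strict_left_mono) auto
        moreover have "1 / (real q powr t) = real q powr (-t)" by (simp add: powr_minus_divide)
        ultimately show False using lo Pc decay[of q] qM by linarith
      qed
    qed
  qed
  have "?F \<subseteq> (\<Union>q\<in>{-int M..int M}. {p :: int ^ 'm. \<forall>i. p $ i \<in> {\<lceil>of_int q * y $ i - Phi (nat \<bar>q\<bar>) / c\<rceil>..\<lfloor>of_int q * y $ i + Phi (nat \<bar>q\<bar>) / c\<rfloor>}} \<times> {q})"
  proof clarify
    fix p :: "int ^ 'm" and q :: int
    assume q: "q \<noteq> 0" and app: "\<forall>i. \<bar>of_int q * y $ i - of_int (p $ i)\<bar> \<le> Phi (nat \<bar>q\<bar>) / c"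
    have n1: "nat \<bar>q\<bar> \<ge> 1" using q by simp
    have "nat \<bar>q\<bar> \<le> M"
    proof (cases "q > 0")
      case True
      then have "real (nat \<bar>q\<bar>) = of_int q" by simp
      then show ?thesis using app by (intro bound[OF n1, of p]) (simp only:)
    next
      case False
      then have r: "real (nat \<bar>q\<bar>) = - of_int q" by simp
      have "\<bar>real (nat \<bar>q\<bar>) * y $ i - of_int ((\<chi> i. - p $ i) $ i)\<bar> = \<bar>of_int q * y $ i - of_int (p $ i)\<bar>" for i
        unfolding r by simp
      then show ?thesis using app by (intro bound[OF n1, of "\<chi> i. - p $ i"]) (simp only:)
    qed
    then have "q \<in> {-int M..int M}" by auto
    moreover have "\<forall>i. p $ i \<in> {\<lceil>of_int q * y $ i - Phi (nat \<bar>q\<bar>) / c\<rceil>..\<lfloor>of_int q * y $ i + Phi (nat \<bar>q\<bar>) / c\<rfloor>}"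
    proof
      fix i
      have "\<bar>of_int q * y $ i - of_int (p $ i)\<bar> \<le> Phi (nat \<bar>q\<bar>) / c" using app by simp
      then show "p $ i \<in> {\<lceil>of_int q * y $ i - Phi (nat \<bar>q\<bar>) / c\<rceil>..\<lfloor>of_int q * y $ i + Phi (nat \<bar>q\<bar>) / c\<rfloor>}"
        unfolding atLeastAtMost_iff ceiling_le_iff le_floor_iff abs_le_iff by linarith
    qed
    ultimately show "(p, q) \<in> (\<Union>q\<in>{-int M..int M}. {p :: int ^ 'm. \<forall>i. p $ i \<in> {\<lceil>of_int q * y $ i - Phi (nat \<bar>q\<bar>) / c\<rceil>..\<lfloor>of_int q * y $ i + Phi (nat \<bar>q\<bar>) / c\<rfloor>}} \<times> {q})"
      by blast
  qed
  then show "finite ?F"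
    by (rule finite_subset) (intro finite_UN_I finite_cartesian_product finite_vec_int; simp)
qed

section \<open>The Cantor construction\<close>

text \<open>The shift by 2 gives \<open>eps 0 < 1\<close>, so that already the root cube stays off
  its centre.\<close>

definition eps :: "nat \<Rightarrow> real" where
  "eps k = 1 / (real k + 2)"

lemma eps_pos: "0 < eps k" and eps_less_1: "eps k < 1"
  by (auto simp: eps_def)

text \<open>All coordinates are displaced in the positive direction, so what is kept of the shell
  around \<open>pt x\<close> is a single cube at its far corner.\<close>

definition cube :: "nat \<Rightarrow> (int ^ 'm) \<times> nat \<Rightarrow> (real ^ 'm) set" where
  "cube k x = box_at (\<chi> i. pt x $ i + (1 - eps k) * rad Phi (snd x)) (eps k * rad Phi (snd x))"

text \<open>Different fractions with denominators \<open>q\<close> and \<open>q'\<close> are at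
  least \<open>1 / (q q')\<close> apart in some coordinate, and this is at least
  \<open>2 * rad Phi q\<close> for \<open>q'\<close> up to this bound.\<close>

definition safe_until :: "(int ^ 'm) \<times> nat \<Rightarrow> real" where
  "safe_until x = 1 / (2 * real (snd x) * rad Phi (snd x))"

text \<open>The worst radius among the denominators a child may have; it bounds the sides of the
  next cubes from below without any regularity of \<open>Phi\<close>.\<close>

definition low :: "nat \<Rightarrow> nat \<Rightarrow> real" where
  "low m N = Min (rad Phi ` {1..N ^ m})"

text \<open>\<open>s\<close> is a common lower bound for half the sides of the cubes and
  \<open>r\<close> the separation of their centres. The bound on the radii keeps each cube within
  \<open>r / 4\<close> of its centre.\<close>

definition level_inv :: "nat \<Rightarrow> nat \<Rightarrow> (nat \<Rightarrow> (int ^ 'm) \<times> nat) \<Rightarrow> real \<Rightarrow> real \<Rightarrow> bool" where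
  "level_inv k M g s r \<longleftrightarrow> M \<ge> 1 \<and> 0 < s \<and> 0 < r \<and>
     (\<forall>i<M. lowest_terms (fst (g i)) (snd (g i)) \<and> snd (g i) \<ge> k \<and> snd (g i) \<ge> q0 \<and>
        roomy CARD('m) t (eps k / 2 * rad Phi (snd (g i))) (safe_until (g i)) \<and>
        s \<le> eps k / 2 * rad Phi (snd (g i)) \<and> real CARD('m) * rad Phi (snd (g i)) \<le> r / 4) \<and>
     (\<forall>i<M. \<forall>j<M. i \<noteq> j \<longrightarrow> r \<le> dist (pt (g i)) (pt (g j)))"

definition child_of :: "nat \<Rightarrow> (int ^ 'm) \<times> nat \<Rightarrow> (int ^ 'm) \<times> nat \<Rightarrow> bool" where
  "child_of k x y \<longleftrightarrow> cube (Suc k) y \<subseteq> cube k x \<and> avoids t (safe_until x) ((2 * real (snd y)) powr (1/t)) (pt y)"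

lemma rad_le_1: "q \<ge> q0 \<Longrightarrow> rad Phi q \<le> 1"
proof -
  assume q: "q \<ge> q0"
  have "real q powr (-1-t) \<le> real q powr 0" using q q0 t by (intro powr_mono) auto
  then show ?thesis using rad_le[OF q] q q0 by simp
qed

lemma low_pos: "N \<ge> 1 \<Longrightarrow> low m N > 0"
  unfolding low_def by (subst Min_gr_iff) (auto intro: rad_pos)

lemma low_le: "1 \<le> q \<Longrightarrow> q \<le> N ^ m \<Longrightarrow> low m N \<le> rad Phi q"
  unfolding low_def by (intro Min_le) auto

lemma mem_cube:
  "z \<in> cube k x \<longleftrightarrow> (\<forall>i. (1 - eps k) * rad Phi (snd x) \<le> z $ i - pt x $ i \<and> z $ i - pt x $ i \<le> rad Phi (snd x))"
  unfolding cube_def mem_box_at by (auto simp: algebra_simps)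

lemma dist_cube_le:
  fixes z :: "real ^ 'm"
  assumes "z \<in> cube k x" "snd x \<ge> 1"
  shows "dist z (pt x) \<le> real CARD('m) * rad Phi (snd x)"
proof -
  have "\<bar>(z - pt x) $ i\<bar> \<le> rad Phi (snd x)" for i
  proof -
    have "(1 - eps k) * rad Phi (snd x) \<ge> 0" using eps_less_1[of k] rad_pos[OF assms(2)] by simp
    moreover have "(1 - eps k) * rad Phi (snd x) \<le> z $ i - pt x $ i" "z $ i - pt x $ i \<le> rad Phi (snd x)"
      using assms(1) unfolding mem_cube by blast+
    ultimately show ?thesis unfolding vector_minus_component by linarith
  qed
  then show ?thesis unfolding dist_norm by (rule norm_le_card_mult)
qed

lemma sep_pos: "N \<ge> 1 \<Longrightarrow> sep m N > 0"
  by (simp add: sep_def)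

lemma sep_tendsto_0: "sep m \<longlonglongrightarrow> 0"
proof -
  have "(\<lambda>N. 8 * 4 ^ m * real N powr (-(real m + 1))) \<longlonglongrightarrow> 8 * 4 ^ m * 0"
    by (intro tendsto_mult tendsto_const tendsto_neg_powr filterlim_real_sequentially) auto
  moreover have "eventually (\<lambda>N. 8 * 4 ^ m * real N powr (-(real m + 1)) = sep m N) sequentially"
    using eventually_gt_at_top[of 0]
    by eventually_elim (simp only: sep_eq_powr Suc_le_eq One_nat_def)
  ultimately have "sep m \<longlonglongrightarrow> 8 * 4 ^ m * 0" by (rule Lim_transform_eventually)
  then show ?thesis by simp
qed

text \<open>Child radii are at most about \<open>N powr (-m (1 + t))\<close> and the separation is
  about \<open>N powr (-m - 1)\<close>; the quotient is \<open>N powr (1 - m t)\<close>.\<close>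

lemma eventually_rad_small:
  assumes mt: "real m * t > 1" and m: "m \<ge> 1"
  shows "eventually (\<lambda>N. \<forall>q. N ^ m \<le> 8 * 4 ^ m * q \<longrightarrow> q0 \<le> q \<longrightarrow> real m * rad Phi q \<le> sep m N / 4) sequentially"
proof -
  define H where "H = 8 * (4 :: real) ^ m"
  have H: "H > 0" by (simp add: H_def)
  define C where "C = real m * (1/H) powr (-1-t)"
  have "(\<lambda>N. C * real N powr (1 - m * t)) \<longlonglongrightarrow> C * 0"
    using mt by (intro tendsto_mult tendsto_const tendsto_neg_powr filterlim_real_sequentially) auto
  then have "eventually (\<lambda>N. C * real N powr (1 - m * t) < H / 4) sequentially"
    using H by (intro order_tendstoD(2)) auto
  then show ?thesis using eventually_ge_at_top[of 1]
  proof eventually_elim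
    case (elim N)
    have N: "real N > 0" using elim by simp
    show ?case
    proof (intro allI impI)
      fix q assume q: "N ^ m \<le> 8 * 4 ^ m * q" "q0 \<le> q"
      have "real (N ^ m) \<le> real (8 * 4 ^ m * q)" using q by (simp only: of_nat_le_iff)
      then have "real N ^ m \<le> H * real q" by (simp add: H_def)
      then have ge: "real N ^ m * (1/H) \<le> real q" using H by (simp add: field_simps)
      have "real m * rad Phi q \<le> real m * real q powr (-1-t)" using rad_le[OF q(2)] by (intro mult_left_mono) auto
      also have "\<dots> \<le> real m * (real N ^ m * (1/H)) powr (-1-t)"
        using ge H N t by (intro mult_left_mono powr_mono2') auto
      also have "(real N ^ m * (1/H)) powr (-1-t) = (real N ^ m) powr (-1-t) * (1/H) powr (-1-t)"
        by (rule powr_mult)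
      also have "(real N ^ m) powr (-1-t) = real N powr (m * (-1-t))"
        using N by (simp add: powr_powr flip: powr_realpow)
      also have "m * (-1-t) = (1 - m * t) + (-(real m + 1))" by (simp add: algebra_simps)
      also have "real N powr \<dots> = real N powr (1 - m * t) * real N powr (-(real m + 1))" by (rule powr_add)
      also have "real m * (real N powr (1 - m * t) * real N powr (-(real m + 1)) * (1/H) powr (-1-t)) =
          (C * real N powr (1 - m * t)) * real N powr (-(real m + 1))" by (simp add: C_def)
      also have "\<dots> \<le> (H / 4) * real N powr (-(real m + 1))" using elim by (intro mult_right_mono) auto
      also have "\<dots> = sep m N / 4" using elim(2) by (simp add: sep_eq_powr H_def)
      finally show "real m * rad Phi q \<le> sep m N / 4" .
    qed
  qed
qed

lemma children_ratio_pos: "children_ratio m > 0"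
  by (simp add: children_ratio_def)

text \<open>Stated for all large \<open>N\<close>, so that one more condition, available only for
  infinitely many \<open>N\<close>, can be imposed on the choice of \<open>N\<close>.\<close>

lemma eventually_next_level:
  fixes g :: "nat \<Rightarrow> (int ^ 'm) \<times> nat"
  defines "m \<equiv> CARD('m)"
  assumes mt: "real m * t > real m + 2" and inv: "level_inv k M g s r"
  shows "eventually (\<lambda>N. \<exists>K g'. K \<ge> 1 \<and> level_inv (Suc k) (M * K) g' (eps (Suc k) / 2 * low m N) (sep m N) \<and>
     children_ratio m * (s / sep m N) ^ m \<le> real K \<and> sep m N \<le> r / 2 \<and>
     (\<forall>i<M * K. child_of k (g (i div K)) (g' i))) sequentially"
proof -
  have m: "m \<ge> 1" by (simp add: m_def Suc_leI)
  let ?s = "\<lambda>i. eps k / 2 * rad Phi (snd (g i))"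
  let ?a = "\<lambda>i. (\<chi> l. pt (g i) $ l + (1 - eps k) * rad Phi (snd (g i))) :: real ^ 'm"
  from inv have s: "0 < s" and r: "0 < r" and M: "M \<ge> 1" by (auto simp: level_inv_def)
  have gi: "lowest_terms (fst (g i)) (snd (g i))" "snd (g i) \<ge> q0" "roomy m t (?s i) (safe_until (g i))"
    "s \<le> ?s i" "real m * rad Phi (snd (g i)) \<le> r / 4" if "i < M" for i
    using inv that unfolding level_inv_def m_def by blast+
  have q1: "snd (g i) \<ge> 1" if "i < M" for i using gi(2)[OF that] q0 by linarith
  have far: "r \<le> dist (pt (g i)) (pt (g j))" if "i < M" "j < M" "i \<noteq> j" for i j
    using inv that unfolding level_inv_def by blast
  have s1: "?s i \<le> 1" if "i < M" for i
  proof -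
    have "?s i \<le> 1 * 1" using eps_pos[of k] eps_less_1[of k] rad_le_1[OF gi(2)[OF that]] rad_pos[OF q1[OF that]]
      by (intro mult_mono) auto
    then show ?thesis by simp
  qed
  let ?Z = "\<lambda>i \<rho> N. \<exists>Z. finite Z \<and> children_ratio m * (?s i / \<rho>) ^ m \<le> real (card Z) \<and>
     (\<forall>x\<in>Z. good_child t N (?a i) (?s i) (safe_until (g i)) x) \<and> (\<forall>x\<in>Z. \<forall>y\<in>Z. x \<noteq> y \<longrightarrow> \<rho> \<le> dist (pt x) (pt y))"
  have ev: "eventually (\<lambda>N. \<forall>i\<in>{..<M}. ?Z i (sep m N) N) sequentially"
  proof (rule eventually_ball_finite)
    show "\<forall>i\<in>{..<M}. eventually (\<lambda>N. ?Z i (sep m N) N) sequentially"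
    proof
      fix i assume "i \<in> {..<M}"
      then have i: "i < M" by simp
      have "0 < ?s i" using gi(4)[OF i] s by linarith
      then show "eventually (\<lambda>N. ?Z i (sep m N) N) sequentially"
        unfolding m_def using mt gi(3)[OF i] s1[OF i] t unfolding m_def by (intro eventually_children) auto
    qed
  qed simp
  have "eventually (\<lambda>q :: nat. \<forall>d. 0 < d \<longrightarrow> d \<le> real q powr (-1-t) \<longrightarrow> roomy m t (eps (Suc k) / 2 * d) (1 / (2 * real q * d))) sequentially"
    using eps_pos[of "Suc k"] t mt m by (intro eventually_roomy) auto
  then obtain Q1 where Q1: "\<And>q d. q \<ge> Q1 \<Longrightarrow> 0 < d \<Longrightarrow> d \<le> real q powr (-1-t) \<Longrightarrow> roomy m t (eps (Suc k) / 2 * d) (1 / (2 * real q * d))"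
    unfolding eventually_sequentially by blast
  define Q2 where "Q2 = max (max Q1 (Suc k)) q0"
  have evs: "eventually (\<lambda>N. sep m N < min (r / 2) s) sequentially"
    using s r by (intro order_tendstoD(2)[OF sep_tendsto_0]) auto
  have mt1: "real m * t > 1" using mt by linarith
  show ?thesis
    using ev evs eventually_rad_small[OF mt1 m] eventually_ge_at_top[of "8 * 4 ^ m * Q2 + 1"]
  proof eventually_elim
    case (elim N)
    have N: "N \<ge> 1" using elim(4) by simp
    \<comment> \<open>A lower bound on \<open>N\<close> becomes \<open>q \<ge> Q2\<close> for all
      child denominators, as these are at least \<open>N ^ m / (8 * 4 ^ m)\<close>.\<close>
    have "N \<le> N ^ m" using N m by (intro self_le_power) auto
    then have N2: "8 * 4 ^ m * Q2 < N ^ m" using elim(4) by linarith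
    define \<rho> where "\<rho> = sep m N"
    have \<rho>: "\<rho> > 0" "\<rho> \<le> r / 2" "\<rho> \<le> s" using elim(2) sep_pos[OF N] by (auto simp: \<rho>_def)
    \<comment> \<open>The same number of children for every parent, surplus ones being dropped: this
      permits index arithmetic with \<open>div\<close> and \<open>mod\<close> and gives all cubes of
      a level equal mass.\<close>
    define K where "K = nat \<lceil>children_ratio m * (s / \<rho>) ^ m\<rceil>"
    have Kpos: "children_ratio m * (s / \<rho>) ^ m > 0" using s \<rho> children_ratio_pos by simp
    then have K1: "K \<ge> 1" unfolding K_def by linarith
    have K: "children_ratio m * (s / \<rho>) ^ m \<le> real K" unfolding K_def by linarith
    let ?h = "\<lambda>i h. inj_on h {..<K} \<and> (\<forall>j<K. good_child t N (?a i) (?s i) (safe_until (g i)) (h j)) \<and>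
       (\<forall>j<K. \<forall>l<K. j \<noteq> l \<longrightarrow> \<rho> \<le> dist (pt (h j)) (pt (h l)))"
    have "\<forall>i. \<exists>h. i < M \<longrightarrow> ?h i h"
    proof
      fix i
      show "\<exists>h. i < M \<longrightarrow> ?h i h"
      proof (cases "i < M")
        case i: True
        have "?Z i \<rho> N" by (rule bspec[OF elim(1)[folded \<rho>_def]]) (use i in simp)
        then obtain Z where Z: "finite Z" "children_ratio m * (?s i / \<rho>) ^ m \<le> real (card Z)"
          "\<forall>x\<in>Z. good_child t N (?a i) (?s i) (safe_until (g i)) x"
          "\<forall>x\<in>Z. \<forall>y\<in>Z. x \<noteq> y \<longrightarrow> \<rho> \<le> dist (pt x) (pt y)" by (elim exE conjE) (rule that)
        have "children_ratio m * (s / \<rho>) ^ m \<le> children_ratio m * (?s i / \<rho>) ^ m"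
          using gi(4)[OF i] s \<rho> children_ratio_pos[of m] by (intro mult_left_mono power_mono divide_right_mono) auto
        then have "children_ratio m * (s / \<rho>) ^ m \<le> real (card Z)" using Z(2) by linarith
        then have "K \<le> card Z" unfolding K_def by (simp add: ceiling_le_iff nat_le_iff)
        then obtain Z' where Z': "Z' \<subseteq> Z" "card Z' = K" by (meson obtain_subset_with_card_n)
        have "finite Z'" using Z' Z(1) finite_subset by blast
        then obtain h where h: "bij_betw h {0..<K} Z'" using ex_bij_betw_nat_finite Z'(2) by blast
        have hZ: "h j \<in> Z" if "j < K" for j using h Z'(1) that by (auto simp: bij_betw_def)
        have inj: "inj_on h {..<K}" using h by (simp add: bij_betw_def atLeast0LessThan)
        have "\<rho> \<le> dist (pt (h j)) (pt (h l))" if "j < K" "l < K" "j \<noteq> l" for j l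
        proof -
          have "h j \<noteq> h l" using inj that by (auto simp: inj_on_def)
          then show ?thesis using Z(4) hZ that by blast
        qed
        then show ?thesis using inj Z(3) hZ by blast
      qed simp
    qed
    from choice[OF this] obtain h where h:
      "\<And>i j. i < M \<Longrightarrow> j < K \<Longrightarrow> good_child t N (?a i) (?s i) (safe_until (g i)) (h i j)"
      "\<And>i j l. i < M \<Longrightarrow> j < K \<Longrightarrow> l < K \<Longrightarrow> j \<noteq> l \<Longrightarrow> \<rho> \<le> dist (pt (h i j)) (pt (h i l))"
      by blast
    define g' where "g' i = h (i div K) (i mod K)" for i
    have idx: "i div K < M" "i mod K < K" if "i < M * K" for i
      using that K1 by (auto simp: less_mult_imp_div_less)
    have good: "good_child t N (?a (i div K)) (?s (i div K)) (safe_until (g (i div K))) (g' i)" if "i < M * K" for i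
      unfolding g'_def using h(1) idx[OF that] by blast
    have q': "snd (g' i) \<ge> Q2" "snd (g' i) \<ge> q0" "snd (g' i) \<ge> 1" "real m * rad Phi (snd (g' i)) \<le> \<rho> / 4"
       "rad Phi (snd (g' i)) \<le> \<rho> / 4"
      if i: "i < M * K" for i
    proof -
      have *: "N ^ m \<le> 8 * 4 ^ m * snd (g' i)" using good[OF i] by (simp add: good_child_def m_def)
      then have "8 * 4 ^ m * Q2 < 8 * 4 ^ m * snd (g' i)" using N2 by linarith
      then show a: "snd (g' i) \<ge> Q2" by simp
      then show b: "snd (g' i) \<ge> q0" by (simp add: Q2_def)
      then show c: "snd (g' i) \<ge> 1" using q0 by linarith
      show d: "real m * rad Phi (snd (g' i)) \<le> \<rho> / 4" using elim(3) * b unfolding \<rho>_def by blast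
      have "1 * rad Phi (snd (g' i)) \<le> real m * rad Phi (snd (g' i))"
        using rad_pos[OF c] m by (intro mult_right_mono) auto
      then show "rad Phi (snd (g' i)) \<le> \<rho> / 4" using d by simp
    qed
    have ptb: "pt (g' i) $ l - pt (g (i div K)) $ l \<ge> (1 - eps k) * rad Phi (snd (g (i div K)))"
      "pt (g' i) $ l - pt (g (i div K)) $ l \<le> rad Phi (snd (g (i div K))) - s / 4" if i: "i < M * K" for i l
    proof -
      let ?i = "i div K"
      have *: "?a ?i $ l + ?s ?i / 4 \<le> pt (g' i) $ l" "pt (g' i) $ l \<le> ?a ?i $ l + 7 * ?s ?i / 4"
        using good[OF i] by (auto simp: good_child_def)
      have **: "s \<le> ?s ?i" using gi(4) idx[OF i] by blast
      have a: "?a ?i $ l = pt (g ?i) $ l + (1 - eps k) * rad Phi (snd (g ?i))" by simp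
      have b: "(1 - eps k) * rad Phi (snd (g ?i)) + 2 * ?s ?i = rad Phi (snd (g ?i))" by (simp add: algebra_simps)
      show "pt (g' i) $ l - pt (g (i div K)) $ l \<ge> (1 - eps k) * rad Phi (snd (g (i div K)))"
        using *(1) ** s unfolding a by linarith
      show "pt (g' i) $ l - pt (g (i div K)) $ l \<le> rad Phi (snd (g (i div K))) - s / 4"
        using *(2) ** b unfolding a by linarith
    qed
    have child: "child_of k (g (i div K)) (g' i)" if i: "i < M * K" for i
      unfolding child_of_def
    proof
      show "avoids t (safe_until (g (i div K))) ((2 * real (snd (g' i))) powr (1/t)) (pt (g' i))"
        using good[OF i] by (simp add: good_child_def)
      show "cube (Suc k) (g' i) \<subseteq> cube k (g (i div K))"
      proof
        fix z assume z: "z \<in> cube (Suc k) (g' i)"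
        show "z \<in> cube k (g (i div K))" unfolding mem_cube
        proof
          fix l
          have "0 \<le> (1 - eps (Suc k)) * rad Phi (snd (g' i))"
            using eps_less_1[of "Suc k"] rad_pos[OF q'(3)[OF i]] by simp
          moreover have "(1 - eps (Suc k)) * rad Phi (snd (g' i)) \<le> z $ l - pt (g' i) $ l"
            "z $ l - pt (g' i) $ l \<le> rad Phi (snd (g' i))" using z unfolding mem_cube by blast+
          ultimately have "0 \<le> z $ l - pt (g' i) $ l" "z $ l - pt (g' i) $ l \<le> s / 4"
            using q'(5)[OF i] \<rho> by linarith+
          then show "(1 - eps k) * rad Phi (snd (g (i div K))) \<le> z $ l - pt (g (i div K)) $ l \<and>
             z $ l - pt (g (i div K)) $ l \<le> rad Phi (snd (g (i div K)))"
            using ptb[OF i, of l] by linarith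
        qed
      qed
    qed
    have near: "dist (pt (g' i)) (pt (g (i div K))) \<le> r / 4" if i: "i < M * K" for i
    proof -
      have "(1 - eps k) * rad Phi (snd (g (i div K))) \<le> pt (g' i) $ l - pt (g (i div K)) $ l \<and>
          pt (g' i) $ l - pt (g (i div K)) $ l \<le> rad Phi (snd (g (i div K)))" for l
        using ptb[OF i, of l] s by linarith
      then have "pt (g' i) \<in> cube k (g (i div K))" unfolding mem_cube by blast
      then have "dist (pt (g' i)) (pt (g (i div K))) \<le> real m * rad Phi (snd (g (i div K)))"
        unfolding m_def using dist_cube_le q1 idx(1)[OF i] by blast
      then show ?thesis using gi(5)[OF idx(1)[OF i]] by linarith
    qed
    have "level_inv (Suc k) (M * K) g' (eps (Suc k) / 2 * low m N) \<rho>"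
      unfolding level_inv_def m_def[symmetric]
    proof (intro conjI allI impI)
      show "1 \<le> M * K" using M K1 by (simp add: Suc_le_eq)
      show "0 < eps (Suc k) / 2 * low m N" using eps_pos low_pos[OF N] by simp
      show "0 < \<rho>" using \<rho> by simp
      fix i assume i: "i < M * K"
      show "lowest_terms (fst (g' i)) (snd (g' i))" using good[OF i] by (simp add: good_child_def)
      show "Suc k \<le> snd (g' i)" using q'(1)[OF i] by (simp add: Q2_def)
      show "q0 \<le> snd (g' i)" using q'(2)[OF i] .
      show "roomy m t (eps (Suc k) / 2 * rad Phi (snd (g' i))) (safe_until (g' i))"
        unfolding safe_until_def using q'(1)[OF i] rad_pos[OF q'(3)[OF i]] rad_le[OF q'(2)[OF i]]
        by (intro Q1) (auto simp: Q2_def)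
      have "snd (g' i) \<le> N ^ m" using good[OF i] by (simp add: good_child_def m_def)
      then show "eps (Suc k) / 2 * low m N \<le> eps (Suc k) / 2 * rad Phi (snd (g' i))"
        using eps_pos[of "Suc k"] q'(3)[OF i] by (intro mult_left_mono low_le) auto
      show "real m * rad Phi (snd (g' i)) \<le> \<rho> / 4" using q'(4)[OF i] .
    next
      fix i j assume i: "i < M * K" and j: "j < M * K" and ij: "i \<noteq> j"
      show "\<rho> \<le> dist (pt (g' i)) (pt (g' j))"
      proof (cases "i div K = j div K")
        case True
        then have "i mod K \<noteq> j mod K" using ij by (metis div_mult_mod_eq)
        then show ?thesis unfolding g'_def True using h(2) idx[OF i] idx[OF j] by blast
      next
        case False
        \<comment> \<open>Children's centres are within \<open>r / 4\<close> of their parents'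
          centres, so those of different parents keep a distance of at least
          \<open>r / 2\<close>.\<close>
        have "r \<le> dist (pt (g (i div K))) (pt (g (j div K)))" using far idx(1)[OF i] idx(1)[OF j] False by blast
        also have "\<dots> \<le> dist (pt (g (i div K))) (pt (g' i)) + dist (pt (g' i)) (pt (g' j)) + dist (pt (g' j)) (pt (g (j div K)))"
          by (meson add_right_mono dist_triangle order_trans)
        finally show ?thesis using near[OF i] near[OF j] \<rho> by (simp add: dist_commute)
      qed
    qed
    then show ?case using K1 K \<rho>(2) child unfolding \<rho>_def by blast
  qed
qed

text \<open>The \<open>M k\<close> cubes of level \<open>k\<close> are numbered so that \<open>i div K k\<close> is the parent of \<open>i\<close>. The cube of level \<open>k\<close>
  containing the point with parameter \<open>u\<close> then has number \<open>\<lfloor>u M k\<rfloor>\<close>, and the natural measure on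
  the Cantor set is the image of Lebesgue measure on the unit interval.\<close>

context
  fixes M K :: "nat \<Rightarrow> nat" and g :: "nat \<Rightarrow> nat \<Rightarrow> (int ^ 'm) \<times> nat" and s r :: "nat \<Rightarrow> real"
  assumes inv: "\<And>k. level_inv k (M k) (g k) (s k) (r k)"
    and K: "\<And>k. K k \<ge> 1" and M_Suc: "\<And>k. M (Suc k) = M k * K k"
    and K_ge: "\<And>k. children_ratio CARD('m) * (s k / r (Suc k)) ^ CARD('m) \<le> real (K k)"
    and r_half: "\<And>k. r (Suc k) \<le> r k / 2"
    and child: "\<And>k. \<forall>i<M (Suc k). child_of k (g k (i div K k)) (g (Suc k) i)"
begin

definition idx :: "nat \<Rightarrow> real \<Rightarrow> nat" where
  "idx k u = nat \<lfloor>u * real (M k)\<rfloor>"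

definition node :: "nat \<Rightarrow> real \<Rightarrow> (int ^ 'm) \<times> nat" where
  "node k u = g k (idx k u)"

definition limit_map :: "real \<Rightarrow> real ^ 'm" where
  "limit_map u = lim (\<lambda>k. pt (node k u))"

lemma M1: "M k \<ge> 1" and s_pos: "s k > 0" and r_pos: "r k > 0"
  using inv[of k] by (auto simp: level_inv_def)

lemma inv_node:
  assumes "i < M k"
  shows "lowest_terms (fst (g k i)) (snd (g k i))" "snd (g k i) \<ge> k" "snd (g k i) \<ge> q0" "snd (g k i) \<ge> 1"
    "roomy CARD('m) t (eps k / 2 * rad Phi (snd (g k i))) (safe_until (g k i))"
    "real CARD('m) * rad Phi (snd (g k i)) \<le> r k / 4"
  using inv[of k] assms q0 unfolding level_inv_def by (auto intro: order_trans)

lemma separated: "i < M k \<Longrightarrow> j < M k \<Longrightarrow> i \<noteq> j \<Longrightarrow> r k \<le> dist (pt (g k i)) (pt (g k j))"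
  using inv[of k] unfolding level_inv_def by blast

lemma idx_less: "0 \<le> u \<Longrightarrow> u < 1 \<Longrightarrow> idx k u < M k"
proof -
  assume u: "0 \<le> u" "u < 1"
  have "u * real (M k) < 1 * real (M k)" using u M1[of k] by (intro mult_strict_right_mono) auto
  then have "\<lfloor>u * real (M k)\<rfloor> < int (M k)" by (simp add: floor_less_iff)
  then show ?thesis using M1[of k] by (simp add: idx_def nat_less_iff)
qed

lemma idx_interval: "0 \<le> u \<Longrightarrow> u \<in> {real (idx k u) / real (M k)..(real (idx k u) + 1) / real (M k)}"
proof -
  assume u: "0 \<le> u"
  have "real (idx k u) = of_int \<lfloor>u * real (M k)\<rfloor>" using u by (simp add: idx_def)
  then have "real (idx k u) \<le> u * real (M k)" "u * real (M k) \<le> real (idx k u) + 1" by linarith+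
  then show ?thesis using M1[of k] by (simp add: field_simps)
qed

text \<open>Nested floors: dividing \<open>\<lfloor>u * M * K\<rfloor>\<close> by \<open>K\<close>
  and rounding down gives \<open>\<lfloor>u * M\<rfloor>\<close>. Hence the cubes numbered
  \<open>idx k u\<close> form a branch of the tree.\<close>

lemma idx_div: "0 \<le> u \<Longrightarrow> idx (Suc k) u div K k = idx k u"
proof -
  assume u: "0 \<le> u"
  have "\<lfloor>u * real (M (Suc k))\<rfloor> div int (K k) = \<lfloor>u * real (M (Suc k)) / real_of_int (int (K k))\<rfloor>"
    by (rule floor_divide_real_eq_div[symmetric]) simp
  also have "u * real (M (Suc k)) / real_of_int (int (K k)) = u * real (M k)"
    using K[of k] by (simp add: M_Suc)
  finally show ?thesis using u by (simp add: idx_def flip: nat_div_distrib' )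
      (metis nat_div_distrib nat_int u zero_le_floor zero_le_mult_iff of_nat_0_le_iff)
qed

lemma child_node: "0 \<le> u \<Longrightarrow> u < 1 \<Longrightarrow> child_of k (node k u) (node (Suc k) u)"
  unfolding node_def using child[rule_format, OF idx_less[of u "Suc k"]] idx_div by simp

lemma r_le: "r k \<le> r 0 / 2 ^ k"
proof (induction k)
  case (Suc k)
  have "r (Suc k) \<le> r k / 2" by (rule r_half)
  also have "\<dots> \<le> (r 0 / 2 ^ k) / 2" using Suc by (rule divide_right_mono) simp
  finally show ?case by simp
qed simp

lemma r_tendsto_0: "r \<longlonglongrightarrow> 0"
proof (rule tendsto_sandwich)
  show "(\<lambda>_. 0) \<longlonglongrightarrow> (0 :: real)" by simp
  have "(\<lambda>k. r 0 * (1/2) ^ k) \<longlonglongrightarrow> r 0 * 0" by (intro tendsto_intros LIMSEQ_power_zero) auto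
  then show "(\<lambda>k. r 0 / 2 ^ k) \<longlonglongrightarrow> 0" by (simp add: power_divide)
  show "eventually (\<lambda>k. 0 \<le> r k) sequentially" using r_pos by (simp add: less_imp_le)
  show "eventually (\<lambda>k. r k \<le> r 0 / 2 ^ k) sequentially" using r_le by simp
qed

lemma limit_map:
  assumes u: "0 \<le> u" "u < 1"
  shows "limit_map u \<in> cube k (node k u)" "dist (limit_map u) (pt (node k u)) \<le> r k / 4"
proof -
  define F where "F k = cube k (node k u)" for k
  have rp: "rad Phi (snd (node k u)) > 0" for k
    unfolding node_def by (intro rad_pos inv_node(4) idx_less u)
  have F: "F k \<noteq> {}" for k
  proof -
    have "(1 - eps k) * rad Phi (snd (node k u)) \<le> 1 * rad Phi (snd (node k u))"
      using rp[of k] eps_pos[of k] by (intro mult_right_mono) auto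
    then have "(\<chi> i. pt (node k u) $ i + rad Phi (snd (node k u))) \<in> F k" by (simp add: F_def mem_cube)
    then show ?thesis by auto
  qed
  have "\<Inter>(range F) \<noteq> {}"
  proof (rule compact_nest)
    show "compact (F n)" for n unfolding F_def cube_def box_at_def by (rule compact_cbox)
    show "F n \<noteq> {}" for n by (rule F)
    show "F b \<subseteq> F a" if "a \<le> b" for a b
      using that by (rule lift_Suc_antimono_le[rotated]) (use child_node[OF u] in \<open>simp add: F_def child_of_def\<close>)
  qed
  then obtain y where y: "\<And>k. y \<in> F k" by auto
  have d: "dist y (pt (node k u)) \<le> r k / 4" for k
  proof -
    have i: "idx k u < M k" by (rule idx_less[OF u])
    have "dist y (pt (node k u)) \<le> real CARD('m) * rad Phi (snd (node k u))"
      using y[of k] inv_node(4)[OF i] unfolding F_def node_def by (rule dist_cube_le)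
    then show ?thesis using inv_node(6)[OF i] unfolding node_def by linarith
  qed
  have "(\<lambda>k. pt (node k u)) \<longlonglongrightarrow> y"
  proof (rule tendsto_dist_iff[THEN iffD2], rule tendsto_sandwich)
    show "(\<lambda>_. 0) \<longlonglongrightarrow> (0 :: real)" by simp
    show "(\<lambda>k. r k / 4) \<longlonglongrightarrow> 0" using tendsto_divide[OF r_tendsto_0 tendsto_const[of 4]] by simp
    show "eventually (\<lambda>k. 0 \<le> dist (pt (node k u)) y) sequentially" by simp
    show "eventually (\<lambda>k. dist (pt (node k u)) y \<le> r k / 4) sequentially" using d by (simp add: dist_commute)
  qed
  then have "limit_map u = y" unfolding limit_map_def by (rule limI)
  then show "limit_map u \<in> cube k (node k u)" "dist (limit_map u) (pt (node k u)) \<le> r k / 4"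
    using y d by (auto simp: F_def)
qed

text \<open>The column enters the sets \<open>near_lattice\<close> of the Borel-Cantelli argument,
  which have to be measurable. Each approximation factors through the integer
  \<open>idx k u\<close>.\<close>

lemma limit_map_measurable: "limit_map \<in> borel_measurable borel"
  unfolding limit_map_def
proof (rule borel_measurable_lim_metric)
  fix k
  have "(\<lambda>u. nat \<lfloor>u * real (M k)\<rfloor>) \<in> measurable borel (count_space UNIV)" by measurable
  then have "(\<lambda>u. pt (g k (nat \<lfloor>u * real (M k)\<rfloor>))) \<in> borel_measurable borel"
    by (rule measurable_compose) simp
  then show "(\<lambda>u. pt (node k u)) \<in> borel_measurable borel" by (simp add: node_def idx_def)
qed

text \<open>Makes every dangerous denominator \<open>q\<close> at most the denominator of the child,
  so that the radius of the child is at most \<open>q powr (-1-t)\<close>.\<close>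

lemma root_le:
  assumes q: "q \<ge> q0" shows "(2 * real q) powr (1/t) \<le> real q"
proof -
  have "real q0 powr (t - 1) \<le> real q powr (t - 1)" using q t by (intro powr_mono2) auto
  then have "2 * real q \<le> real q powr (t - 1) * real q" using q0_large by (intro mult_right_mono) auto
  also have "\<dots> = real q powr t" using q q0 by (simp add: powr_diff)
  finally have "(2 * real q) powr (1/t) \<le> (real q powr t) powr (1/t)" using t by (intro powr_mono2) auto
  also have "\<dots> = real q" using t q q0 by (simp add: powr_powr)
  finally show ?thesis .
qed

lemma exact_pt_limit_map:
  assumes u: "0 \<le> u" "u < 1"
  shows "exact_pt Phi (limit_map u)"
proof (rule exact_ptI[where x = "\<lambda>k. node k u" and e = eps])
  have i: "idx k u < M k" for k by (rule idx_less[OF u])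
  show "lowest_terms (fst (node k u)) (snd (node k u))" "k \<le> snd (node k u)" for k
    unfolding node_def using inv_node[OF i] by auto
  show "0 < eps k" "eps k < 1" for k by (rule eps_pos eps_less_1)+
  show "eps \<longlonglongrightarrow> 0" unfolding eps_def by real_asymp
  show "(1 - eps k) * rad Phi (snd (node k u)) \<le> limit_map u $ l - pt (node k u) $ l"
    "limit_map u $ l - pt (node k u) $ l \<le> rad Phi (snd (node k u))" for k l
    using limit_map(1)[OF u, of k] unfolding mem_cube by blast+
  fix k q p
  assume q: "1 / (2 * real (snd (node k u)) * rad Phi (snd (node k u))) < real q"
    "real q \<le> (2 * real (snd (node (Suc k) u))) powr (1/t)"
  define Q where "Q = snd (node (Suc k) u)"
  have Q: "Q \<ge> q0" "Q \<ge> 1" unfolding Q_def node_def using inv_node[OF i] by auto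
  have rp: "1 / (2 * real (snd (node k u)) * rad Phi (snd (node k u))) \<ge> 0"
    unfolding node_def using rad_pos[OF inv_node(4)[OF i]] by (simp add: less_imp_le)
  obtain l where l: "\<bar>pt (node (Suc k) u) $ l - rat_pt p q $ l\<bar> > 2 * real q powr (-1-t)"
    using child_node[OF u, of k] q unfolding child_of_def avoids_def safe_until_def by blast
  have "0 \<le> (1 - eps (Suc k)) * rad Phi Q" using eps_less_1[of "Suc k"] rad_pos[OF Q(2)] by simp
  moreover have "(1 - eps (Suc k)) * rad Phi Q \<le> limit_map u $ l - pt (node (Suc k) u) $ l"
     "limit_map u $ l - pt (node (Suc k) u) $ l \<le> rad Phi Q"
    using limit_map(1)[OF u, of "Suc k"] unfolding mem_cube Q_def by blast+
  moreover have "rad Phi Q \<le> real q powr (-1-t)"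
  proof -
    have "real q \<le> real Q" using q(2) root_le[OF Q(1)] unfolding Q_def by linarith
    moreover have "real q > 0" using q(1) rp by linarith
    ultimately have "real Q powr (-1-t) \<le> real q powr (-1-t)" using t by (intro powr_mono2') auto
    then show ?thesis using rad_le[OF Q(1)] by linarith
  qed
  ultimately show "\<exists>i. \<bar>limit_map u $ i - rat_pt p q $ i\<bar> > real q powr (-1-t)"
    using l by (intro exI[of _ l]) linarith
qed

text \<open>All cubes of level \<open>k\<close> have mass \<open>1 / M k\<close>, and those whose
  limit points meet the ball have separated centres in the ball of radius \<open>2 * \<rho>\<close>.
  The constant 6 absorbs \<open>4 * \<rho> / r k + 1\<close>.\<close>

lemma interval_cover_level:
  assumes \<rho>: "r k \<le> \<rho>"
  shows "interval_cover limit_map x \<rho> ((6 * \<rho> / r k) ^ CARD('m) / real (M k))"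
proof -
  define I where "I = {i. \<exists>u. 0 \<le> u \<and> u < 1 \<and> limit_map u \<in> cball x \<rho> \<and> idx k u = i}"
  have Isub: "I \<subseteq> {..<M k}" unfolding I_def using idx_less by auto
  then have fin: "finite I" by (rule finite_subset) simp
  let ?p = "\<lambda>i. pt (g k i)"
  have inj: "inj_on ?p I"
  proof (rule inj_onI, rule ccontr)
    fix i j assume "i \<in> I" "j \<in> I" "?p i = ?p j" "i \<noteq> j"
    then have "r k \<le> dist (?p i) (?p j)" using Isub by (intro separated) auto
    then show False using r_pos[of k] \<open>?p i = ?p j\<close> by simp
  qed
  have "real (card (?p ` I)) \<le> ((2 * \<rho> + r k / 2) / (r k / 2)) ^ DIM(real ^ 'm)"
  proof (rule card_separated_le)
    show "finite (?p ` I)" using fin by simp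
    show "?p ` I \<subseteq> cball x (2 * \<rho>)"
    proof clarify
      fix i assume "i \<in> I"
      then obtain u where u: "0 \<le> u" "u < 1" "limit_map u \<in> cball x \<rho>" "idx k u = i" by (auto simp: I_def)
      have "dist (limit_map u) (?p i) \<le> r k / 4" using limit_map(2)[OF u(1,2), of k] u(4) by (simp add: node_def)
      moreover have "dist x (limit_map u) \<le> \<rho>" using u(3) by simp
      moreover have "dist x (?p i) \<le> dist x (limit_map u) + dist (limit_map u) (?p i)" by (rule dist_triangle)
      ultimately have "dist x (?p i) \<le> 2 * \<rho>" using \<rho> r_pos[of k] by linarith
      then show "?p i \<in> cball x (2 * \<rho>)" by simp
    qed
    show "r k \<le> dist y z" if "y \<in> ?p ` I" "z \<in> ?p ` I" "y \<noteq> z" for y z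
      using that Isub by (auto intro!: separated)
    show "0 < r k" by (rule r_pos)
    show "0 \<le> 2 * \<rho>" using \<rho> r_pos[of k] by linarith
  qed
  also have "\<dots> \<le> (6 * \<rho> / r k) ^ DIM(real ^ 'm)"
    using \<rho> r_pos[of k] by (intro power_mono) (auto simp: field_simps)
  finally have cI: "real (card I) \<le> (6 * \<rho> / r k) ^ CARD('m)" using card_image[OF inj] by simp
  show ?thesis
    unfolding interval_cover_def
  proof (intro exI[of _ "M k"] exI[of _ I] conjI)
    show "1 \<le> M k" by (rule M1)
    show "finite I" by (rule fin)
    show "{u \<in> {0..<1}. limit_map u \<in> cball x \<rho>} \<subseteq> (\<Union>i\<in>I. {real i / real (M k)..(real i + 1) / real (M k)})"
    proof
      fix u assume "u \<in> {u \<in> {0..<1}. limit_map u \<in> cball x \<rho>}"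
      then have u: "0 \<le> u" "u < 1" "limit_map u \<in> cball x \<rho>" by auto
      then have "idx k u \<in> I" unfolding I_def by blast
      then show "u \<in> (\<Union>i\<in>I. {real i / real (M k)..(real i + 1) / real (M k)})" using idx_interval[OF u(1), of k] by blast
    qed
    show "real (card I) / real (M k) \<le> (6 * \<rho> / r k) ^ CARD('m) / real (M k)" using cI by (intro divide_right_mono) auto
  qed
qed

text \<open>By \<open>K_ge\<close> the separation of level \<open>k + 1\<close> cancels: down to
  that scale the bound is that of Lebesgue measure with total mass \<open>1 / M k\<close> spread
  over volume \<open>s k ^ m\<close>, up to a constant.\<close>

lemma interval_cover_next_level:
  assumes \<rho>: "r (Suc k) \<le> \<rho>"
  shows "interval_cover limit_map x \<rho> (6 ^ CARD('m) / children_ratio CARD('m) * (\<rho> / s k) ^ CARD('m) / real (M k))"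
proof (rule interval_cover_mono[OF interval_cover_level[OF \<rho>]])
  have r: "r (Suc k) > 0" and s: "s k > 0" and M: "real (M k) > 0" and \<rho>0: "\<rho> > 0"
    using r_pos[of "Suc k"] s_pos[of k] M1[of k] \<rho> by auto
  have c: "children_ratio CARD('m) > 0" by (rule children_ratio_pos)
  have KM: "real (M k) * (children_ratio CARD('m) * (s k / r (Suc k)) ^ CARD('m)) \<le> real (M (Suc k))"
    using K_ge[of k] M by (simp add: M_Suc mult_left_mono)
  have "(6 * \<rho> / r (Suc k)) ^ CARD('m) / real (M (Suc k)) \<le>
     (6 * \<rho> / r (Suc k)) ^ CARD('m) / (real (M k) * (children_ratio CARD('m) * (s k / r (Suc k)) ^ CARD('m)))"
    using KM r s M c \<rho>0 M1[of "Suc k"] by (intro divide_left_mono mult_pos_pos) auto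
  also have "\<dots> = 6 ^ CARD('m) / children_ratio CARD('m) * (\<rho> / s k) ^ CARD('m) / real (M k)"
    using r s M c by (simp add: power_divide power_mult_distrib field_simps)
  finally show "(6 * \<rho> / r (Suc k)) ^ CARD('m) / real (M (Suc k)) \<le> 6 ^ CARD('m) / children_ratio CARD('m) * (\<rho> / s k) ^ CARD('m) / real (M k)" .
qed

text \<open>For \<rho> between \<open>r (Suc k)\<close> and \<open>r k\<close> there are two
  regimes. Up to \<open>s k\<close> the mass shrinks from \<open>1 / M k\<close> with exponent
  \<open>m \<ge> S\<close>; between \<open>s k\<close> and \<open>r k\<close> the ball meets
  boundedly many cubes of level \<open>k\<close>. Both reduce to \<open>1 / M k\<close> being at
  most a constant times \<open>s k powr S\<close>.\<close>

lemma interval_cover_holder: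
  assumes S: "0 \<le> S" "S \<le> real CARD('m)" and growth: "\<And>k. 1 \<le> real (M (Suc k)) * s (Suc k) powr S"
  obtains C where "C > 0" "\<And>x \<rho>. 0 < \<rho> \<Longrightarrow> interval_cover limit_map x \<rho> (C * \<rho> powr S)"
proof -
  \<comment> \<open>\<open>growth\<close> says nothing about level 0, which is absorbed into the
    constant.\<close>
  define c1 where "c1 = min 1 (real (M 0) * s 0 powr S)"
  have c1: "c1 > 0" using s_pos[of 0] M1[of 0] by (simp add: c1_def)
  have gr: "c1 \<le> real (M k) * s k powr S" for k
    using growth by (cases k) (auto simp: c1_def intro: min.coboundedI1)
  define D where "D = max (6 ^ CARD('m)) (6 ^ CARD('m) / children_ratio CARD('m))"
  have D: "D > 0" "6 ^ CARD('m) \<le> D" "6 ^ CARD('m) / children_ratio CARD('m) \<le> D" by (auto simp: D_def less_max_iff_disj)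
  define C where "C = max (1 / r 0 powr S) (D / c1)"
  have C: "C > 0" "1 / r 0 powr S \<le> C" "D / c1 \<le> C" using r_pos[of 0] by (auto simp: C_def less_max_iff_disj)
  have "interval_cover limit_map x \<rho> (C * \<rho> powr S)" if \<rho>: "0 < \<rho>" for x \<rho>
  proof (cases "r 0 \<le> \<rho>")
    case True
    have "1 = 1 / r 0 powr S * r 0 powr S" using r_pos[of 0] by simp
    also have "\<dots> \<le> C * \<rho> powr S" using C True S r_pos[of 0] by (intro mult_mono powr_mono2) auto
    finally show ?thesis using interval_cover_1 interval_cover_mono by blast
  next
    case False
    have "eventually (\<lambda>k. r k < \<rho>) sequentially" using \<rho> r_tendsto_0 by (intro order_tendstoD(2)) auto
    then have ex: "\<exists>k. r k < \<rho>" by (rule eventually_happens'[OF sequentially_bot])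
    define j where "j = (LEAST k. r k < \<rho>)"
    have j: "r j < \<rho>" unfolding j_def using ex by (rule LeastI_ex)
    then have "j \<noteq> 0" using False by (metis less_imp_le)
    then obtain k where k: "j = Suc k" by (cases j) auto
    have rk: "\<rho> \<le> r k" using not_less_Least[of k "\<lambda>k. r k < \<rho>"] k unfolding j_def by simp
    have M: "real (M k) > 0" using M1[of k] by simp
    have s: "s k > 0" by (rule s_pos)
    have ineq: "(\<rho> / s k) powr S * (D / real (M k)) \<le> C * \<rho> powr S"
    proof -
      have "(\<rho> / s k) powr S * (D / real (M k)) = D * \<rho> powr S / (real (M k) * s k powr S)"
        using \<rho> s by (simp add: powr_divide mult_ac)
      also have "\<dots> \<le> D * \<rho> powr S / c1" using gr[of k] c1 D M s by (intro divide_left_mono) auto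
      also have "\<dots> = D / c1 * \<rho> powr S" by simp
      also have "\<dots> \<le> C * \<rho> powr S" using C by (intro mult_right_mono) auto
      finally show ?thesis .
    qed
    show ?thesis
    proof (cases "\<rho> \<le> s k")
      case True
      have "(\<rho> / s k) ^ CARD('m) = (\<rho> / s k) powr real CARD('m)" using \<rho> s by (simp add: powr_realpow)
      also have "\<dots> \<le> (\<rho> / s k) powr S" using True \<rho> s S by (intro powr_mono') auto
      finally have "6 ^ CARD('m) / children_ratio CARD('m) * (\<rho> / s k) ^ CARD('m) / real (M k) \<le> D * (\<rho> / s k) powr S / real (M k)"
        using D M \<rho> s by (intro divide_right_mono mult_mono) auto
      also have "\<dots> \<le> C * \<rho> powr S" using ineq by (simp add: mult.commute)
      finally show ?thesis
        using interval_cover_next_level[of k \<rho> x] j k interval_cover_mono by (simp add: less_imp_le)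
    next
      case False
      have "1 \<le> (\<rho> / s k) powr S" using False s S by (intro ge_one_powr_ge_zero) auto
      then have "D / real (M k) * 1 \<le> D / real (M k) * (\<rho> / s k) powr S" using D M by (intro mult_left_mono) auto
      then have "6 ^ CARD('m) / real (M k) \<le> C * \<rho> powr S"
        using ineq D M divide_right_mono[OF D(2), of "real (M k)"] by (simp add: mult.commute)
      moreover have "interval_cover limit_map x (r k) (6 ^ CARD('m) / real (M k))"
        using interval_cover_level[of k "r k" x] r_pos[of k] by simp
      ultimately show ?thesis using interval_cover_subset[OF _ rk] interval_cover_mono by blast
    qed
  qed
  then show ?thesis using that[of C] C by blast
qed

text \<open>Only the scales \<open>r (Suc k)\<close> are used. The loss against Lebesgue measure
  there is the factor \<open>1 / s k ^ m\<close>, which by \<open>growth\<close> costs an exponent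
  of at most \<open>1 / (k + 1)\<close>.\<close>

lemma interval_cover_packing:
  assumes growth: "\<And>k. r (Suc k) powr (1 / (real k + 1)) \<le> s k ^ CARD('m)" and e: "0 < e" and \<rho>0: "0 < \<rho>0"
  obtains \<rho> where "0 < \<rho>" "\<rho> < \<rho>0" "\<And>x. interval_cover limit_map x \<rho> (\<rho> powr (real CARD('m) - e))"
proof -
  define C where "C = 6 ^ CARD('m) / children_ratio CARD('m)"
  have C: "C > 0" using children_ratio_pos by (simp add: C_def)
  have "(\<lambda>k. r (Suc k)) \<longlonglongrightarrow> 0" using r_tendsto_0 by (rule LIMSEQ_Suc)
  \<comment> \<open>For \<open>\<rho> < C powr (-2/e)\<close> the constant \<open>C\<close> is at
    most \<open>\<rho> powr (-e/2)\<close>; the other half of \<open>e\<close> pays for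
    \<open>s k\<close>.\<close>
  moreover have "min (min \<rho>0 1) (C powr (-2/e)) > 0" using \<rho>0 C by simp
  ultimately have "eventually (\<lambda>k. r (Suc k) < min (min \<rho>0 1) (C powr (-2/e))) sequentially"
    by (rule order_tendstoD(2))
  moreover have "(\<lambda>k. 1 / (real k + 1)) \<longlonglongrightarrow> 0" by real_asymp
  then have "eventually (\<lambda>k. 1 / (real k + 1) < e / 2) sequentially" using e by (intro order_tendstoD(2)) auto
  ultimately have "eventually (\<lambda>k. r (Suc k) < min (min \<rho>0 1) (C powr (-2/e)) \<and> 1 / (real k + 1) < e / 2) sequentially"
    by (rule eventually_conj)
  then obtain k where k: "r (Suc k) < \<rho>0" "r (Suc k) < 1" "r (Suc k) < C powr (-2/e)" "1 / (real k + 1) < e / 2"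
    using eventually_happens'[OF sequentially_bot] by fastforce
  define \<rho> where "\<rho> = r (Suc k)"
  have \<rho>: "\<rho> > 0" "\<rho> < 1" using r_pos k by (auto simp: \<rho>_def)
  have bound: "C * (\<rho> / s k) ^ CARD('m) / real (M k) \<le> \<rho> powr (real CARD('m) - e)"
  proof -
    have "C * (\<rho> / s k) ^ CARD('m) / real (M k) \<le> C * (\<rho> / s k) ^ CARD('m) / 1"
      using C \<rho> s_pos[of k] M1[of k] by (intro divide_left_mono) (auto intro!: mult_nonneg_nonneg simp: Suc_le_eq)
    also have "\<dots> = C * \<rho> ^ CARD('m) / s k ^ CARD('m)" by (simp add: power_divide)
    also have "\<dots> \<le> C * \<rho> ^ CARD('m) / \<rho> powr (1 / (real k + 1))"
      using growth[of k] C \<rho> s_pos[of k] by (intro divide_left_mono) (auto simp: \<rho>_def)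
    also have "\<dots> \<le> C * \<rho> ^ CARD('m) / \<rho> powr (e / 2)"
      using C \<rho> k(4) by (intro divide_left_mono powr_mono' ) auto
    also have "\<dots> = C * (\<rho> powr (real CARD('m) - e / 2))" using \<rho> by (simp add: powr_diff powr_realpow)
    also have "\<rho> powr (real CARD('m) - e / 2) = \<rho> powr (e / 2) * \<rho> powr (real CARD('m) - e)"
      by (simp flip: powr_add)
    also have "C * (\<rho> powr (e / 2) * \<rho> powr (real CARD('m) - e)) \<le> C * ((C powr (-2/e)) powr (e / 2) * \<rho> powr (real CARD('m) - e))"
      using k(3) \<rho> e C by (intro mult_left_mono mult_right_mono powr_mono2) (auto simp: \<rho>_def)
    also have "(C powr (-2/e)) powr (e / 2) = 1 / C" using e C by (subst powr_powr) (simp add: powr_minus_divide)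
    finally show ?thesis using C by simp
  qed
  have "interval_cover limit_map x \<rho> (\<rho> powr (real CARD('m) - e))" for x
    using interval_cover_next_level[of k \<rho> x] bound interval_cover_mono by (auto simp: \<rho>_def C_def)
  then show ?thesis using that[of \<rho>] \<rho> k by (auto simp: \<rho>_def)
qed

end

section \<open>Existence of a scheme with prescribed growth\<close>

lemma root_level:
  assumes mt: "real CARD('m) * t > real CARD('m) + 2"
  shows "\<exists>(g :: nat \<Rightarrow> (int ^ 'm) \<times> nat) s r. level_inv 0 1 g s r"
proof -
  have m: "CARD('m) \<ge> 1" by (simp add: Suc_leI)
  have "eventually (\<lambda>q :: nat. \<forall>d. 0 < d \<longrightarrow> d \<le> real q powr (-1-t) \<longrightarrow> roomy CARD('m) t (eps 0 / 2 * d) (1 / (2 * real q * d))) sequentially"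
    using eps_pos[of 0] t mt m by (intro eventually_roomy) auto
  then obtain Q1 where Q1: "\<And>q d. q \<ge> Q1 \<Longrightarrow> 0 < d \<Longrightarrow> d \<le> real q powr (-1-t) \<Longrightarrow> roomy CARD('m) t (eps 0 / 2 * d) (1 / (2 * real q * d))"
    unfolding eventually_sequentially by blast
  define q where "q = max Q1 q0"
  have q: "q \<ge> Q1" "q \<ge> q0" "q \<ge> 1" using q0 by (auto simp: q_def)
  define x where "x = (((\<chi> i. 1) :: int ^ 'm), q)"
  have "lowest_terms (\<chi> i :: 'm. 1) q"
    unfolding lowest_terms_def
  proof (intro conjI allI impI)
    show "1 \<le> q" by (rule q(3))
    fix p' :: "int ^ 'm" and q'
    assume "\<forall>i. int q' * (\<chi> i. 1) $ i = int q * p' $ i"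
    then have "int q' = int q * p' $ undefined" by (metis mult.right_neutral vec_lambda_beta)
    then have "int q dvd int q'" by simp
    then show "q dvd q'" by simp
  qed
  \<comment> \<open>With one cube separation is vacuous, so \<open>r\<close> is taken just large
    enough for the condition on the radius.\<close>
  then have "level_inv 0 1 (\<lambda>_. x) (eps 0 / 2 * rad Phi q) (4 * (real CARD('m) * rad Phi q))"
    unfolding level_inv_def x_def safe_until_def using rad_pos[OF q(3)] eps_pos[of 0] q Q1[OF q(1) rad_pos[OF q(3)] rad_le[OF q(2)]] by simp
  then show ?thesis by blast
qed

text \<open>\<open>N\<close> is taken from the frequent set and beyond all thresholds. The last two
  conclusions are the growth conditions: the first needs \<open>sep m N\<close> tiny compared with
  the old side, the second that the number of children times \<open>s' powr S\<close> beats all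
  constants, which the surplus \<open>N powr e\<close> provides.\<close>

lemma next_level:
  fixes g :: "nat \<Rightarrow> (int ^ 'm) \<times> nat"
  defines "m \<equiv> CARD('m)"
  assumes mt: "real m * t > real m + 2" and inv: "level_inv k M g s r"
    and freq: "0 < e" "frequently (\<lambda>N. real N powr e \<le> low m N powr S * real N powr (real m * (real m + 1))) sequentially"
  shows "\<exists>g' s' r' K. K \<ge> 1 \<and> level_inv (Suc k) (M * K) g' s' r' \<and>
     children_ratio m * (s / r') ^ m \<le> real K \<and> r' \<le> r / 2 \<and> (\<forall>i<M * K. child_of k (g (i div K)) (g' i)) \<and>
     r' powr (1 / (real k + 1)) \<le> s ^ m \<and> 1 \<le> real (M * K) * s' powr S"
proof -
  define c where "c = eps (Suc k) / 2"
  define H where "H = 8 * (4 :: real) ^ m"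
  have c: "c > 0" using eps_pos by (simp add: c_def)
  have H: "H > 0" by (simp add: H_def)
  have s: "s > 0" and M: "M \<ge> 1" using inv by (auto simp: level_inv_def)
  \<comment> \<open>All constants in the product of the child count with
    \<open>(eps (Suc k) / 2 * low m N) powr S\<close>.\<close>
  define A where "A = children_ratio m * s ^ m / H ^ m * c powr S"
  have A: "A > 0" using children_ratio_pos s H c by (simp add: A_def)
  have "((\<lambda>N. sep m N powr (1 / (real k + 1))) \<longlongrightarrow> 0) sequentially"
    by (rule tendsto_zero_powrI[OF sep_tendsto_0 tendsto_const]) (auto simp: sep_def)
  then have "eventually (\<lambda>N. sep m N powr (1 / (real k + 1)) < s ^ m) sequentially"
    using s by (intro order_tendstoD(2)) auto
  moreover have "filterlim (\<lambda>N. A * real N powr e) at_top sequentially"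
    using A freq(1) by real_asymp
  then have "eventually (\<lambda>N. 1 \<le> A * real N powr e) sequentially" by (simp add: filterlim_at_top)
  moreover note eventually_next_level[OF mt[unfolded m_def] inv, folded m_def]
  moreover have "eventually (\<lambda>N. N \<ge> (1 :: nat)) sequentially" by (rule eventually_ge_at_top)
  ultimately have "eventually (\<lambda>N. sep m N powr (1 / (real k + 1)) < s ^ m \<and> 1 \<le> A * real N powr e \<and> N \<ge> 1 \<and>
     (\<exists>K g'. K \<ge> 1 \<and> level_inv (Suc k) (M * K) g' (eps (Suc k) / 2 * low m N) (sep m N) \<and>
     children_ratio m * (s / sep m N) ^ m \<le> real K \<and> sep m N \<le> r / 2 \<and>
     (\<forall>i<M * K. child_of k (g (i div K)) (g' i)))) sequentially"
    by eventually_elim (intro conjI; assumption)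
  from frequently_ex[OF frequently_eventually_conj[OF freq(2) this]] obtain N K g' where N:
    "sep m N powr (1 / (real k + 1)) < s ^ m" "1 \<le> A * real N powr e" "N \<ge> 1"
    "real N powr e \<le> low m N powr S * real N powr (real m * (real m + 1))"
    and K: "K \<ge> 1" "level_inv (Suc k) (M * K) g' (eps (Suc k) / 2 * low m N) (sep m N)"
     "children_ratio m * (s / sep m N) ^ m \<le> real K" "sep m N \<le> r / 2"
     "\<forall>i<M * K. child_of k (g (i div K)) (g' i)"
    by (elim exE conjE) (rule that)
  have N0: "real N > 0" using N by simp
  have l: "low m N > 0" using low_pos[OF N(3)] .
  have P: "real N powr (real m * (real m + 1)) = (real N ^ (m + 1)) ^ m"
  proof -
    have "(real N ^ (m + 1)) ^ m = real N ^ ((m + 1) * m)" by (rule power_mult[symmetric])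
    also have "\<dots> = real N powr (real ((m + 1) * m))" using N0 by (rule powr_realpow[symmetric])
    also have "real ((m + 1) * m) = real m * (real m + 1)" by (simp add: algebra_simps)
    finally show ?thesis by simp
  qed
  have "1 \<le> A * real N powr e" by (rule N(2))
  also have "\<dots> \<le> A * (low m N powr S * (real N ^ (m + 1)) ^ m)" using N(4) A unfolding P by (intro mult_left_mono) auto
  also have "\<dots> = children_ratio m * (s / sep m N) ^ m * (c * low m N) powr S"
    using c l by (simp add: A_def sep_def H_def powr_mult power_divide power_mult_distrib del: power_Suc)
  also have "\<dots> \<le> real K * (c * low m N) powr S" using K(3) by (intro mult_right_mono) auto
  also have "\<dots> \<le> real (M * K) * (c * low m N) powr S"
  proof (intro mult_right_mono)
    have "1 * K \<le> M * K" using M by (intro mult_right_mono) auto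
    then show "real K \<le> real (M * K)" by (simp only: of_nat_le_iff mult_1)
  qed auto
  finally have "1 \<le> real (M * K) * (eps (Suc k) / 2 * low m N) powr S" by (simp add: c_def)
  then show ?thesis using K N(1) by (intro exI[of _ g'] exI[of _ "eps (Suc k) / 2 * low m N"] exI[of _ "sep m N"] exI[of _ K]) simp
qed

lemma cantor_scheme_exists:
  defines "m \<equiv> CARD('m)"
  assumes mt: "real m * t > real m + 2"
    and freq: "0 < e" "frequently (\<lambda>N. real N powr e \<le> low m N powr S * real N powr (real m * (real m + 1))) sequentially"
  shows "\<exists>M K (g :: nat \<Rightarrow> nat \<Rightarrow> (int ^ 'm) \<times> nat) s r. \<forall>k. level_inv k (M k) (g k) (s k) (r k) \<and>
    K k \<ge> 1 \<and> M (Suc k) = M k * K k \<and> children_ratio m * (s k / r (Suc k)) ^ m \<le> real (K k) \<and> r (Suc k) \<le> r k / 2 \<and>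
    (\<forall>i<M (Suc k). child_of k (g k (i div K k)) (g (Suc k) i)) \<and>
    r (Suc k) powr (1 / (real k + 1)) \<le> s k ^ m \<and> 1 \<le> real (M (Suc k)) * s (Suc k) powr S"
proof -
  \<comment> \<open>The last component of a state is the number of children per cube used to reach
    it, so \<open>K n\<close> is read off from \<open>f (Suc n)\<close>.\<close>
  let ?P = "\<lambda>n :: nat. \<lambda>(M :: nat, g :: nat \<Rightarrow> (int ^ 'm) \<times> nat, s, r, K :: nat). level_inv n M g s r"
  let ?Q = "\<lambda>n :: nat. \<lambda>(M, g, s, r, _). \<lambda>(M', g', s', r', K). K \<ge> 1 \<and> M' = M * K \<and>
     children_ratio m * (s / r') ^ m \<le> real K \<and> r' \<le> r / 2 \<and> (\<forall>i<M * K. child_of n (g (i div K)) (g' i)) \<and>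
     r' powr (1 / (real n + 1)) \<le> s ^ m \<and> 1 \<le> real (M * K) * s' powr S"
  have "\<exists>f. \<forall>n. ?P n (f n) \<and> ?Q n (f n) (f (Suc n))"
  proof (rule dependent_nat_choice)
    obtain g :: "nat \<Rightarrow> (int ^ 'm) \<times> nat" and s r where "level_inv 0 1 g s r"
      using root_level mt unfolding m_def by blast
    then show "\<exists>x. ?P 0 x" by (intro exI[of _ "(1, g, s, r, 1)"]) simp
  next
    fix x n assume x: "?P n x"
    obtain M g s r K0 where xe: "x = (M, g, s, r, K0)" by (cases x) auto
    then have "level_inv n M g s r" using x by simp
    from next_level[OF mt[unfolded m_def] this freq[unfolded m_def], folded m_def]
    obtain g' s' r' K where K: "K \<ge> 1 \<and> level_inv (Suc n) (M * K) g' s' r' \<and>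
     children_ratio m * (s / r') ^ m \<le> real K \<and> r' \<le> r / 2 \<and> (\<forall>i<M * K. child_of n (g (i div K)) (g' i)) \<and>
     r' powr (1 / (real n + 1)) \<le> s ^ m \<and> 1 \<le> real (M * K) * s' powr S" by (elim exE) (rule that)
    show "\<exists>y. ?P (Suc n) y \<and> ?Q n x y"
      using K unfolding xe by (intro exI[of _ "(M * K, g', s', r', K)"]) simp
  qed
  then obtain f where ff: "\<forall>n. ?P n (f n) \<and> ?Q n (f n) (f (Suc n))" ..
  note f = ff[THEN spec, THEN conjunct1] ff[THEN spec, THEN conjunct2]
  define M where "M n = fst (f n)" for n
  define g where "g n = fst (snd (f n))" for n
  define s where "s n = fst (snd (snd (f n)))" for n
  define r where "r n = fst (snd (snd (snd (f n))))" for n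
  define K where "K n = snd (snd (snd (snd (f (Suc n)))))" for n
  have 1: "level_inv n (M n) (g n) (s n) (r n)" for n
    using f(1)[of n] by (simp add: M_def g_def s_def r_def split_beta)
  have 2: "K n \<ge> 1 \<and> M (Suc n) = M n * K n \<and>
     children_ratio m * (s n / r (Suc n)) ^ m \<le> real (K n) \<and> r (Suc n) \<le> r n / 2 \<and>
     (\<forall>i<M n * K n. child_of n (g n (i div K n)) (g (Suc n) i)) \<and>
     r (Suc n) powr (1 / (real n + 1)) \<le> s n ^ m \<and> 1 \<le> real (M n * K n) * s (Suc n) powr S" for n
    using f(2)[of n] unfolding M_def g_def s_def r_def K_def split_beta .
  show ?thesis
    by (rule exI[of _ M], rule exI[of _ K], rule exI[of _ g], rule exI[of _ s], rule exI[of _ r])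
       (use 1 2 in auto)
qed

lemma exact_pt_cantor_map:
  assumes mt: "real CARD('m) * t > real CARD('m) + 2" and S: "0 \<le> S" "S \<le> real CARD('m)"
    and freq: "0 < e" "frequently (\<lambda>N. real N powr e \<le> low CARD('m) N powr S * real N powr (real CARD('m) * (real CARD('m) + 1))) sequentially"
  obtains f :: "real \<Rightarrow> real ^ 'm" and C where "f \<in> borel_measurable borel" "\<And>u. 0 \<le> u \<Longrightarrow> u < 1 \<Longrightarrow> exact_pt Phi (f u)"
    "C > 0" "\<And>x \<rho>. 0 < \<rho> \<Longrightarrow> interval_cover f x \<rho> (C * \<rho> powr S)"
    "\<And>d \<rho>0. 0 < d \<Longrightarrow> 0 < \<rho>0 \<Longrightarrow> \<exists>\<rho>>0. \<rho> < \<rho>0 \<and> (\<forall>x. interval_cover f x \<rho> (\<rho> powr (real CARD('m) - d)))"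
proof -
  obtain M K and g :: "nat \<Rightarrow> nat \<Rightarrow> (int ^ 'm) \<times> nat" and s r where
    all: "\<forall>k. level_inv k (M k) (g k) (s k) (r k) \<and>
    K k \<ge> 1 \<and> M (Suc k) = M k * K k \<and> children_ratio CARD('m) * (s k / r (Suc k)) ^ CARD('m) \<le> real (K k) \<and> r (Suc k) \<le> r k / 2 \<and>
    (\<forall>i<M (Suc k). child_of k (g k (i div K k)) (g (Suc k) i)) \<and>
    r (Suc k) powr (1 / (real k + 1)) \<le> s k ^ CARD('m) \<and> 1 \<le> real (M (Suc k)) * s (Suc k) powr S"
    using cantor_scheme_exists[OF mt freq] by (elim exE) (rule that)
  then have scheme: "level_inv k (M k) (g k) (s k) (r k)" "K k \<ge> 1" "M (Suc k) = M k * K k"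
      "children_ratio CARD('m) * (s k / r (Suc k)) ^ CARD('m) \<le> real (K k)" "r (Suc k) \<le> r k / 2"
      "\<forall>i<M (Suc k). child_of k (g k (i div K k)) (g (Suc k) i)"
    and growth: "r (Suc k) powr (1 / (real k + 1)) \<le> s k ^ CARD('m)" "1 \<le> real (M (Suc k)) * s (Suc k) powr S" for k
    by blast+
  obtain C where C: "C > 0" "\<And>x \<rho>. 0 < \<rho> \<Longrightarrow> interval_cover (limit_map M g) x \<rho> (C * \<rho> powr S)"
    using interval_cover_holder[OF scheme S growth(2)] by blast
  show ?thesis
  proof (rule that[OF limit_map_measurable[OF scheme] exact_pt_limit_map[OF scheme] C])
    show "\<exists>\<rho>>0. \<rho> < \<rho>0 \<and> (\<forall>x. interval_cover (limit_map M g) x \<rho> (\<rho> powr (real CARD('m) - d)))"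
      if "0 < d" "0 < \<rho>0" for d \<rho>0
      using interval_cover_packing[OF scheme growth(1) that] by metis
  qed
qed

section \<open>From columns to matrices\<close>

text \<open>Borel-Cantelli over \<open>T = imaxnorm q\<close>: at most \<open>(2 T + 1) ^ n\<close>
  vectors, each contributing at most \<open>(12 * Phi T) ^ m\<close>, give terms of order
  \<open>T powr (n - m t)\<close>, summable for \<open>m t > n + 1\<close>.\<close>

lemma eventually_not_near_lattice:
  fixes f :: "real \<Rightarrow> real ^ 'm" and j0 :: "'n::finite"
  assumes f: "f \<in> borel_measurable borel" and nt: "real CARD('m) * t > real CARD('n) + 1"
  obtains G :: "(real ^ 'n ^ 'm) set" where "G \<in> sets lborel" "G \<subseteq> unit_mats" "emeasure lborel G > 0"
    "\<And>B. B \<in> G \<Longrightarrow> \<exists>T0. \<forall>q. (\<exists>j. j \<noteq> j0 \<and> q $ j \<noteq> 0) \<longrightarrow> T0 \<le> nat (imaxnorm q) \<longrightarrow> B \<notin> near_lattice i0 j0 f q (Phi (nat (imaxnorm q)))"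
proof -
  let ?n = "CARD('n)" and ?m = "CARD('m)"
  \<comment> \<open>From here on \<open>Phi T \<le> 1 / T \<le> 1/6\<close>, as
    \<open>emeasure_near_lattice\<close> requires.\<close>
  define T1 where "T1 = max q0 6"
  define Q where "Q T = {q :: int ^ 'n. (\<exists>j. j \<noteq> j0 \<and> q $ j \<noteq> 0) \<and> nat (imaxnorm q) = T}" for T
  define A where "A T = (if T1 \<le> T then \<Union>q\<in>Q T. near_lattice i0 j0 f q (Phi T) else {})" for T
  have Qsub: "Q T \<subseteq> {q. \<forall>j. q $ j \<in> {-int T..int T}}" for T
  proof
    fix q assume "q \<in> Q T"
    then have "imaxnorm q = int T" using imaxnorm_nonneg[of q] by (auto simp: Q_def)
    then have "\<bar>q $ j\<bar> \<le> int T" for j using imaxnorm_le_iff[of q "int T"] by simp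
    then have "q $ j \<in> {-int T..int T}" for j by (simp only: abs_le_iff atLeastAtMost_iff minus_le_iff)
    then show "q \<in> {q. \<forall>j. q $ j \<in> {-int T..int T}}" by blast
  qed
  have finbox: "finite {q :: int ^ 'n. \<forall>j. q $ j \<in> {-int T..int T}}" for T
    by (intro finite_vec_int) simp
  have finQ: "finite (Q T)" for T using Qsub finbox by (rule finite_subset)
  have cQ: "card (Q T) \<le> (2 * T + 1) ^ ?n" for T
  proof -
    have "card (Q T) \<le> card {q :: int ^ 'n. \<forall>j. q $ j \<in> {-int T..int T}}" using finbox Qsub by (rule card_mono)
    also have "\<dots> = (\<Prod>j\<in>(UNIV :: 'n set). card {-int T..int T})" by (rule card_vec_int)
    also have "card {-int T..int T} = 2 * T + 1" by simp
    finally have "card (Q T) \<le> (\<Prod>j\<in>(UNIV :: 'n set). 2 * T + 1)" .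
    then show ?thesis by simp
  qed
  have Ameas: "A T \<in> sets lborel" for T
    unfolding A_def using finQ near_lattice_sets[OF f] by (auto intro!: sets.finite_UN)
  define C where "C = 3 ^ ?n * (12 :: real) ^ ?m"
  have bound: "emeasure lborel (A T) \<le> ennreal (C * real T powr (real ?n - real ?m * t))" for T
  proof (cases "T1 \<le> T")
    case True
    then have T: "T \<ge> q0" "T \<ge> 6" by (auto simp: T1_def)
    have P: "0 < Phi T" using pos T by simp
    have "Phi T \<le> 1 / real T" using decay1 T by simp
    also have "\<dots> \<le> 1 / 6" using T by (intro divide_left_mono) auto
    finally have P6: "Phi T \<le> 1/6" .
    have one: "emeasure lborel (near_lattice i0 j0 f q (Phi T)) \<le> ennreal ((12 * Phi T) ^ ?m)" if q: "q \<in> Q T" for q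
    proof -
      obtain j where "j \<noteq> j0" "q $ j \<noteq> 0" using q by (auto simp: Q_def)
      then show ?thesis using f P P6 by (intro emeasure_near_lattice) auto
    qed
    have "emeasure lborel (A T) \<le> (\<Sum>q\<in>Q T. emeasure lborel (near_lattice i0 j0 f q (Phi T)))"
      unfolding A_def using True finQ near_lattice_sets[OF f] by (auto intro!: emeasure_subadditive_finite)
    also have "\<dots> \<le> (\<Sum>q\<in>Q T. ennreal ((12 * Phi T) ^ ?m))" by (intro sum_mono one)
    also have "\<dots> = ennreal (real (card (Q T)) * (12 * Phi T) ^ ?m)" using P by (subst sum_ennreal) auto
    also have "\<dots> \<le> ennreal (C * real T powr (real ?n - real ?m * t))"
    proof (rule ennreal_leI)
      have "real (card (Q T)) \<le> real ((2 * T + 1) ^ ?n)" using cQ by (simp only: of_nat_le_iff)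
      also have "\<dots> = (2 * real T + 1) ^ ?n" by (simp add: add.commute)
      also have "\<dots> \<le> (3 * real T) ^ ?n" using T by (intro power_mono) auto
      finally have a: "real (card (Q T)) \<le> (3 * real T) ^ ?n" .
      have b: "(12 * Phi T) ^ ?m \<le> (12 * real T powr (-t)) ^ ?m" using decay[OF T(1)] P by (intro power_mono mult_left_mono) auto
      have "real (card (Q T)) * (12 * Phi T) ^ ?m \<le> (3 * real T) ^ ?n * (12 * real T powr (-t)) ^ ?m"
        using P by (intro mult_mono a b) auto
      also have "\<dots> = C * (real T ^ ?n * (real T powr (-t)) ^ ?m)" by (simp add: C_def power_mult_distrib)
      also have "real T ^ ?n * (real T powr (-t)) ^ ?m = real T powr (real ?n) * real T powr (real ?m * (-t))"
        using T by (simp add: powr_power powr_realpow mult.commute)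
      also have "\<dots> = real T powr (real ?n - real ?m * t)" by (simp flip: powr_add)
      finally show "real (card (Q T)) * (12 * Phi T) ^ ?m \<le> C * real T powr (real ?n - real ?m * t)" .
    qed
    finally show ?thesis .
  qed (simp add: A_def)
  have C0: "C \<ge> 0" by (simp add: C_def)
  have "summable (\<lambda>T. real T powr (real ?n - real ?m * t))" using nt by (subst summable_real_powr_iff) simp
  then have "summable (\<lambda>T. C * real T powr (real ?n - real ?m * t))" by (rule summable_mult)
  then have summ: "summable (\<lambda>T. measure lborel (A T))"
  proof (rule summable_comparison_test'[where N = 0])
    show "norm (measure lborel (A T)) \<le> C * real T powr (real ?n - real ?m * t)" for T
      using bound[of T] C0 by (simp add: measure_def enn2real_leI)
  qed
  have "AE B in lborel. eventually (\<lambda>T. B \<in> space lborel - A T) sequentially"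
    using Ameas order.strict_trans1[OF bound ennreal_less_top] summ by (intro borel_cantelli_AE1) auto
  then obtain N where N: "{B \<in> space lborel. \<not> eventually (\<lambda>T. B \<in> space lborel - A T) sequentially} \<subseteq> N"
    "N \<in> null_sets lborel" by (auto elim!: AE_E simp: null_sets_def)
  show ?thesis
  proof (rule that[of "unit_mats - N"])
    show "unit_mats - N \<in> sets lborel" using N(2) by auto
    show "emeasure lborel (unit_mats - N) > 0"
      using emeasure_unit_mats_pos N(2) by (simp add: emeasure_Diff_null_set)
    fix B assume B: "B \<in> unit_mats - N"
    then have "eventually (\<lambda>T. B \<in> space lborel - A T) sequentially" using N(1) by auto
    then obtain T2 where T2: "\<And>T. T \<ge> T2 \<Longrightarrow> B \<notin> A T" by (auto simp: eventually_sequentially)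
    show "\<exists>T0. \<forall>q. (\<exists>j. j \<noteq> j0 \<and> q $ j \<noteq> 0) \<longrightarrow> T0 \<le> nat (imaxnorm q) \<longrightarrow> B \<notin> near_lattice i0 j0 f q (Phi (nat (imaxnorm q)))"
    proof (intro exI[of _ "max T1 T2"] allI impI)
      fix q :: "int ^ 'n" assume q: "\<exists>j. j \<noteq> j0 \<and> q $ j \<noteq> 0" "max T1 T2 \<le> nat (imaxnorm q)"
      then have "B \<notin> A (nat (imaxnorm q))" "q \<in> Q (nat (imaxnorm q))" using T2 by (auto simp: Q_def)
      then show "B \<notin> near_lattice i0 j0 f q (Phi (nat (imaxnorm q)))" using q(2) by (auto simp: A_def)
    qed
  qed auto
qed

text \<open>Solutions with \<open>q\<close> on the axis of \<open>j0\<close> correspond via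
  \<open>h\<close> to those of the single column. All others for \<open>Phi / c\<close> have bounded
  \<open>q\<close>, and each \<open>q\<close> admits only finitely many \<open>p\<close>.\<close>

lemma put_col_Exact:
  fixes f :: "real \<Rightarrow> real ^ 'm" and j0 :: "'n::finite"
  assumes B: "B \<in> unit_mats" and ex: "exact_pt Phi (f (B $ i0 $ j0))"
    and T0: "\<And>q. (\<exists>j. j \<noteq> j0 \<and> q $ j \<noteq> 0) \<Longrightarrow> T0 \<le> nat (imaxnorm q) \<Longrightarrow> B \<notin> near_lattice i0 j0 f q (Phi (nat (imaxnorm q)))"
  shows "put_col i0 j0 f B \<in> Exact Phi"
proof -
  define A where "A = put_col i0 j0 f B"
  define y where "y = f (B $ i0 $ j0)"
  define h where "h = (\<lambda>(p :: int ^ 'm, z :: int). (p, axis j0 z :: int ^ 'n))"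
  define P where "P c = {(p :: int ^ 'm, q :: int). q \<noteq> 0 \<and> (\<forall>i. \<bar>of_int q * y $ i - of_int (p $ i)\<bar> \<le> Phi (nat \<bar>q\<bar>) / c)}" for c :: real
  define S where "S c = {(p :: int ^ 'm, q :: int ^ 'n). q \<noteq> 0 \<and> maxnorm (A *v rvec q - rvec p) \<le> Phi (nat (imaxnorm q)) / c}" for c :: real
  have inj: "inj h" by (auto simp: inj_on_def h_def axis_eq_axis)
  have col: "(A *v rvec (axis j0 z)) $ i = of_int z * y $ i" for z i
  proof -
    have "(A *v rvec (axis j0 z)) $ i = (\<Sum>j\<in>UNIV. A $ i $ j * rvec (axis j0 z) $ j)"
      by (simp add: matrix_vector_mult_def)
    also have "\<dots> = (\<Sum>j\<in>UNIV. if j = j0 then of_int z * y $ i else 0)"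
      by (intro sum.cong) (auto simp: rvec_def axis_def A_def put_col_def y_def)
    finally show ?thesis by simp
  qed
  have axis0: "axis j0 z = (0 :: int ^ 'n) \<longleftrightarrow> z = 0" for z by (simp add: axis_eq_0_iff)
  have hP: "h (p, z) \<in> S c \<longleftrightarrow> (p, z) \<in> P c" for p z c
    by (simp add: h_def S_def P_def maxnorm_le_iff col axis0 imaxnorm_axis) (simp add: rvec_def)
  have "infinite (P 1)" using ex by (simp add: exact_pt_def P_def y_def)
  then have "infinite (h ` P 1)" using inj by (simp add: finite_image_iff inj_on_subset)
  moreover have "h ` P 1 \<subseteq> S 1" using hP by auto
  ultimately have "infinite (S 1)" using finite_subset by blast
  then have W1: "A \<in> W Phi" by (simp add: W_def S_def)
  have "A \<notin> W (\<lambda>t. Phi t / c)" if c: "c > 1" for c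
  proof -
    define D where "D = {q :: int ^ 'n. \<forall>j. q $ j \<in> {-int T0..int T0}}"
    define I where "I q i = {\<lceil>(A *v rvec q) $ i - Phi (nat (imaxnorm q)) / c\<rceil>..\<lfloor>(A *v rvec q) $ i + Phi (nat (imaxnorm q)) / c\<rfloor>}" for q :: "int ^ 'n" and i
    have "finite (P c)" using ex c by (simp add: exact_pt_def P_def y_def)
    moreover have "finite D" unfolding D_def by (intro finite_vec_int) simp
    moreover have "finite {p :: int ^ 'm. \<forall>i. p $ i \<in> I q i}" for q by (intro finite_vec_int) (simp add: I_def)
    ultimately have fin: "finite (h ` P c \<union> (\<Union>q\<in>D. {p :: int ^ 'm. \<forall>i. p $ i \<in> I q i} \<times> {q}))" by auto
    have "S c \<subseteq> h ` P c \<union> (\<Union>q\<in>D. {p :: int ^ 'm. \<forall>i. p $ i \<in> I q i} \<times> {q})"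
    proof
      fix x assume x: "x \<in> S c"
      obtain p q where pq: "x = (p, q)" by (cases x) auto
      have q0: "q \<noteq> 0" and app: "\<And>i. \<bar>(A *v rvec q) $ i - of_int (p $ i)\<bar> \<le> Phi (nat (imaxnorm q)) / c"
        using x by (auto simp: pq S_def maxnorm_le_iff rvec_def)
      show "x \<in> h ` P c \<union> (\<Union>q\<in>D. {p :: int ^ 'm. \<forall>i. p $ i \<in> I q i} \<times> {q})"
      proof (cases "\<exists>j. j \<noteq> j0 \<and> q $ j \<noteq> 0")
        case False
        then have "q = axis j0 (q $ j0)" by (auto simp: vec_eq_iff axis_def)
        then have "x = h (p, q $ j0)" by (simp add: pq h_def)
        then show ?thesis using hP x by blast
      next
        case True
        have "nat (imaxnorm q) \<ge> 1" using imaxnorm_pos[OF q0] by simp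
        then have "Phi (nat (imaxnorm q)) > 0" by (rule pos)
        then have "Phi (nat (imaxnorm q)) / c \<le> Phi (nat (imaxnorm q))" using c by (simp add: divide_le_eq)
        then have "\<bar>(A *v rvec q) $ i - of_int (p $ i)\<bar> \<le> Phi (nat (imaxnorm q))" for i
          using app[of i] by linarith
        then have "B \<in> near_lattice i0 j0 f q (Phi (nat (imaxnorm q)))"
          using B by (auto simp: near_lattice_def A_def)
        then have "\<not> T0 \<le> nat (imaxnorm q)" using T0[OF True] by blast
        then have "imaxnorm q \<le> int T0" by simp
        then have "\<bar>q $ j\<bar> \<le> int T0" for j using imaxnorm_le_iff by blast
        then have "q \<in> D" by (simp add: D_def abs_le_iff minus_le_iff)
        moreover have "p $ i \<in> I q i" for i
          using app[of i] unfolding I_def atLeastAtMost_iff ceiling_le_iff le_floor_iff abs_le_iff by linarith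
        ultimately show ?thesis by (auto simp: pq)
      qed
    qed
    then have "finite (S c)" using fin by (rule finite_subset)
    then show ?thesis by (simp add: W_def S_def)
  qed
  then show ?thesis using W1 unfolding Exact_def A_def by blast
qed

text \<open>The \<open>m (n - 1)\<close> entries of the other columns contribute their full
  dimension; the distinguished column adds \<open>S\<close> to the Hausdorff and \<open>m\<close> to
  the packing dimension.\<close>

theorem dim_Exact_ge:
  defines "m \<equiv> CARD('m::finite)" and "n \<equiv> CARD('n::finite)"
  assumes mt: "real m * t > real m + 2" and nt: "real m * t > real n + 1" and S: "0 \<le> S" "S \<le> real m"
    and freq: "0 < e" "frequently (\<lambda>N. real N powr e \<le> low m N powr S * real N powr (real m * (real m + 1))) sequentially"
  shows "hausdorff_dim (Exact Phi :: (real ^ 'n ^ 'm) set) \<ge> ereal (real m * (real n - 1) + S)"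
    "packing_dim (Exact Phi :: (real ^ 'n ^ 'm) set) \<ge> ereal (real m * real n)"
proof -
  let ?E = "Exact Phi :: (real ^ 'n ^ 'm) set"
  obtain f :: "real \<Rightarrow> real ^ 'm" and C where f: "f \<in> borel_measurable borel" "\<And>u. 0 \<le> u \<Longrightarrow> u < 1 \<Longrightarrow> exact_pt Phi (f u)"
    "C > 0" "\<And>x \<rho>. 0 < \<rho> \<Longrightarrow> interval_cover f x \<rho> (C * \<rho> powr S)"
    "\<And>d \<rho>0. 0 < d \<Longrightarrow> 0 < \<rho>0 \<Longrightarrow> \<exists>\<rho>>0. \<rho> < \<rho>0 \<and> (\<forall>x. interval_cover f x \<rho> (\<rho> powr (real m - d)))"
    using exact_pt_cantor_map[OF mt[unfolded m_def] S[unfolded m_def] freq[unfolded m_def]] unfolding m_def by blast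
  define i0 :: 'm where "i0 = undefined"
  define j0 :: 'n where "j0 = undefined"
  obtain G :: "(real ^ 'n ^ 'm) set" where G: "G \<in> sets lborel" "G \<subseteq> unit_mats" "emeasure lborel G > 0"
    "\<And>B. B \<in> G \<Longrightarrow> \<exists>T0. \<forall>q. (\<exists>j. j \<noteq> j0 \<and> q $ j \<noteq> 0) \<longrightarrow> T0 \<le> nat (imaxnorm q) \<longrightarrow> B \<notin> near_lattice i0 j0 f q (Phi (nat (imaxnorm q)))"
    using eventually_not_near_lattice[OF f(1) nt[unfolded m_def n_def]] by blast
  have sub: "put_col i0 j0 f ` G \<subseteq> ?E"
  proof clarify
    fix B assume B: "B \<in> G"
    then have BU: "B \<in> unit_mats" using G(2) by blast
    then have "exact_pt Phi (f (B $ i0 $ j0))" by (intro f(2)) (auto simp: unit_mats_def)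
    then show "put_col i0 j0 f B \<in> ?E" using G(4)[OF B] BU by (blast intro: put_col_Exact)
  qed
  let ?e = "m * (n - 1)"
  have n1: "real ?e = real m * (real n - 1)" by (simp add: n_def of_nat_diff Suc_leI)
  have cov: "\<exists>R\<in>sets lborel. {B \<in> G. put_col i0 j0 f B \<in> cball X \<rho>} \<subseteq> R \<and> emeasure lborel R \<le> ennreal (v * (2 * \<rho>) ^ ?e)"
    if ic: "\<And>x. interval_cover f x \<rho> v" and \<rho>: "0 < \<rho>" for X :: "real ^ 'n ^ 'm" and \<rho> v
  proof -
    obtain R where "R \<in> sets lborel" "{B \<in> unit_mats. put_col i0 j0 f B \<in> cball X \<rho>} \<subseteq> R"
      "emeasure lborel R \<le> ennreal (v * (2 * \<rho>) ^ ?e)"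
      using put_col_preimage_cover[OF ic \<rho>] unfolding m_def n_def by blast
    then show ?thesis using G(2) by blast
  qed
  show "hausdorff_dim ?E \<ge> ereal (real m * (real n - 1) + S)"
  proof (rule hausdorff_dim_ge[OF G(1,3) sub])
    show "C * 2 ^ ?e > 0" using f(3) by simp
    fix X :: "real ^ 'n ^ 'm" and \<rho> :: real assume \<rho>: "0 < \<rho>"
    have "C * \<rho> powr S * (2 * \<rho>) ^ ?e = C * 2 ^ ?e * (\<rho> ^ ?e * \<rho> powr S)" by (simp add: power_mult_distrib)
    also have "\<rho> ^ ?e * \<rho> powr S = \<rho> powr (real m * (real n - 1) + S)"
      unfolding n1[symmetric] powr_add using \<rho> by (simp only: powr_realpow)
    finally have "C * \<rho> powr S * (2 * \<rho>) ^ ?e = C * 2 ^ ?e * \<rho> powr (real m * (real n - 1) + S)" .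
    then show "\<exists>R\<in>sets lborel. {B \<in> G. put_col i0 j0 f B \<in> cball X \<rho>} \<subseteq> R \<and>
        emeasure lborel R \<le> ennreal (C * 2 ^ ?e * \<rho> powr (real m * (real n - 1) + S))"
      using cov[OF f(4)[OF \<rho>] \<rho>, of X] by (simp only:)
  qed
  show "packing_dim ?E \<ge> ereal (real m * real n)"
  proof (rule packing_dim_ge[OF G(1,3) sub])
    fix d r0 :: real assume d: "0 < d" and r0: "0 < r0"
    \<comment> \<open>Below this radius the factor \<open>2 ^ (m * (n - 1))\<close> costs at most
      \<open>\<rho> powr (-d/2)\<close>; the column uses the other half of \<open>d\<close>.\<close>
    define r1 where "r1 = min r0 ((2 ^ ?e) powr (-2/d))"
    have "r1 > 0" "d / 2 > 0" using r0 d by (auto simp: r1_def)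
    then obtain \<rho> where \<rho>: "\<rho> > 0" "\<rho> < r1" "\<And>x. interval_cover f x \<rho> (\<rho> powr (real m - d/2))"
      using f(5) by meson
    have "\<rho> powr (real m - d/2) * (2 * \<rho>) ^ ?e = 2 ^ ?e * (\<rho> powr (real m - d/2) * \<rho> ^ ?e)"
      by (simp add: power_mult_distrib)
    also have "\<rho> powr (real m - d/2) * \<rho> ^ ?e = \<rho> powr (d/2) * \<rho> powr (real m * real n - d)"
    proof -
      have "\<rho> ^ ?e = \<rho> powr (real ?e)" using \<rho>(1) by (rule powr_realpow[symmetric])
      then show ?thesis unfolding n1 by (simp add: powr_add[symmetric] algebra_simps)
    qed
    also have "2 ^ ?e * (\<rho> powr (d/2) * \<rho> powr (real m * real n - d)) \<le>
       2 ^ ?e * (((2 ^ ?e) powr (-2/d)) powr (d/2) * \<rho> powr (real m * real n - d))"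
      using \<rho> d by (intro mult_left_mono mult_right_mono powr_mono2) (auto simp: r1_def)
    also have "((2 ^ ?e) powr (-2/d)) powr (d/2) = 1 / (2 :: real) ^ ?e"
      using d by (subst powr_powr) (simp add: powr_minus_divide)
    finally have le: "\<rho> powr (real m - d/2) * (2 * \<rho>) ^ ?e \<le> \<rho> powr (real m * real n - d)" by simp
    show "\<exists>r>0. r < r0 \<and> (\<forall>X. \<exists>R\<in>sets lborel. {B \<in> G. put_col i0 j0 f B \<in> cball X r} \<subseteq> R \<and>
        emeasure lborel R \<le> ennreal (r powr (real m * real n - d)))"
    proof (intro exI[of _ \<rho>] conjI allI)
      fix X :: "real ^ 'n ^ 'm"
      show "\<exists>R\<in>sets lborel. {B \<in> G. put_col i0 j0 f B \<in> cball X \<rho>} \<subseteq> R \<and>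
        emeasure lborel R \<le> ennreal (\<rho> powr (real m * real n - d))"
        using cov[OF \<rho>(3,1), of X] ennreal_leI[OF le] by (meson order_trans)
    qed (use \<rho> in \<open>auto simp: r1_def\<close>)
  qed
qed

end

section \<open>The main theorem\<close>

text \<open>For \<open>q \<le> N ^ m \<le> T\<close> one has
  \<open>rad Phi q \<ge> Phi q / q \<ge> Phi T / N ^ m\<close>; the upper bound on \<open>T\<close>
  converts \<open>T powr (-\<tau>)\<close> into a power of \<open>N\<close>.\<close>

lemma low_lower_bound:
  assumes af: "approx_fun Phi t q0" and anti: "\<And>a b. 1 \<le> a \<Longrightarrow> a \<le> b \<Longrightarrow> Phi b \<le> Phi a"
    and N: "N \<ge> 1" "N ^ m \<le> T" "T \<le> (2 * N) ^ m" and T: "real T powr (-\<tau>) \<le> Phi T" and \<tau>: "\<tau> \<ge> 0"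
  shows "2 powr (- real m * \<tau>) * real N powr (- real m * (1 + \<tau>)) \<le> approx_fun.low Phi m N"
proof -
  have N0: "real N > 0" using N by simp
  have T1: "T \<ge> 1" using N(1,2) by (meson le_trans one_le_power)
  have "2 powr (- real m * \<tau>) * real N powr (- real m * (1 + \<tau>)) \<le> rad Phi q" if q: "1 \<le> q" "q \<le> N ^ m" for q
  proof -
    have "real T \<le> real ((2 * N) ^ m)" using N(3) by (simp only: of_nat_le_iff)
    also have "\<dots> = (2 * real N) powr real m" using N0 by (simp add: powr_realpow)
    finally have "((2 * real N) powr real m) powr (-\<tau>) \<le> real T powr (-\<tau>)" using \<tau> T1 by (intro powr_mono2') auto
    then have a: "2 powr (- real m * \<tau>) * real N powr (- real m * \<tau>) \<le> Phi q"
      using T anti[OF q(1) order_trans[OF q(2) N(2)]] by (simp add: powr_powr powr_mult)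
    have "real q \<le> real (N ^ m)" using q(2) by (simp only: of_nat_le_iff)
    then have "real q \<le> real N powr real m" using N0 by (simp add: powr_realpow)
    then have b: "real N powr (- real m) \<le> 1 / real q"
      using q(1) N0 by (simp add: powr_minus_divide frac_le)
    have "2 powr (- real m * \<tau>) * real N powr (- real m * (1 + \<tau>)) = 2 powr (- real m * \<tau>) * real N powr (- real m * \<tau>) * real N powr (- real m)"
      by (simp add: algebra_simps flip: powr_add)
    also have "\<dots> \<le> Phi q * (1 / real q)" using a b approx_fun.pos[OF af q(1)] by (intro mult_mono) auto
    also have "\<dots> \<le> rad Phi q" using approx_fun.rad_ge[OF af q(1), of 1] by simp
    finally show ?thesis .
  qed
  then show ?thesis unfolding approx_fun.low_def[OF af] using N(1) by (subst Min_ge_iff) (auto simp: Suc_le_eq)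
qed

text \<open>A favourable \<open>T\<close> is transferred to the largest \<open>N\<close> with
  \<open>N ^ m \<le> T\<close>. The right-hand side is then at least a constant times
  \<open>N powr \<eta>\<close>, and half of the positive surplus \<eta> absorbs the
  constant.\<close>

lemma frequently_low:
  assumes af: "approx_fun Phi t q0" and anti: "\<And>a b. 1 \<le> a \<Longrightarrow> a \<le> b \<Longrightarrow> Phi b \<le> Phi a"
    and m: "m \<ge> 1" and freq: "frequently (\<lambda>T. real T powr (-\<tau>) \<le> Phi T) sequentially"
    and \<tau>: "\<tau> \<ge> 0" and S: "0 \<le> S" "S * (1 + \<tau>) < real m + 1"
  obtains e where "e > 0" "frequently (\<lambda>N. real N powr e \<le> approx_fun.low Phi m N powr S * real N powr (real m * (real m + 1))) sequentially"
proof -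
  define \<eta> where "\<eta> = real m * (real m + 1 - S * (1 + \<tau>))"
  have \<eta>: "\<eta> > 0" using m S by (simp add: \<eta>_def)
  define c where "c = 2 powr (real m * \<tau> * S)"
  have "filterlim (\<lambda>N :: nat. real N powr (\<eta>/2)) at_top sequentially" using \<eta> by real_asymp
  then have "eventually (\<lambda>N :: nat. c \<le> real N powr (\<eta>/2)) sequentially" by (simp add: filterlim_at_top)
  then obtain N1 where N1: "\<And>N. N \<ge> N1 \<Longrightarrow> c \<le> real N powr (\<eta>/2)" by (auto simp: eventually_sequentially)
  have "\<exists>N\<ge>N0. real N powr (\<eta>/2) \<le> approx_fun.low Phi m N powr S * real N powr (real m * (real m + 1))" for N0
  proof -
    \<comment> \<open>The \<open>+ 1\<close> also forces \<open>N \<ge> 1\<close>.\<close>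
    obtain T where T: "T \<ge> (max N0 N1 + 1) ^ m" "real T powr (-\<tau>) \<le> Phi T"
      using freq unfolding frequently_sequentially by blast
    define N where "N = nat \<lfloor>real T powr (1/m)\<rfloor>"
    have T0: "real T > 0" using T(1) by (metis add_is_0 le_zero_eq of_nat_0_less_iff power_eq_0_iff zero_neq_one not_gr_zero)
    have Tm: "(real T powr (1/m)) ^ m = real T" using m T0 by (simp add: powr_power)
    have fl: "real N \<le> real T powr (1/m)" "real T powr (1/m) \<le> real N + 1" unfolding N_def by (rule of_nat_floor) (simp, linarith)
    have "real ((max N0 N1 + 1) ^ m) \<le> real T" using T(1) by (simp only: of_nat_le_iff)
    then have "(real (max N0 N1) + 1) ^ m \<le> (real T powr (1/m)) ^ m" unfolding Tm by (simp add: add.commute)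
    then have "real (max N0 N1) + 1 \<le> real T powr (1/m)" using m by (subst (asm) power_mono_iff) auto
    then have "real (max N0 N1) + 1 \<le> real N + 1" unfolding N_def by linarith
    then have NN: "N \<ge> N0" "N \<ge> N1" by auto
    have N1': "N \<ge> 1" using \<open>real (max N0 N1) + 1 \<le> real T powr (1/m)\<close> unfolding N_def by (simp add: le_nat_floor)
    have "real (N ^ m) \<le> real T" using power_mono[OF fl(1), of m] Tm by simp
    then have NT: "N ^ m \<le> T" by (simp only: of_nat_le_iff)
    have "real T powr (1/m) \<le> 2 * real N" using fl(2) N1' by simp
    then have "(real T powr (1/m)) ^ m \<le> (2 * real N) ^ m" by (intro power_mono) auto
    then have "real T \<le> real ((2 * N) ^ m)" unfolding Tm by simp
    then have TN: "T \<le> (2 * N) ^ m" by (simp only: of_nat_le_iff)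
    have low: "2 powr (- real m * \<tau>) * real N powr (- real m * (1 + \<tau>)) \<le> approx_fun.low Phi m N"
      by (rule low_lower_bound[OF af anti N1' NT TN T(2) \<tau>])
    have "c * real N powr (\<eta>/2) \<le> real N powr (\<eta>/2) * real N powr (\<eta>/2)"
      using N1[OF NN(2)] by (intro mult_right_mono) auto
    also have "\<dots> = real N powr \<eta>" by (simp flip: powr_add)
    finally have "real N powr (\<eta>/2) \<le> (1 / c) * real N powr \<eta>" by (simp add: c_def field_simps)
    also have "real N powr \<eta> = real N powr (- real m * (1 + \<tau>) * S) * real N powr (real m * (real m + 1))"
      unfolding \<eta>_def by (simp add: algebra_simps flip: powr_add)
    also have "(1 / c) * (real N powr (- real m * (1 + \<tau>) * S) * real N powr (real m * (real m + 1)))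
        = (2 powr (- real m * \<tau>) * real N powr (- real m * (1 + \<tau>))) powr S * real N powr (real m * (real m + 1))"
    proof -
      have "(2 powr (- real m * \<tau>) * real N powr (- real m * (1 + \<tau>))) powr S = 2 powr (- real m * \<tau> * S) * real N powr (- real m * (1 + \<tau>) * S)"
        by (simp add: powr_mult powr_powr)
      moreover have "1 / c = 2 powr (- real m * \<tau> * S)" unfolding c_def by (simp add: powr_minus_divide)
      ultimately show ?thesis by simp
    qed
    also have "\<dots> \<le> approx_fun.low Phi m N powr S * real N powr (real m * (real m + 1))"
      using low S by (intro mult_right_mono powr_mono2) auto
    finally show ?thesis using NN by blast
  qed
  then show ?thesis using that[of "\<eta>/2"] \<eta> unfolding frequently_sequentially by simp
qed

theorem theorem2p3:
  fixes Phi :: "nat \<Rightarrow> real"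
    and m_ty :: "'m::finite itself" and n_ty :: "'n::finite itself"
  defines "m \<equiv> CARD('m)" and "n \<equiv> CARD('n)"
  defines "\<theta> \<equiv> real (max (n + 1) (m + 2)) / real m"
  defines "\<tau> \<equiv> Liminf sequentially (\<lambda>t. ereal (- ln (Phi t) / ln (real t)))"
  assumes pos: "\<forall>t\<ge>1. Phi t > 0"
    and bound: "\<forall>t\<ge>1. Phi t \<le> real t powr (- (real n / real m))"
  shows "(\<tau> > ereal \<theta> \<and> (\<forall>s t. 1 \<le> s \<and> s \<le> t \<longrightarrow> Phi t \<le> Phi s) \<longrightarrow>
            hausdorff_dim (Exact Phi :: (real ^ 'n ^ 'm) set)
              \<ge> ereal (real m * (real n - 1) +
                        (if \<tau> = \<infinity> then 0 else (real m + 1) / (1 + real_of_ereal \<tau>))))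
       \<and> (\<tau> > ereal (max \<theta> ((5 + sqrt 17) / 2)) \<longrightarrow>
            hausdorff_dim (Exact Phi :: (real ^ 'n ^ 'm) set) \<ge> ereal (real m * (real n - 1))
            \<and> packing_dim (Exact Phi :: (real ^ 'n ^ 'm) set) = ereal (real m * real n))"
proof -
  let ?E = "Exact Phi :: (real ^ 'n ^ 'm) set"
  have m: "m \<ge> 1" by (simp add: m_def Suc_leI)
  have \<theta>1: "\<theta> > 1" using m by (simp add: \<theta>_def less_divide_eq)
  have exponent: "\<exists>t q0. approx_fun Phi t q0 \<and> real m * t > real m + 2 \<and> real m * t > real n + 1" if \<tau>\<theta>: "\<tau> > ereal \<theta>"
  proof -
    obtain t where t: "ereal \<theta> < ereal t" "ereal t < \<tau>" using ereal_dense2[OF \<tau>\<theta>] by blast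
    then have t\<theta>: "\<theta> < t" by simp
    then have t1: "t > 1" using \<theta>1 by simp
    have "real (max (n + 1) (m + 2)) < real m * t" using t\<theta> m by (simp add: \<theta>_def divide_less_eq mult.commute)
    then have mt: "real m * t > real m + 2" "real m * t > real n + 1" by auto
    have "eventually (\<lambda>T. ereal t < ereal (- ln (Phi T) / ln (real T))) sequentially"
      using t(2) unfolding \<tau>_def by (rule less_LiminfD)
    then have "eventually (\<lambda>T. Phi T \<le> real T powr (-t)) sequentially" using eventually_ge_at_top[of 2]
    proof eventually_elim
      case (elim T)
      have l: "ln (real T) > 0" using elim by simp
      have P: "Phi T > 0" using pos elim by simp
      have "t * ln (real T) < - ln (Phi T)" using elim(1) pos_less_divide_eq[OF l] by (simp only: less_ereal.simps)
      then have "ln (Phi T) < - t * ln (real T)" by simp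
      then have "exp (ln (Phi T)) < exp (- t * ln (real T))" by simp
      then show ?case using P elim by (simp add: powr_def)
    qed
    moreover have "filterlim (\<lambda>q :: nat. real q powr (t - 1)) at_top sequentially" using t1 by real_asymp
    then have "eventually (\<lambda>q :: nat. 2 \<le> real q powr (t - 1)) sequentially" by (simp add: filterlim_at_top)
    ultimately have "eventually (\<lambda>T. Phi T \<le> real T powr (-t) \<and> 2 \<le> real T powr (t - 1)) sequentially"
      by (rule eventually_conj)
    then obtain q0 where q0: "\<And>T. T \<ge> q0 \<Longrightarrow> Phi T \<le> real T powr (-t) \<and> 2 \<le> real T powr (t - 1)"
      unfolding eventually_sequentially by blast
    have "approx_fun Phi t (max q0 1)" using pos q0 t1 by unfold_locales auto
    then show ?thesis using mt by blast
  qed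
  \<comment> \<open>With \<open>S = 0\<close> the growth condition carries no information on
    \<open>Phi\<close> and comes down to \<open>1 \<le> m * (m + 1)\<close>.\<close>
  have triv: "frequently (\<lambda>N. real N powr 1 \<le> approx_fun.low Phi m N powr 0 * real N powr (real m * (real m + 1))) sequentially"
    if "approx_fun Phi t q0" for t q0
  proof (intro eventually_frequently)
    show "eventually (\<lambda>N. real N powr 1 \<le> approx_fun.low Phi m N powr 0 * real N powr (real m * (real m + 1))) sequentially"
      using eventually_ge_at_top[of 1]
    proof eventually_elim
      case (elim N)
      have "1 * 1 \<le> real m * (real m + 1)" using m by (intro mult_mono) auto
      then have "real N powr 1 \<le> real N powr (real m * (real m + 1))" using elim by (intro powr_mono) auto
      then show ?case using approx_fun.low_pos[OF that elim, of m] by simp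
    qed
  qed simp
  have base: "hausdorff_dim ?E \<ge> ereal (real m * (real n - 1))" "packing_dim ?E \<ge> ereal (real m * real n)" if \<tau>\<theta>: "\<tau> > ereal \<theta>"
  proof -
    obtain t q0 where t: "approx_fun Phi t q0" "real m * t > real m + 2" "real m * t > real n + 1" using exponent[OF \<tau>\<theta>] by blast
    show "hausdorff_dim ?E \<ge> ereal (real m * (real n - 1))" "packing_dim ?E \<ge> ereal (real m * real n)"
      using approx_fun.dim_Exact_ge[OF t(1) t(2,3)[unfolded m_def n_def] order_refl _ zero_less_one triv[OF t(1), unfolded m_def]]
      by (simp_all add: m_def n_def)
  qed
  have partb: "hausdorff_dim ?E \<ge> ereal (real m * (real n - 1)) \<and> packing_dim ?E = ereal (real m * real n)" if "\<tau> > ereal \<theta>"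
  proof -
    have "packing_dim ?E \<le> ereal (real m * real n)" using packing_dim_le[of ?E] by (simp add: m_def n_def mult.commute)
    then show ?thesis using base[OF that] by (simp add: antisym)
  qed
  have parta: "hausdorff_dim ?E \<ge> ereal (real m * (real n - 1) + (real m + 1) / (1 + real_of_ereal \<tau>))"
    if \<tau>\<theta>: "\<tau> > ereal \<theta>" and fin: "\<tau> \<noteq> \<infinity>" and anti: "\<forall>s t. 1 \<le> s \<and> s \<le> t \<longrightarrow> Phi t \<le> Phi s"
  proof (rule ccontr)
    obtain T where T: "\<tau> = ereal T" using \<tau>\<theta> fin by (cases \<tau>) auto
    have T\<theta>: "T > \<theta>" using \<tau>\<theta> T by simp
    then have T1: "T > 1" using \<theta>1 by simp
    define S0 where "S0 = (real m + 1) / (1 + T)"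
    have S0: "S0 > 0" using T1 by (simp add: S0_def)
    assume "\<not> ?thesis"
    then have "hausdorff_dim ?E < ereal (real m * (real n - 1) + S0)" by (simp add: T S0_def)
    then obtain z where z: "hausdorff_dim ?E < ereal z" "z < real m * (real n - 1) + S0"
      by (meson ereal_dense2 less_ereal.simps(1))
    \<comment> \<open>\<open>S\<close> stays strictly below \<open>S0\<close>, as
      \<open>frequently_low\<close> demands, yet reaches past the supposed dimension;
      \<open>max 0\<close> keeps it a valid exponent.\<close>
    define S where "S = max 0 (z - real m * (real n - 1))"
    have S: "0 \<le> S" "S < S0" "z \<le> real m * (real n - 1) + S" using z(2) S0 by (auto simp: S_def)
    \<comment> \<open>\<open>T > 1\<close> gives \<open>S0 \<le> (m + 1) / 2 \<le> m\<close>, so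
      \<open>S\<close> does not exceed the dimension of a column.\<close>
    have "S0 \<le> (real m + 1) / 2" unfolding S0_def using T1 by (intro divide_left_mono) auto
    then have Sm: "S \<le> real m" using S m by simp
    have "S * (1 + T) < real m + 1" using S(2) T1 by (simp add: S0_def less_divide_eq)
    \<comment> \<open>The lower limit gives \<open>Phi q \<ge> q powr (-\<tau>1)\<close> infinitely
      often for exponents above \<open>T\<close>. At most half of the slack in
      \<open>S * (1 + T) < m + 1\<close> is spent on the excess; \<open>S + 1\<close> avoids a
      division by zero.\<close>
    define \<tau>1 where "\<tau>1 = T + (real m + 1 - S * (1 + T)) / (2 * (S + 1))"
    have \<tau>1: "\<tau>1 > T" using \<open>S * (1 + T) < real m + 1\<close> S(1) by (simp add: \<tau>1_def)
    have "S * (1 + \<tau>1) = S * (1 + T) + (S / (S + 1)) * ((real m + 1 - S * (1 + T)) / 2)"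
      using S(1) by (simp add: \<tau>1_def field_simps)
    also have "\<dots> \<le> S * (1 + T) + 1 * ((real m + 1 - S * (1 + T)) / 2)"
      using S(1) \<open>S * (1 + T) < real m + 1\<close> by (intro add_left_mono mult_right_mono) auto
    also have "\<dots> < real m + 1" using \<open>S * (1 + T) < real m + 1\<close> by (simp add: field_simps)
    finally have S\<tau>: "S * (1 + \<tau>1) < real m + 1" .
    have "frequently (\<lambda>q. ereal (- ln (Phi q) / ln (real q)) < ereal \<tau>1) sequentially"
    proof (rule ccontr)
      assume "\<not> ?thesis"
      then have "eventually (\<lambda>q. ereal \<tau>1 \<le> ereal (- ln (Phi q) / ln (real q))) sequentially"
        by (simp add: not_frequently not_less)
      then have "ereal \<tau>1 \<le> \<tau>" unfolding \<tau>_def by (rule Liminf_bounded)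
      then show False using \<tau>1 T by simp
    qed
    from frequently_eventually_conj[OF this eventually_ge_at_top[of 2]]
    have freq: "frequently (\<lambda>q. real q powr (-\<tau>1) \<le> Phi q) sequentially"
    proof (rule frequently_elim1, elim conjE)
      fix q :: nat assume q: "2 \<le> q" "ereal (- ln (Phi q) / ln (real q)) < ereal \<tau>1"
      have l: "ln (real q) > 0" using q by simp
      have P: "Phi q > 0" using pos q by simp
      have "- ln (Phi q) < \<tau>1 * ln (real q)" using q(2) pos_divide_less_eq[OF l] by (simp only: less_ereal.simps)
      then have "exp (- \<tau>1 * ln (real q)) < exp (ln (Phi q))" by simp
      then show "real q powr (-\<tau>1) \<le> Phi q" using P q by (simp add: powr_def)
    qed
    obtain t q0 where t: "approx_fun Phi t q0" "real m * t > real m + 2" "real m * t > real n + 1" using exponent[OF \<tau>\<theta>] by blast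
    have anti': "\<And>a b. 1 \<le> a \<Longrightarrow> a \<le> b \<Longrightarrow> Phi b \<le> Phi a" using anti by blast
    obtain e where e: "e > 0"
      "frequently (\<lambda>N. real N powr e \<le> approx_fun.low Phi m N powr S * real N powr (real m * (real m + 1))) sequentially"
      using frequently_low[OF t(1) anti' m freq _ S(1) S\<tau>] \<tau>1 T1 by auto
    have "hausdorff_dim ?E \<ge> ereal (real m * (real n - 1) + S)"
      using approx_fun.dim_Exact_ge(1)[OF t(1) t(2,3)[unfolded m_def n_def] S(1) Sm[unfolded m_def] e(1) e(2)[unfolded m_def]]
      by (simp add: m_def n_def)
    moreover have "ereal z \<le> ereal (real m * (real n - 1) + S)" using S(3) by simp
    ultimately show False using z(1) by (meson leD order_trans)
  qed
  show ?thesis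
  proof (intro conjI impI; (elim conjE)?)
    assume a: "\<tau> > ereal \<theta>" "\<forall>s t. 1 \<le> s \<and> s \<le> t \<longrightarrow> Phi t \<le> Phi s"
    show "hausdorff_dim ?E \<ge> ereal (real m * (real n - 1) + (if \<tau> = \<infinity> then 0 else (real m + 1) / (1 + real_of_ereal \<tau>)))"
      using base(1)[OF a(1)] parta[OF a(1) _ a(2)] by simp
  next
    assume "\<tau> > ereal (max \<theta> ((5 + sqrt 17) / 2))"
    moreover have "ereal \<theta> \<le> ereal (max \<theta> ((5 + sqrt 17) / 2))" by simp
    ultimately have "\<tau> > ereal \<theta>" by (rule order.strict_trans1[rotated])
    then show "hausdorff_dim ?E \<ge> ereal (real m * (real n - 1))" "packing_dim ?E = ereal (real m * real n)"
      using partb by blast+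
  qed
qed

end
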